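(* Let $\tau_1,\tau_2,\tilde\tau_1,\tilde\tau_2\in L_2(0,1)$ be complex-valued, put $p=\tau_1'$, $q=\tau_2''$ (distributional derivatives, so $p\in W_2^{-1}(0,1)$, $q\in W_2^{-2}(0,1)$) and similarly $\tilde p=\tilde\tau_1'$, $\tilde q=\tilde\tau_2''$. Let $$F(x)=\begin{pmatrix}0&1&0&0\\-\tau_2&\tau_1&1&0\\\tau_1\tau_2&-\tau_1^2+2\tau_2&-\tau_1&1\\\tau_2^2&-\tau_1\tau_2&-\tau_2&0\end{pmatrix},$$ the associated matrix of $l_4(y)=y^{(4)}-(py')'+qy$, and let $\tilde F$ be defined analogously with $\tilde\tau_1,\tilde\tau_2$. Assume that $\mathcal L=(F,U,V)$ and $\tilde{\mathcal L}=(\tilde F,U,V)$ both satisfy the separation assumption. For $(i,j)\in\{(1,2),(1,3),(2,3)\}$ let $\mathfrak S_{ij}$ be the spectrum of the boundary value problem $y^{[4]}=\lambda y$, $U_i(y)=U_j(y)=0$, $V_3(y)=V_4(y)=0$, and $\tilde{\mathfrak S}_{ij}$ the analogous spectrum for $\tilde{\mathcal L}$. If $\mathfrak S_{12}=\tilde{\mathfrak S}_{12}$, $\mathfrak S_{13}=\tilde{\mathfrak S}_{13}$ and $\mathfrak S_{23}=\tilde{\mathfrak S}_{23}$, then $p=\tilde p$ in $W_2^{-1}(0,1)$ and $q=\tilde q$ in $W_2^{-2}(0,1)$.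
   Context: General setting (order $n$). Let $F(x)=[f_{k,j}(x)]_{k,j=1}^n$ be a complex-valued matrix function on $[0,1]$ with $f_{k,j}\equiv0$ for $j>k+1$, $f_{k,k+1}\equiv1$, $f_{k,k}\in L_2(0,1)$, $f_{k,j}\in L_1(0,1)$ for $k>j$, and $\operatorname{trace}F\equiv0$. Quasi-derivatives: $y^{[0]}=y$, $y^{[k]}=(y^{[k-1]})'-\sum_{j=1}^k f_{k,j}y^{[j-1]}$, $k=1,\dots,n$. Let $\mathcal D_F=\{y: y^{[k]}\in AC[0,1],\ k=0,\dots,n-1\}$. A solution of $y^{[n]}=\lambda y$ ($\lambda\in\mathbb C$) is a function $y\in\mathcal D_F$ with $y^{[n]}=\lambda y$ a.e. on $(0,1)$. Linear forms: $U_s(y)=y^{[n-s]}(0)$, $V_s(y)=y^{[n-s]}(1)$, $s=1,\dots,n$. Let $C_k(x,\lambda)$, $k=1,\dots,n$, be the solutions with $U_s(C_k)=\delta_{s,k}$. Put $\Delta_{k,k}(\lambda)=\det[V_s(C_r)]_{s,r=k+1}^n$ (with $\Delta_{n,n}\equiv1$), and for $j>k$ let $\Delta_{j,k}(\lambda)$ be obtained from $\Delta_{k,k}(\lambda)$ by replacing $C_j$ by $C_k$; these are entire functions of $\lambda$. Separation assumption: for each $1\le m\le n-1$, $\Delta_{m,m}$ and $\Delta_{m+1,m+1}$ have no common zeros. The problem $\mathcal L=(F,U,V)$ is this data; objects for $\tilde{\mathcal L}$ (built from $\tilde F$ in the same way) carry a tilde. The spectrum of a boundary value problem $y^{[n]}=\lambda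 y$, $W_1(y)=\dots=W_n(y)=0$, where each $W_i$ is one of the forms $U_s,V_s$, is the multiset of zeros, counted with multiplicities, of the entire function $\det[W_i(C_r(\cdot,\lambda))]_{i,r=1}^n$. Here $n=4$. *)

theory Defs
  imports "HOL-Analysis.Analysis" "HOL-Library.Extended_Nat"
begin

definition L2_01 :: "(real \<Rightarrow> complex) \<Rightarrow> bool" where
  "L2_01 f \<longleftrightarrow> set_borel_measurable lborel {0..1} f
      \<and> set_integrable lborel {0..1} (\<lambda>x. complex_of_real ((cmod (f x))\<^sup>2))"

definition abs_cont_on :: "real \<Rightarrow> real \<Rightarrow> (real \<Rightarrow> complex) \<Rightarrow> bool" where
  "abs_cont_on a b f \<longleftrightarrow>
     (\<forall>e>0. \<exists>d>0. \<forall>(m::nat) (u::nat \<Rightarrow> real) v.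
        (\<forall>i<m. a \<le> u i \<and> u i \<le> v i \<and> v i \<le> b)
      \<and> (\<forall>i<m. \<forall>j<m. i \<noteq> j \<longrightarrow> v i \<le> u j \<or> v j \<le> u i)
      \<and> (\<Sum>i<m. v i - u i) < d
      \<longrightarrow> (\<Sum>i<m. cmod (f (v i) - f (u i))) < e)"

text \<open>Matrix functions F = [f_{k,j}], indices k,j = 1..n.\<close>
type_synonym mfun = "nat \<Rightarrow> nat \<Rightarrow> real \<Rightarrow> complex"

text \<open>Y k, k = 0..n, are the quasi-derivatives y^{[k]} of y = Y 0 w.r.t. F:
  Y 0, ..., Y (n-1) are absolutely continuous on [0,1] (i.e. y in D_F) and a.e. on (0,1)
  y^{[k]} = (y^{[k-1]})' - sum_{j=1}^k f_{k,j} y^{[j-1]}, k = 1..n.\<close>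
definition quasi_derivs :: "nat \<Rightarrow> mfun \<Rightarrow> (nat \<Rightarrow> real \<Rightarrow> complex) \<Rightarrow> bool" where
  "quasi_derivs n F Y \<longleftrightarrow>
     (\<forall>k<n. abs_cont_on 0 1 (Y k))
   \<and> (AE x in lborel. x \<in> {0<..<1} \<longrightarrow>
        (\<forall>k\<in>{1..n}. (Y (k - 1) has_vector_derivative
                        (Y k x + (\<Sum>j=1..k. F k j x * Y (j - 1) x))) (at x)))"

definition is_solution :: "nat \<Rightarrow> mfun \<Rightarrow> complex \<Rightarrow> (nat \<Rightarrow> real \<Rightarrow> complex) \<Rightarrow> bool" where
  "is_solution n F lam Y \<longleftrightarrow> quasi_derivs n F Y
     \<and> (AE x in lborel. x \<in> {0<..<1} \<longrightarrow> Y n x = lam * Y 0 x)"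

text \<open>The solution C_k(x,lambda) (with its quasi-derivatives) normalised by
  U_s(C_k) = C_k^{[n-s]}(0) = delta_{s,k}, s = 1..n.\<close>
definition fund_sol :: "nat \<Rightarrow> mfun \<Rightarrow> complex \<Rightarrow> nat \<Rightarrow> nat \<Rightarrow> real \<Rightarrow> complex" where
  "fund_sol n F lam k = (SOME Y. is_solution n F lam Y
       \<and> (\<forall>s\<in>{1..n}. Y (n - s) 0 = (if s = k then 1 else 0)))"

text \<open>Linear forms: (False, s) stands for U_s, (True, s) for V_s;
  value of the form on C_r.\<close>
definition bform :: "nat \<Rightarrow> mfun \<Rightarrow> complex \<Rightarrow> bool \<times> nat \<Rightarrow> nat \<Rightarrow> complex" where
  "bform n F lam W r = fund_sol n F lam r (n - snd W) (if fst W then 1 else 0)"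

definition detI :: "nat set \<Rightarrow> (nat \<Rightarrow> nat \<Rightarrow> complex) \<Rightarrow> complex" where
  "detI I M = (\<Sum>p | p permutes I. of_int (sign p) * (\<Prod>i\<in>I. M i (p i)))"

definition Delta :: "nat \<Rightarrow> mfun \<Rightarrow> nat \<Rightarrow> complex \<Rightarrow> complex" where
  "Delta n F k lam = detI {k+1..n} (\<lambda>s r. bform n F lam (True, s) r)"

definition separation :: "nat \<Rightarrow> mfun \<Rightarrow> bool" where
  "separation n F \<longleftrightarrow>
     (\<forall>m\<in>{1..n-1}. \<not> (\<exists>lam. Delta n F m lam = 0 \<and> Delta n F (m+1) lam = 0))"

definition char_fun :: "nat \<Rightarrow> mfun \<Rightarrow> (nat \<Rightarrow> bool \<times> nat) \<Rightarrow> complex \<Rightarrow> complex" where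
  "char_fun n F W lam = detI {1..n} (\<lambda>i r. bform n F lam (W i) r)"

definition zero_mult :: "(complex \<Rightarrow> complex) \<Rightarrow> complex \<Rightarrow> enat" where
  "zero_mult f z = (if \<exists>k. (deriv ^^ k) f z \<noteq> 0
                    then enat (LEAST k. (deriv ^^ k) f z \<noteq> 0) else \<infinity>)"

text \<open>Spectrum as multiset of zeros, represented by its multiplicity function.\<close>
definition spectrum :: "nat \<Rightarrow> mfun \<Rightarrow> (nat \<Rightarrow> bool \<times> nat) \<Rightarrow> complex \<Rightarrow> enat" where
  "spectrum n F W = zero_mult (char_fun n F W)"

definition W_ij :: "nat \<Rightarrow> nat \<Rightarrow> nat \<Rightarrow> bool \<times> nat" where
  "W_ij i j a = (if a = 1 then (False, i) else if a = 2 then (False, j)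
                 else if a = 3 then (True, 3) else (True, 4))"

text \<open>Associated matrix of l_4(y) = y'''' - (p y')' + q y, p = tau1', q = tau2''.\<close>
definition Fmat :: "(real \<Rightarrow> complex) \<Rightarrow> (real \<Rightarrow> complex) \<Rightarrow> mfun" where
  "Fmat t1 t2 k j x =
    (if k = 1 then (if j = 2 then 1 else 0)
     else if k = 2 then (if j = 1 then - t2 x else if j = 2 then t1 x else if j = 3 then 1 else 0)
     else if k = 3 then (if j = 1 then t1 x * t2 x else if j = 2 then - (t1 x)\<^sup>2 + 2 * t2 x
                         else if j = 3 then - t1 x else if j = 4 then 1 else 0)
     else if k = 4 then (if j = 1 then (t2 x)\<^sup>2 else if j = 2 then - t1 x * t2 x
                         else if j = 3 then - t2 x else 0)
     else 0)"

definition vderiv_iter :: "nat \<Rightarrow> (real \<Rightarrow> complex) \<Rightarrow> real \<Rightarrow> complex" where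
  "vderiv_iter k \<phi> = ((\<lambda>g x. vector_derivative g (at x)) ^^ k) \<phi>"

definition test_fun :: "(real \<Rightarrow> complex) \<Rightarrow> bool" where
  "test_fun \<phi> \<longleftrightarrow> (\<forall>k x. vderiv_iter k \<phi> differentiable (at x))
     \<and> (\<exists>a b. 0 < a \<and> b < 1 \<and> (\<forall>x. x \<notin> {a..b} \<longrightarrow> \<phi> x = 0))"

definition distr_deriv :: "nat \<Rightarrow> (real \<Rightarrow> complex) \<Rightarrow> (real \<Rightarrow> complex) \<Rightarrow> complex" where
  "distr_deriv k \<tau> \<phi> = (-1) ^ k * (LINT x:{0..1}|lborel. \<tau> x * vderiv_iter k \<phi> x)"

end

theory Submission
  imports Defs "HOL-Complex_Analysis.Complex_Analysis"
begin

text \<open>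
  The solutions with \<open>V_3 = V_4 = 0\<close> form a two-dimensional space, which is determined by its values at 0,
  that is, by the 2 x 2 minors of the rows \<open>V_3, V_4\<close> of the fundamental matrix. The form \<open>bracket\<close> is
  constant on pairs of solutions and vanishes on this space. Hence the minors satisfy, besides the quadratic
  Pluecker relation, one linear relation, and the three minors with the given spectra as zeros determine all
  the ratios that occur: zero-free entire functions of order at most 1/4 are constant, and at a zero of the first
  minor the fourth one is given by the Pluecker relation, because the separation assumption excludes common
  zeros of the first two.

  On the ray \<open>\<lambda> = -4 s^4\<close> the characteristic exponents are \<open>s(\<plusminus>1 \<plusminus> i)\<close>: two solutions grow, the two clamped ones
  decay, and within each pair the rates agree. So the matrix which maps the solutions of one problem to those of the
  other with the same initial values, entire of order at most 1/4 in \<open>\<lambda>\<close>, is controlled there by the common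
  two-dimensional space alone. By Phragmen-Lindelof its entries above the diagonal vanish, and its
  differential equation then forces the coefficients to coincide almost everywhere.
\<close>

section \<open>Absolutely continuous functions\<close>

text \<open>For positive \<open>\<lambda>\<close> two characteristic exponents would be purely
  imaginary and would neither grow nor decay; on the negative ray the gap 2 s between growth and
  decay matches the two clamping conditions at the right end. One ray suffices, because
  Phragmen-Lindelof in a plane slit along a ray admits every order below 1/2, and all entire
  functions here have order at most 1/4. The obstacle is that the coefficients are only integrable.
  The perturbation does not become small in norm as s grows, and no rate of convergence is
  available. What is small is its integral against kernels concentrated at a point, and this gives
  limits, which are enough: a nonzero limit of a ratio fixes a constant of proportionality, and the
  rest is power counting. The entry (i, j) of \<open>Q\<close> is bounded by a multiple of s^(i+j-3)
  on the ray, which decays for i + j < 3. The quasi-derivatives contain \<open>t1\<close> and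
  \<open>t2\<close> themselves, so the argument recovers these functions almost everywhere, and
  equality of the distributional derivatives is a consequence.\<close>

definition short_family :: "real \<Rightarrow> real \<Rightarrow> real \<Rightarrow> nat \<Rightarrow> (nat \<Rightarrow> real) \<Rightarrow> (nat \<Rightarrow> real) \<Rightarrow> bool" where
  "short_family a b d m u v \<longleftrightarrow>
        (\<forall>i<m. a \<le> u i \<and> u i \<le> v i \<and> v i \<le> b)
      \<and> (\<forall>i<m. \<forall>j<m. i \<noteq> j \<longrightarrow> v i \<le> u j \<or> v j \<le> u i)
      \<and> (\<Sum>i<m. v i - u i) < d"

text \<open>\<open>abs_cont_on\<close> speaks of complex values only, whereas the Gronwall argument
  needs real-valued functions.\<close>

definition acon :: "real \<Rightarrow> real \<Rightarrow> (real \<Rightarrow> 'a::real_normed_vector) \<Rightarrow> bool" where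
  "acon a b f \<longleftrightarrow>
     (\<forall>e>0. \<exists>d>0. \<forall>(m::nat) (u::nat \<Rightarrow> real) v.
        short_family a b d m u v
      \<longrightarrow> (\<Sum>i<m. norm (f (v i) - f (u i))) < e)"

lemma aconE:
  assumes "acon a b f" "e > 0"
  obtains d where "d > 0" "\<forall>(m::nat) (u::nat \<Rightarrow> real) v. short_family a b d m u v
      \<longrightarrow> (\<Sum>i<m. norm (f (v i) - f (u i))) < e"
  using assms unfolding acon_def by blast

lemma acon_iff_abs_cont_on: "acon a b f \<longleftrightarrow> abs_cont_on a b f"
  unfolding acon_def abs_cont_on_def short_family_def ..

definition short_indexed_family :: "real \<Rightarrow> real \<Rightarrow> real \<Rightarrow> 'i set \<Rightarrow> ('i \<Rightarrow> real) \<Rightarrow> ('i \<Rightarrow> real) \<Rightarrow> bool" where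
  "short_indexed_family a b d S u v \<longleftrightarrow> finite S \<and> (\<forall>i\<in>S. a \<le> u i \<and> u i \<le> v i \<and> v i \<le> b)
     \<and> (\<forall>i\<in>S. \<forall>j\<in>S. i \<noteq> j \<longrightarrow> v i \<le> u j \<or> v j \<le> u i) \<and> (\<Sum>i\<in>S. v i - u i) < d"

text \<open>Tagged divisions are sets of pairs, so the proof of
  \<open>fundamental_theorem_acon\<close> needs families indexed by an arbitrary finite set.\<close>

lemma acon_finite_family:
  assumes "acon a b f" "e > 0"
  obtains d where "d > 0"
    "\<forall>(S::'i set) u v. short_indexed_family a b d S u v \<longrightarrow> (\<Sum>i\<in>S. norm (f (v i) - f (u i))) < e"
proof -
  from assms obtain d where d: "d > 0" "\<forall>(m::nat) (u::nat \<Rightarrow> real) v. short_family a b d m u v \<longrightarrow> (\<Sum>i<m. norm (f (v i) - f (u i))) < e"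
    by (rule aconE) blast
  show thesis
  proof (rule that[OF d(1)], intro allI impI)
    fix S :: "'i set" and u v
    assume "short_indexed_family a b d S u v"
    then have fin: "finite S" and uv: "\<And>i. i \<in> S \<Longrightarrow> a \<le> u i \<and> u i \<le> v i \<and> v i \<le> b"
      and dj: "\<And>i j. \<lbrakk>i \<in> S; j \<in> S; i \<noteq> j\<rbrakk> \<Longrightarrow> v i \<le> u j \<or> v j \<le> u i"
      and len: "(\<Sum>i\<in>S. v i - u i) < d"
      by (auto simp: short_indexed_family_def)
    obtain h where h: "bij_betw h {..<card S} S"
      using ex_bij_betw_nat_finite[OF fin] by (auto simp: atLeast0LessThan)
    have mem: "h i \<in> S" if "i < card S" for i using h that by (auto simp: bij_betw_def)
    have inj: "h i \<noteq> h j" if "i < card S" "j < card S" "i \<noteq> j" for i j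
      using h that by (auto simp: bij_betw_def inj_on_def)
    have s: "(\<Sum>i\<in>S. q i) = (\<Sum>i<card S. q (h i))" for q :: "'i \<Rightarrow> real"
      using sum.reindex_bij_betw[OF h, of q] by simp
    have "(\<Sum>i<card S. norm (f (v (h i)) - f (u (h i)))) < e"
      by (rule d(2)[rule_format, of "card S" "u \<circ> h" "v \<circ> h", simplified o_def])
         (use uv dj mem inj len s[of "\<lambda>i. v i - u i"] in \<open>auto simp: o_def short_family_def\<close>)
    then show "(\<Sum>i\<in>S. norm (f (v i) - f (u i))) < e" by (simp add: s)
  qed
qed

lemma acon_continuous_on:
  assumes "acon a b f" shows "continuous_on {a..b} f"
  unfolding continuous_on_iff
proof (intro ballI allI impI)
  fix x e :: real assume x: "x \<in> {a..b}" and e: "e > 0"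
  obtain d where d: "d > 0" "\<forall>(S::nat set) u v. short_indexed_family a b d S u v \<longrightarrow> (\<Sum>i\<in>S. norm (f (v i) - f (u i))) < e"
    using acon_finite_family[OF assms e] by blast
  show "\<exists>d>0. \<forall>x'\<in>{a..b}. dist x' x < d \<longrightarrow> dist (f x') (f x) < e"
  proof (intro exI[of _ d] conjI ballI impI d)
    fix y assume y: "y \<in> {a..b}" "dist y x < d"
    have "norm (f (max x y) - f (min x y)) < e"
      using d(2)[rule_format, of "{0}" "\<lambda>_. min x y" "\<lambda>_. max x y"] x y
      by (auto simp: dist_real_def short_indexed_family_def max_def min_def)
    then show "dist (f y) (f x) < e"
      by (auto simp: dist_norm norm_minus_commute max_def min_def split: if_splits)
  qed
qed

text \<open>Common source of the closure properties: sums, products and Lipschitz images all have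
  increments that are controlled linearly by those of their constituents.\<close>

lemma acon_dominated:
  fixes f :: "real \<Rightarrow> 'a::real_normed_vector" and g :: "real \<Rightarrow> 'b::real_normed_vector"
    and h :: "real \<Rightarrow> 'c::real_normed_vector"
  assumes "acon a b f" "acon a b g" "L \<ge> 0"
    and dom: "\<And>u v. a \<le> u \<Longrightarrow> u \<le> v \<Longrightarrow> v \<le> b \<Longrightarrow>
       norm (h v - h u) \<le> L * (norm (f v - f u) + norm (g v - g u))"
  shows "acon a b h"
  unfolding acon_def
proof (intro allI impI)
  fix e :: real assume "e > 0"
  \<comment> \<open>The added 1 avoids division by 0 and makes \<open>L * (e' + e')\<close> strictly
    smaller than \<open>e\<close>.\<close>
  define e' where "e' = e / (2 * (L + 1))"
  have e': "e' > 0" using \<open>e > 0\<close> \<open>L \<ge> 0\<close> by (auto simp: e'_def)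
  have "2 * (L + 1) * e' = e" using \<open>L \<ge> 0\<close> by (simp add: e'_def)
  then have e'': "L * (e' + e') < e" using e' by (simp add: algebra_simps)
  from assms(1) e' obtain d1 where d1: "d1 > 0" "\<forall>(m::nat) (u::nat \<Rightarrow> real) v. short_family a b d1 m u v \<longrightarrow> (\<Sum>i<m. norm (f (v i) - f (u i))) < e'"
    by (rule aconE) blast
  from assms(2) e' obtain d2 where d2: "d2 > 0" "\<forall>(m::nat) (u::nat \<Rightarrow> real) v. short_family a b d2 m u v \<longrightarrow> (\<Sum>i<m. norm (g (v i) - g (u i))) < e'"
    by (rule aconE) blast
  show "\<exists>d>0. \<forall>(m::nat) (u::nat \<Rightarrow> real) v.
        short_family a b d m u v
      \<longrightarrow> (\<Sum>i<m. norm (h (v i) - h (u i))) < e"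
  proof (intro exI[of _ "min d1 d2"] conjI allI impI)
    fix m :: nat and u v :: "nat \<Rightarrow> real"
    assume A: "short_family a b (min d1 d2) m u v"
    have "(\<Sum>i<m. norm (h (v i) - h (u i)))
        \<le> (\<Sum>i<m. L * (norm (f (v i) - f (u i)) + norm (g (v i) - g (u i))))"
      by (intro sum_mono dom) (use A in \<open>auto simp: short_family_def\<close>)
    also have "\<dots> = L * ((\<Sum>i<m. norm (f (v i) - f (u i))) + (\<Sum>i<m. norm (g (v i) - g (u i))))"
      by (simp add: sum.distrib sum_distrib_left distrib_left)
    also have "\<dots> \<le> L * (e' + e')"
      using d1(2)[rule_format, of m u v] d2(2)[rule_format, of m u v] A \<open>L \<ge> 0\<close>
      by (intro mult_left_mono add_mono) (auto simp: short_family_def)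
    finally show "(\<Sum>i<m. norm (h (v i) - h (u i))) < e" using e'' by simp
  qed (use d1 d2 in auto)
qed

lemma acon_id: "acon a b (\<lambda>x. x)"
  unfolding acon_def
proof (intro allI impI)
  fix e :: real assume "e > 0"
  show "\<exists>d>0. \<forall>(m::nat) (u::nat \<Rightarrow> real) v.
        short_family a b d m u v
      \<longrightarrow> (\<Sum>i<m. norm (v i - u i)) < e"
    by (intro exI[of _ e]) (use \<open>e > 0\<close> in \<open>auto simp: short_family_def\<close>)
qed

lemma acon_lipschitz:
  assumes "acon a b f" "L \<ge> 0"
    and "\<And>u v. a \<le> u \<Longrightarrow> u \<le> v \<Longrightarrow> v \<le> b \<Longrightarrow> norm (h v - h u) \<le> L * norm (f v - f u)"
  shows "acon a b h"
proof (rule acon_dominated[OF assms(1) acon_id assms(2)])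
  fix u v assume "a \<le> u" "u \<le> v" "v \<le> b"
  then have "norm (h v - h u) \<le> L * norm (f v - f u)" by (rule assms(3))
  also have "\<dots> \<le> L * (norm (f v - f u) + norm (v - u))" using assms(2) by (intro mult_left_mono) auto
  finally show "norm (h v - h u) \<le> \<dots>" .
qed

lemma acon_const: "acon a b (\<lambda>x. c)"
  by (rule acon_lipschitz[OF acon_id[of a b], of 0]) auto

lemma acon_add: "acon a b f \<Longrightarrow> acon a b g \<Longrightarrow> acon a b (\<lambda>x. f x + g x)"
  by (rule acon_dominated[of _ _ f g 1])
     (auto simp: add_diff_add intro: norm_triangle_ineq)

lemma acon_minus: "acon a b f \<Longrightarrow> acon a b (\<lambda>x. - f x)"
  by (rule acon_lipschitz[of _ _ f 1]) (auto simp: norm_minus_commute)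

lemma acon_diff: "acon a b f \<Longrightarrow> acon a b g \<Longrightarrow> acon a b (\<lambda>x. f x - g x)"
  using acon_add[of a b f "\<lambda>x. - g x"] acon_minus[of a b g] by simp

lemma acon_mult:
  fixes f g :: "real \<Rightarrow> 'a::real_normed_algebra"
  assumes "acon a b f" "acon a b g"
  shows "acon a b (\<lambda>x. f x * g x)"
proof -
  have "bounded (f ` {a..b})" "bounded (g ` {a..b})"
    using assms acon_continuous_on compact_continuous_image compact_imp_bounded compact_Icc by blast+
  then obtain A B where A: "\<And>x. x \<in> {a..b} \<Longrightarrow> norm (f x) \<le> A" and B: "\<And>x. x \<in> {a..b} \<Longrightarrow> norm (g x) \<le> B"
    unfolding bounded_iff by blast
  define L where "L = max 0 (max A B)"
  show ?thesis
  proof (rule acon_dominated[OF assms, of L])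
    fix u v assume uv: "a \<le> u" "u \<le> v" "v \<le> b"
    have "f v * g v - f u * g u = (f v - f u) * g v + f u * (g v - g u)" by (simp add: algebra_simps)
    also have "norm \<dots> \<le> norm (f v - f u) * norm (g v) + norm (f u) * norm (g v - g u)"
      by (meson add_mono norm_mult_ineq norm_triangle_le)
    also have "\<dots> \<le> norm (f v - f u) * L + L * norm (g v - g u)"
      using A[of u] B[of v] uv by (intro add_mono mult_mono) (auto simp: L_def)
    finally show "norm (f v * g v - f u * g u) \<le> L * (norm (f v - f u) + norm (g v - g u))"
      by (simp add: algebra_simps)
  qed (auto simp: L_def)
qed

lemma acon_subset:
  assumes "acon a b f" "a \<le> c" "d \<le> b" shows "acon c d f"
  unfolding acon_def
proof (intro allI impI)
  fix e :: real assume "e > 0"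
  with assms(1) obtain d1 where d1: "d1 > 0" "\<forall>(m::nat) (u::nat \<Rightarrow> real) v. short_family a b d1 m u v \<longrightarrow> (\<Sum>i<m. norm (f (v i) - f (u i))) < e"
    by (rule aconE) blast
  show "\<exists>d1>0. \<forall>(m::nat) (u::nat \<Rightarrow> real) v.
        short_family c d d1 m u v
      \<longrightarrow> (\<Sum>i<m. norm (f (v i) - f (u i))) < e"
    by (intro exI[of _ d1] conjI d1(1) allI impI d1(2)[rule_format]) (use assms in \<open>force simp: short_family_def\<close>)
qed

lemma acon_C1:
  fixes f :: "real \<Rightarrow> 'a::real_normed_vector"
  assumes d: "\<And>x. x \<in> {a..b} \<Longrightarrow> (f has_vector_derivative f' x) (at x)"
    and B: "\<And>x. x \<in> {a..b} \<Longrightarrow> norm (f' x) \<le> B"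
  shows "acon a b f"
proof (rule acon_lipschitz[OF acon_id, of "max 0 B"])
  fix u v :: real assume uv: "a \<le> u" "u \<le> v" "v \<le> b"
  show "norm (f v - f u) \<le> max 0 B * norm (v - u)"
  proof (rule differentiable_bound[of "{u..v}" f "\<lambda>x h. h *\<^sub>R f' x"])
    fix x assume x: "x \<in> {u..v}"
    show "(f has_derivative (\<lambda>h. h *\<^sub>R f' x)) (at x within {u..v})"
      using d[of x] x uv unfolding has_vector_derivative_def
      by (auto intro: has_derivative_at_withinI)
    show "onorm (\<lambda>h. h *\<^sub>R f' x) \<le> max 0 B"
      using B[of x] x uv by (intro onorm_bound) (auto simp: mult.commute intro!: mult_left_mono)
  qed (use uv in auto)
qed auto

section \<open>The fundamental theorem of calculus for absolutely continuous functions\<close>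

lemma AE_lborel_iff_negligible:
  "(AE x in lborel. P x) \<longleftrightarrow> (\<exists>N. negligible N \<and> (\<forall>x. x \<notin> N \<longrightarrow> P x))"
proof -
  have "(AE x in lborel. P x) \<longleftrightarrow> (AE x in lebesgue. P x)" by (simp add: AE_completion_iff)
  also have "\<dots> \<longleftrightarrow> (\<exists>N. negligible N \<and> {x. \<not> P x} \<subseteq> N)"
    by (rule eventually_ae_filter_negligible)
  finally show ?thesis by blast
qed

lemma sum_length_le_measure:
  fixes u v :: "'i \<Rightarrow> real"
  assumes fin: "finite S" and uv: "\<And>i. i \<in> S \<Longrightarrow> u i \<le> v i \<and> {u i..v i} \<subseteq> T"
    and dj: "\<And>i j. \<lbrakk>i \<in> S; j \<in> S; i \<noteq> j\<rbrakk> \<Longrightarrow> v i \<le> u j \<or> v j \<le> u i"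
    and T: "T \<in> lmeasurable"
  shows "(\<Sum>i\<in>S. v i - u i) \<le> measure lebesgue T"
proof -
  have "(\<Sum>i\<in>S. v i - u i) = (\<Sum>i\<in>S. measure lebesgue {u i..v i})"
    using uv by (intro sum.cong) auto
  also have "\<dots> = measure lebesgue (\<Union>i\<in>S. {u i..v i})"
  proof (rule measure_negligible_finite_Union_image[symmetric, OF fin])
    show "pairwise (\<lambda>x y. negligible ({u x..v x} \<inter> {u y..v y})) S"
      unfolding pairwise_def
    proof (intro ballI impI)
      fix i j assume ij: "i \<in> S" "j \<in> S" "i \<noteq> j"
      have "{u i..v i} \<inter> {u j..v j} \<subseteq> {v i, v j}" using dj[OF ij] by auto
      then show "negligible ({u i..v i} \<inter> {u j..v j})"
        by (rule negligible_subset[rotated]) (auto intro: negligible_finite)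
    qed
  qed auto
  also have "\<dots> \<le> measure lebesgue T"
    using uv fin T by (intro measure_mono_fmeasurable) (auto intro!: sets.finite_UN)
  finally show ?thesis .
qed

text \<open>In the gauge integral the integrability of \<open>g\<close> is part of the conclusion.
  Off the exceptional null set the gauge comes from differentiability. On the null set it confines
  the intervals to an open set of small measure, where absolute continuity bounds the total
  increment of \<open>f\<close>.\<close>

theorem fundamental_theorem_acon:
  fixes f :: "real \<Rightarrow> 'a::banach"
  assumes ac: "acon a b f" and ab: "a \<le> b"
    and ae: "AE x in lborel. x \<in> {a<..<b} \<longrightarrow> (f has_vector_derivative g x) (at x)"
  shows "(g has_integral f b - f a) {a..b}"
proof (cases "a = b")
  case True then show ?thesis by (auto intro: has_integral_null_real)
next
  case False
  then have lt: "a < b" using ab by simp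
  obtain N where N: "negligible N"
    "\<And>x. x \<notin> N \<Longrightarrow> x \<in> {a<..<b} \<Longrightarrow> (f has_vector_derivative g x) (at x)"
    using ae unfolding AE_lborel_iff_negligible by blast
  define M where "M = N \<union> {a, b}"
  have M: "negligible M" unfolding M_def using N by (auto simp: negligible_Un_eq)
  \<comment> \<open>Changing the integrand on a null set is harmless, and a tag in \<open>M\<close>
    then contributes only the increment of \<open>f\<close>.\<close>
  define g0 where "g0 x = (if x \<in> M then 0 else g x)" for x
  have "(g0 has_integral f b - f a) (cbox a b)"
    unfolding has_integral_factor_content
  proof (intro allI impI)
    fix e :: real assume e: "e > 0"
    define e1 where "e1 = e / 2"
    have e1: "e1 > 0" "e1 * (b - a) > 0" using e lt by (auto simp: e1_def)
    have "\<exists>d>0. x \<in> {a<..<b} - M \<longrightarrow>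
         (\<forall>y. norm (y-x) < d \<longrightarrow> norm (f y - f x - (y-x) *\<^sub>R g x) \<le> e1 * norm (y-x))" for x
    proof (cases "x \<in> {a<..<b} - M")
      case True
      then have "(f has_derivative (\<lambda>h. h *\<^sub>R g x)) (at x)"
        using N(2)[of x] by (auto simp: M_def has_vector_derivative_def)
      then show ?thesis using e1(1) unfolding has_derivative_at_alt by blast
    qed (use zero_less_one in blast)
    then obtain d where d: "\<And>x. d x > 0" "\<And>x y. x \<in> {a<..<b} - M \<Longrightarrow> norm (y-x) < d x
         \<Longrightarrow> norm (f y - f x - (y-x) *\<^sub>R g x) \<le> e1 * norm (y-x)"
      by metis
    obtain dd where dd: "dd > 0" "\<forall>(S::(real \<times> real set) set) u v. short_indexed_family a b dd S u v \<longrightarrow> (\<Sum>i\<in>S. norm (f (v i) - f (u i))) < e1 * (b - a)"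
      using acon_finite_family[OF ac e1(2)] by blast
    have Mz: "M \<in> sets lebesgue" "emeasure lebesgue M = 0"
      using M by (auto simp: negligible_iff_null_sets null_sets_def)
    obtain T where T: "open T" "M \<subseteq> T" "T \<in> lmeasurable" "measure lebesgue T < dd"
    proof -
      obtain T where T: "open T" "M \<subseteq> T" "(T - M) \<in> lmeasurable" "emeasure lebesgue (T - M) < ennreal dd"
        using sets_lebesgue_outer_open[OF Mz(1) dd(1)] by blast
      have "emeasure lebesgue T = emeasure lebesgue (T - M)"
        using emeasure_Diff_null_set[of M lebesgue T] M T(1) by (auto simp: negligible_iff_null_sets)
      then have em: "emeasure lebesgue T < ennreal dd" using T by simp
      have Tm: "T \<in> lmeasurable"
        by (intro fmeasurableI) (use T(1) less_trans[OF em ennreal_less_top] in auto)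
      have "measure lebesgue T < dd"
        using em dd(1) Tm by (simp add: emeasure_eq_measure2 ennreal_less_iff)
      then show thesis using that T Tm by blast
    qed
    have "\<forall>x. \<exists>r>0. x \<in> M \<longrightarrow> ball x r \<subseteq> T"
      using T(1,2) unfolding open_contains_ball by (meson subsetD zero_less_one)
    then obtain r where r: "\<And>x. r x > 0" "\<And>x. x \<in> M \<Longrightarrow> ball x (r x) \<subseteq> T" by metis
    define \<gamma> where "\<gamma> x = ball x (if x \<in> M then r x else d x)" for x
    show "\<exists>\<gamma>. gauge \<gamma> \<and> (\<forall>p. p tagged_division_of cbox a b \<and> \<gamma> fine p \<longrightarrow>
        norm ((\<Sum>(x, K)\<in>p. measure lborel K *\<^sub>R g0 x) - (f b - f a)) \<le> e * measure lborel (cbox a b))"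
    proof (intro exI conjI allI impI)
      show "gauge \<gamma>" unfolding \<gamma>_def using d(1) r(1) by (intro gauge_ball_dependent) auto
      fix p assume p: "p tagged_division_of cbox a b \<and> \<gamma> fine p"
      have finp: "finite p" using p by blast
      have pK: "\<exists>u v. u \<le> v \<and> K = {u..v} \<and> x \<in> K \<and> a \<le> u \<and> v \<le> b \<and> K \<subseteq> \<gamma> x" if "(x,K) \<in> p" for x K
      proof -
        have 1: "x \<in> K" "K \<subseteq> cbox a b" "\<exists>u v. K = cbox u v"
          using p that tagged_division_ofD(2,3,4)[of p "cbox a b" x K] by blast+
        then obtain u v where "K = cbox u v" by blast
        moreover have "K \<subseteq> \<gamma> x" using p that by (auto simp: fine_def)
        ultimately show ?thesis using 1 by (intro exI[of _ u] exI[of _ v]) auto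
      qed
      \<comment> \<open>Degenerate intervals contribute no error and are left out, because
        disjointness of interiors would not put them in order with the others.\<close>
      define S where "S = {i \<in> p. fst i \<in> M \<and> Inf (snd i) < Sup (snd i)}"
      define err where "err = (\<lambda>(x,K). measure lborel K *\<^sub>R g0 x - (f (Sup K) - f (Inf K)))"
      have eq: "(\<Sum>(x, K)\<in>p. measure lborel K *\<^sub>R g0 x) - (f b - f a) = (\<Sum>i\<in>p. err i)"
        using additive_tagged_division_1[of a b p f] ab p
        by (simp add: err_def split_def sum_subtractf)
      have b1: "norm (err i) \<le> e1 * (Sup (snd i) - Inf (snd i))" if "i \<in> p - S" for i
      proof -
        obtain x K where i: "i = (x,K)" by force
        then have xK: "(x,K) \<in> p" using that by auto
        obtain u v where uv: "u \<le> v" "K = {u..v}" "x \<in> K" "a \<le> u" "v \<le> b" "K \<subseteq> \<gamma> x" using pK[OF xK] by blast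
        show ?thesis
        proof (cases "u = v")
          case True then show ?thesis using uv by (auto simp: i err_def)
        next
          case False
          then have xM: "x \<notin> M" using that uv by (auto simp: S_def i)
          then have x: "x \<in> {a<..<b} - M" using uv by (auto simp: M_def)
          have "u \<in> \<gamma> x" "v \<in> \<gamma> x" using uv by auto
          then have nu: "norm (u - x) < d x" "norm (v - x) < d x"
            using xM by (auto simp: \<gamma>_def dist_real_def)
          have "(v - u) *\<^sub>R g x - (f v - f u) = (f u - f x - (u - x) *\<^sub>R g x) - (f v - f x - (v - x) *\<^sub>R g x)"
            by (auto simp: algebra_simps)
          also have "norm \<dots> \<le> e1 * norm (u - x) + e1 * norm (v - x)"
            using d(2)[OF x nu(1)] d(2)[OF x nu(2)] by (meson add_mono norm_triangle_ineq4 order_trans)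
          also have "\<dots> = e1 * (v - u)" using uv by (auto simp: algebra_simps)
          finally show ?thesis using uv xM by (simp add: i err_def g0_def)
        qed
      qed
      have b2: "norm (err i) = norm (f (Sup (snd i)) - f (Inf (snd i)))" if "i \<in> S" for i
        using that by (auto simp: S_def err_def g0_def split_def norm_minus_commute)
      have Sp: "S \<subseteq> p" "finite S" using finp by (auto simp: S_def)
      have Suv: "a \<le> Inf (snd i) \<and> Inf (snd i) \<le> Sup (snd i) \<and> Sup (snd i) \<le> b \<and> {Inf (snd i)..Sup (snd i)} \<subseteq> T" if "i \<in> S" for i
      proof -
        obtain x K where i: "i = (x,K)" by force
        then have xK: "(x,K) \<in> p" "x \<in> M" using that by (auto simp: S_def)
        obtain u v where uv: "u \<le> v" "K = {u..v}" "x \<in> K" "a \<le> u" "v \<le> b" "K \<subseteq> \<gamma> x" using pK[OF xK(1)] by blast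
        then show ?thesis using r(2)[OF xK(2)] xK(2) by (auto simp: i \<gamma>_def)
      qed
      have Sdj: "Sup (snd i) \<le> Inf (snd j) \<or> Sup (snd j) \<le> Inf (snd i)" if "i \<in> S" "j \<in> S" "i \<noteq> j" for i j
      proof -
        obtain x K y L where ij: "i = (x,K)" "j = (y,L)" by force
        have m: "(x,K) \<in> p" "(y,L) \<in> p" using that ij by (auto simp: S_def)
        have "interior K \<inter> interior L = {}"
          using p m that ij tagged_division_ofD(5)[of p "cbox a b" x K y L] by blast
        moreover obtain u v where uv: "u \<le> v" "K = {u..v}" using pK[OF m(1)] by blast
        moreover obtain u' v' where uv': "u' \<le> v'" "L = {u'..v'}" using pK[OF m(2)] by blast
        moreover have "u < v" "u' < v'" using that ij uv uv' by (auto simp: S_def)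
        ultimately have "{max u u'<..<min v v'} = {}" "u < v" "u' < v'" by (auto simp: interior_atLeastAtMost_real)
        then have "v \<le> u' \<or> v' \<le> u" by (simp add: greaterThanLessThan_empty_iff) linarith
        then show ?thesis using ij uv uv' by auto
      qed
      have "(\<Sum>i\<in>S. Sup (snd i) - Inf (snd i)) \<le> measure lebesgue T"
        by (rule sum_length_le_measure) (use Sp Suv Sdj T in auto)
      then have len: "(\<Sum>i\<in>S. Sup (snd i) - Inf (snd i)) < dd" using T by simp
      have SS: "(\<Sum>i\<in>S. norm (f (Sup (snd i)) - f (Inf (snd i)))) < e1 * (b - a)"
        by (rule dd(2)[rule_format, where u = "\<lambda>i. Inf (snd i)" and v = "\<lambda>i. Sup (snd i)"])
           (use Sp Suv Sdj len in \<open>auto simp: short_indexed_family_def\<close>)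
      have "norm (\<Sum>i\<in>p. err i) \<le> (\<Sum>i\<in>p. norm (err i))" by (rule norm_sum)
      also have "\<dots> = (\<Sum>i\<in>p - S. norm (err i)) + (\<Sum>i\<in>S. norm (err i))"
        using Sp finp by (metis sum.subset_diff)
      also have "\<dots> \<le> (\<Sum>i\<in>p - S. e1 * (Sup (snd i) - Inf (snd i))) + e1 * (b - a)"
        using SS b2 by (intro add_mono sum_mono b1) auto
      also have "(\<Sum>i\<in>p - S. e1 * (Sup (snd i) - Inf (snd i))) \<le> (\<Sum>i\<in>p. e1 * (Sup (snd i) - Inf (snd i)))"
      proof (intro sum_mono2 finp)
        fix i assume "i \<in> p - (p - S)"
        then have "i \<in> S" by auto
        from Suv[OF this] e1(1) show "0 \<le> e1 * (Sup (snd i) - Inf (snd i))" by auto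
      qed auto
      also have "\<dots> = e1 * (b - a)"
        using additive_tagged_division_1[of a b p "\<lambda>x. x"] ab p
        by (simp add: split_def sum_distrib_left[symmetric])
      finally show "norm ((\<Sum>(x, K)\<in>p. measure lborel K *\<^sub>R g0 x) - (f b - f a)) \<le> e * measure lborel (cbox a b)"
        using ab unfolding eq by (simp add: e1_def field_simps)
    qed
  qed
  then show ?thesis
    using has_integral_spike[OF M, of "{a..b}" g g0 "f b - f a"] by (auto simp: g0_def)
qed


text \<open>Truncate the norm of \<open>g\<close> at a height n for which the excess has integral
  below e / 2; the truncated part contributes at most n times the total length of the
  intervals.\<close>

theorem acon_integral:
  fixes g :: "real \<Rightarrow> 'a::euclidean_space"
  assumes g: "g absolutely_integrable_on {a..b}"
  shows "acon a b (\<lambda>x. c + integral {a..x} g)"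
  unfolding acon_def
proof (intro allI impI)
  fix e :: real assume e: "e > 0"
  define G where "G x = norm (g x)" for x
  have G: "G absolutely_integrable_on {a..b}"
    using absolutely_integrable_norm[OF g] by (simp add: G_def[abs_def] o_def)
  define h where "h n x = min (G x) (real n)" for n x
  have h: "h n absolutely_integrable_on {a..b}" for n
    unfolding h_def by (intro absolutely_integrable_min_1 G absolutely_integrable_continuous_real continuous_intros)
  have hi: "h n integrable_on {a..b}" and Gi: "G integrable_on {a..b}" for n
    using h G by (auto intro: set_lebesgue_integral_eq_integral(1))
  have "(\<lambda>n. integral {a..b} (h n)) \<longlonglongrightarrow> integral {a..b} G"
  proof (rule dominated_convergence(2)[OF hi Gi])
    fix n x show "norm (h n x) \<le> G x" by (auto simp: h_def G_def)
    show "(\<lambda>n. h n x) \<longlonglongrightarrow> G x"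
    proof (rule tendsto_eventually)
      obtain m where "G x \<le> real m" using real_arch_simple by blast
      then show "\<forall>\<^sub>F n in sequentially. h n x = G x"
        unfolding eventually_sequentially h_def by (intro exI[of _ m]) auto
    qed
  qed
  then have "\<forall>\<^sub>F n in sequentially. dist (integral {a..b} (h n)) (integral {a..b} G) < e / 2"
    using e tendstoD half_gt_zero by blast
  then obtain n where n: "dist (integral {a..b} (h n)) (integral {a..b} G) < e / 2"
    using eventually_happens' sequentially_bot by blast
  have r: "integral {a..b} (\<lambda>x. G x - h n x) < e / 2"
    using n Gi hi[of n] unfolding dist_real_def by (subst integral_diff) linarith+
  define d where "d = e / (2 * (real n + 1))"
  have d: "d > 0" using e by (simp add: d_def)
  have "2 * (real n + 1) * d = e" by (simp add: d_def)
  then have d2: "n * d < e / 2" using d by (simp add: algebra_simps)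
  show "\<exists>d>0. \<forall>m u v. short_family a b d m u v \<longrightarrow>
     (\<Sum>i<m. norm (c + integral {a..v i} g - (c + integral {a..u i} g))) < e"
  proof (intro exI[of _ d] conjI d allI impI)
    fix m u v assume S: "short_family a b d m u v"
    then have uv: "\<And>i. i < m \<Longrightarrow> a \<le> u i" "\<And>i. i < m \<Longrightarrow> u i \<le> v i" "\<And>i. i < m \<Longrightarrow> v i \<le> b"
      and dj: "\<And>i j. \<lbrakk>i < m; j < m; i \<noteq> j\<rbrakk> \<Longrightarrow> v i \<le> u j \<or> v j \<le> u i"
      and len: "(\<Sum>i<m. v i - u i) < d"
      by (auto simp: short_family_def)
    have sub: "f integrable_on {x..y}" if "f integrable_on {a..b}" "a \<le> x" "y \<le> b"
      for f :: "real \<Rightarrow> 'b::euclidean_space" and x y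
      using that integrable_on_subinterval[of f "{a..b}" x y] by auto
    have gi: "g integrable_on {a..b}" using g by (auto intro: set_lebesgue_integral_eq_integral(1))
    have 1: "norm (c + integral {a..v i} g - (c + integral {a..u i} g))
        \<le> integral {u i..v i} (\<lambda>x. G x - h n x) + n * (v i - u i)" if i: "i < m" for i
    proof -
      have "integral {a..u i} g + integral {u i..v i} g = integral {a..v i} g"
        using uv[OF i] by (intro Henstock_Kurzweil_Integration.integral_combine sub[OF gi]) auto
      then have "norm (c + integral {a..v i} g - (c + integral {a..u i} g)) = norm (integral {u i..v i} g)"
        by (metis add_diff_cancel_left add_diff_cancel_left')
      also have "\<dots> \<le> integral {u i..v i} G"
        using uv[OF i] by (intro integral_norm_bound_integral sub[OF gi] sub[OF Gi]) (auto simp: G_def)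
      also have "\<dots> \<le> integral {u i..v i} (\<lambda>x. (G x - h n x) + n)"
        using uv[OF i] by (intro integral_le integrable_add integrable_diff sub[OF Gi] sub[OF hi]) (auto simp: h_def)
      also have "\<dots> = integral {u i..v i} (\<lambda>x. G x - h n x) + n * (v i - u i)"
        using uv[OF i] by (subst integral_add) (auto intro!: integrable_diff sub[OF Gi] sub[OF hi])
      finally show ?thesis .
    qed
    have "((\<lambda>x. G x - h n x) has_integral (\<Sum>i<m. integral {u i..v i} (\<lambda>x. G x - h n x))) (\<Union>i<m. {u i..v i})"
    proof (rule has_integral_UN)
      fix i assume "i \<in> {..<m}"
      then show "((\<lambda>x. G x - h n x) has_integral integral {u i..v i} (\<lambda>x. G x - h n x)) {u i..v i}"
        using uv[of i] by (intro integrable_integral integrable_diff sub[OF Gi] sub[OF hi]) auto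
    next
      show "pairwise (\<lambda>i i'. negligible ({u i..v i} \<inter> {u i'..v i'})) {..<m}"
        unfolding pairwise_def
      proof (intro ballI impI)
        fix i j assume ij: "i \<in> {..<m}" "j \<in> {..<m}" "i \<noteq> j"
        have "{u i..v i} \<inter> {u j..v j} \<subseteq> {v i, v j}" using dj[of i j] ij by auto
        then show "negligible ({u i..v i} \<inter> {u j..v j})"
          by (rule negligible_subset[rotated]) (auto intro: negligible_finite)
      qed
    qed auto
    then have "(\<Sum>i<m. integral {u i..v i} (\<lambda>x. G x - h n x)) \<le> integral {a..b} (\<lambda>x. G x - h n x)"
    proof (rule has_integral_subset_le[rotated])
      show "((\<lambda>x. G x - h n x) has_integral integral {a..b} (\<lambda>x. G x - h n x)) {a..b}"
        by (intro integrable_integral integrable_diff Gi hi)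
    qed (use uv in \<open>force simp: h_def\<close>)+
    moreover have "real n * (\<Sum>i<m. v i - u i) \<le> n * d" using len by (intro mult_left_mono) auto
    moreover have "(\<Sum>i<m. norm (c + integral {a..v i} g - (c + integral {a..u i} g)))
       \<le> (\<Sum>i<m. integral {u i..v i} (\<lambda>x. G x - h n x)) + n * (\<Sum>i<m. v i - u i)"
      unfolding sum_distrib_left sum.distrib[symmetric] by (intro sum_mono 1) auto
    ultimately show "(\<Sum>i<m. norm (c + integral {a..v i} g - (c + integral {a..u i} g))) < e"
      using r d2 by linarith
  qed
qed

lemma AE_right_average:
  fixes g :: "real \<Rightarrow> 'a::euclidean_space"
  assumes g: "\<And>a b. g integrable_on {a..b}"
  obtains N where "negligible N" "\<And>x e. \<lbrakk>x \<notin> N; 0 < e\<rbrakk> \<Longrightarrow>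
               \<exists>d>0. \<forall>h. 0 < h \<and> h < d \<longrightarrow> norm (integral {x..x+h} g - h *\<^sub>R g x) \<le> e * h"
proof -
  obtain N where N: "negligible N" "\<And>x e. \<lbrakk>x \<notin> N; 0 < e\<rbrakk> \<Longrightarrow>
               \<exists>d>0. \<forall>h. 0 < h \<and> h < d \<longrightarrow> norm (integral (cbox x (x + h *\<^sub>R One)) g /\<^sub>R h ^ DIM(real) - g x) < e"
    by (rule integrable_ccontinuous_explicit[of g]) (use g in auto)
  show thesis
  proof (rule that[OF N(1)])
    fix x e :: real assume "x \<notin> N" "0 < e"
    from N(2)[OF this] obtain d where d: "d > 0"
      "\<And>h. 0 < h \<and> h < d \<Longrightarrow> norm (integral {x..x + h} g /\<^sub>R h - g x) < e" by auto
    show "\<exists>d>0. \<forall>h. 0 < h \<and> h < d \<longrightarrow> norm (integral {x..x+h} g - h *\<^sub>R g x) \<le> e * h"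
    proof (intro exI[of _ d] conjI d(1) allI impI)
      fix h assume h: "0 < h \<and> h < d"
      have "norm (integral {x..x+h} g - h *\<^sub>R g x) = h * norm (integral {x..x + h} g /\<^sub>R h - g x)"
      proof -
        have "integral {x..x+h} g - h *\<^sub>R g x = h *\<^sub>R (integral {x..x + h} g /\<^sub>R h - g x)"
          using h by (simp add: scaleR_diff_right)
        then show ?thesis using h by simp
      qed
      also have "\<dots> \<le> h * e" using d(2)[OF h] h by (intro mult_left_mono) auto
      finally show "norm (integral {x..x+h} g - h *\<^sub>R g x) \<le> e * h" by (simp add: mult.commute)
    qed
  qed
qed

text \<open>Right-hand averages are treated by \<open>AE_right_average\<close>, left-hand ones by
  the same lemma for the reflected function. \<open>k\<close> extends \<open>g\<close> by 0 because
  that lemma asks for integrability on every interval.\<close>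

theorem AE_has_vector_derivative_integral:
  fixes g :: "real \<Rightarrow> 'a::euclidean_space"
  assumes g: "g integrable_on {a..b}"
  shows "AE x in lborel. x \<in> {a<..<b} \<longrightarrow> ((\<lambda>x. c + integral {a..x} g) has_vector_derivative g x) (at x)"
proof -
  define k where "k x = (if x \<in> {a..b} then g x else 0)" for x
  have k: "k integrable_on {u..v}" for u v
  proof -
    have "k integrable_on UNIV" using g integrable_restrict_UNIV[of "{a..b}" g] by (simp add: k_def[abs_def])
    then show ?thesis using integrable_on_subcbox[of k UNIV u v] by simp
  qed
  have k': "(\<lambda>x. k (-x)) integrable_on {u..v}" for u v
    using k[of "-v" "-u"] Henstock_Kurzweil_Integration.integrable_reflect_real[of k "-u" "-v"] by simp
  obtain N1 where N1: "negligible N1" "\<And>x e. \<lbrakk>x \<notin> N1; 0 < e\<rbrakk> \<Longrightarrow>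
               \<exists>d>0. \<forall>h. 0 < h \<and> h < d \<longrightarrow> norm (integral {x..x+h} k - h *\<^sub>R k x) \<le> e * h"
    using AE_right_average[OF k] by blast
  obtain N2 where N2: "negligible N2" "\<And>x e. \<lbrakk>x \<notin> N2; 0 < e\<rbrakk> \<Longrightarrow>
               \<exists>d>0. \<forall>h. 0 < h \<and> h < d \<longrightarrow> norm (integral {x..x+h} (\<lambda>x. k (-x)) - h *\<^sub>R k (-x)) \<le> e * h"
    using AE_right_average[OF k'] by blast
  define N where "N = N1 \<union> uminus ` N2"
  have N: "negligible N"
    using N1(1) N2(1) negligible_differentiable_image_negligible[of N2 uminus]
    by (auto simp: N_def negligible_Un_eq differentiable_on_minus)
  have "((\<lambda>x. c + integral {a..x} g) has_vector_derivative g x) (at x)" if x: "x \<notin> N" "x \<in> {a<..<b}" for x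
    unfolding has_vector_derivative_def has_derivative_at_alt
  proof (intro conjI bounded_linear_scaleR_left allI impI)
    fix e :: real assume e: "e > 0"
    have x2: "- x \<notin> N2" "x \<notin> N1" using x by (force simp: N_def)+
    obtain d1 where d1: "d1 > 0" "\<And>h. 0 < h \<Longrightarrow> h < d1 \<Longrightarrow> norm (integral {x..x+h} k - h *\<^sub>R k x) \<le> e * h"
      using N1(2)[OF x2(2) e] by blast
    obtain d2 where d2: "d2 > 0" "\<And>h. 0 < h \<Longrightarrow> h < d2 \<Longrightarrow> norm (integral {-x..-x+h} (\<lambda>x. k (-x)) - h *\<^sub>R k x) \<le> e * h"
      using N2(2)[OF x2(1) e] by auto
    define d where "d = min (min d1 d2) (min (x - a) (b - x))"
    have kg: "k x = g x" using x by (auto simp: k_def)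
    have ik: "integral {u..v} k = integral {u..v} g" if "a \<le> u" "v \<le> b" for u v
      by (rule integral_cong) (use that in \<open>auto simp: k_def\<close>)
    have sub: "g integrable_on {u..v}" if "a \<le> u" "v \<le> b" for u v
      using that integrable_on_subinterval[OF g, of u v] by auto
    show "\<exists>d>0. \<forall>y. norm (y - x) < d \<longrightarrow>
      norm (c + integral {a..y} g - (c + integral {a..x} g) - (y - x) *\<^sub>R g x) \<le> e * norm (y - x)"
    proof (intro exI[of _ d] conjI allI impI)
      show "d > 0" using d1 d2 x by (auto simp: d_def)
      fix y assume y: "norm (y - x) < d"
      consider "y = x" | "y > x" | "y < x" by linarith
      then show "norm (c + integral {a..y} g - (c + integral {a..x} g) - (y - x) *\<^sub>R g x) \<le> e * norm (y - x)"
      proof cases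
        case 2
        have "integral {a..x} g + integral {x..y} g = integral {a..y} g"
          using x y 2 by (intro Henstock_Kurzweil_Integration.integral_combine sub) (auto simp: d_def)
        then have "c + integral {a..y} g - (c + integral {a..x} g) - (y - x) *\<^sub>R g x = integral {x..y} k - (y - x) *\<^sub>R k x"
          using x y 2 ik[of x y] kg by (simp add: d_def algebra_simps)
        also have "norm \<dots> \<le> e * (y - x)" using d1(2)[of "y - x"] y 2 by (simp add: d_def)
        finally show ?thesis using 2 by simp
      next
        case 3
        have "integral {a..y} g + integral {y..x} g = integral {a..x} g"
          using x y 3 by (intro Henstock_Kurzweil_Integration.integral_combine sub) (auto simp: d_def)
        moreover have "integral {-x..-y} (\<lambda>x. k (-x)) = integral {y..x} k" by (rule Henstock_Kurzweil_Integration.integral_reflect_real)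
        ultimately have "c + integral {a..y} g - (c + integral {a..x} g) - (y - x) *\<^sub>R g x
            = - (integral {-x..-x + (x - y)} (\<lambda>x. k (-x)) - (x - y) *\<^sub>R k x)"
          using x y 3 ik[of y x] kg by (simp add: d_def algebra_simps)
        also have "norm \<dots> \<le> e * (x - y)" unfolding norm_minus_cancel
          by (rule d2(2)) (use y 3 in \<open>auto simp: d_def\<close>)
        finally show ?thesis using 3 by simp
      qed auto
    qed
  qed
  then show ?thesis unfolding AE_lborel_iff_negligible using N by blast
qed

section \<open>Gronwall inequalities with an integrable kernel\<close>

lemma acon_exp:
  fixes f :: "real \<Rightarrow> real"
  assumes "acon a b f" shows "acon a b (\<lambda>x. exp (f x))"
proof -
  have "bounded (f ` {a..b})"
    using assms acon_continuous_on compact_continuous_image compact_imp_bounded compact_Icc by blast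
  then obtain A where A: "\<And>x. x \<in> {a..b} \<Longrightarrow> norm (f x) \<le> A"
    unfolding bounded_iff by blast
  show ?thesis
  proof (rule acon_lipschitz[OF assms, of "exp A"])
    fix u v :: real assume uv: "a \<le> u" "u \<le> v" "v \<le> b"
    show "norm (exp (f v) - exp (f u)) \<le> exp A * norm (f v - f u)"
    proof (rule field_differentiable_bound[of "{-A..A}" exp exp])
      fix z assume "z \<in> {-A..A}"
      then show "(exp has_field_derivative exp z) (at z within {-A..A})" "norm (exp z) \<le> exp A"
        by (auto intro!: DERIV_subset[OF DERIV_exp])
    qed (use A[of u] A[of v] uv in auto)
  qed auto
qed

text \<open>The right-hand side H of the hypothesis satisfies H' \<le> \<open>\<alpha>\<close> H
  almost everywhere, so H exp(-B) does not increase, where B is a primitive of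
  \<open>\<alpha>\<close>. As the kernel is only integrable, this monotonicity rests on the
  fundamental theorem for absolutely continuous functions.\<close>

theorem gronwall:
  fixes \<phi> \<alpha> :: "real \<Rightarrow> real"
  assumes \<phi>: "continuous_on {a..b} \<phi>" and \<alpha>: "\<alpha> absolutely_integrable_on {a..b}"
    and nn: "\<And>x. x \<in> {a..b} \<Longrightarrow> 0 \<le> \<alpha> x" and ab: "a \<le> b"
    and le: "\<And>x. x \<in> {a..b} \<Longrightarrow> \<phi> x \<le> c + integral {a..x} (\<lambda>t. \<alpha> t * \<phi> t)"
  shows "\<phi> b \<le> c * exp (integral {a..b} \<alpha>)"
proof -
  have \<alpha>\<phi>: "(\<lambda>t. \<alpha> t * \<phi> t) absolutely_integrable_on {a..b}"
  proof -
    have "(\<lambda>t. \<phi> t * \<alpha> t) absolutely_integrable_on {a..b}"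
      using \<phi> \<alpha> compact_imp_bounded[OF compact_continuous_image[OF \<phi> compact_Icc]]
      by (intro absolutely_integrable_bounded_measurable_product_real)
         (auto intro: continuous_imp_measurable_on_sets_lebesgue)
    then show ?thesis by (simp add: mult.commute)
  qed
  define H where "H x = c + integral {a..x} (\<lambda>t. \<alpha> t * \<phi> t)" for x
  define B where "B x = 0 + integral {a..x} \<alpha>" for x
  have int: "f integrable_on {a..b}" if "f absolutely_integrable_on {a..b}" for f :: "real \<Rightarrow> real"
    using that by (auto intro: set_lebesgue_integral_eq_integral(1))
  have acH: "acon a b H" and acB: "acon a b B"
    unfolding H_def B_def by (intro acon_integral \<alpha>\<phi> \<alpha>)+
  have aeH: "AE x in lborel. x \<in> {a<..<b} \<longrightarrow> (H has_vector_derivative (\<alpha> x * \<phi> x)) (at x)"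
    and aeB: "AE x in lborel. x \<in> {a<..<b} \<longrightarrow> (B has_vector_derivative \<alpha> x) (at x)"
    unfolding H_def B_def by (intro AE_has_vector_derivative_integral int \<alpha>\<phi> \<alpha>)+
  define w where "w x = H x * exp (- B x)" for x
  define w' where "w' x = (\<alpha> x * \<phi> x - \<alpha> x * H x) * exp (- B x)" for x
  have acw: "acon a b w" unfolding w_def by (intro acon_mult acH acon_exp acon_minus acB)
  have "AE x in lborel. x \<in> {a<..<b} \<longrightarrow> (w has_vector_derivative w' x) (at x)"
    using aeH aeB
  proof eventually_elim
    case (elim x)
    show ?case
    proof
      assume "x \<in> {a<..<b}"
      then have "(H has_real_derivative (\<alpha> x * \<phi> x)) (at x)" "(B has_real_derivative \<alpha> x) (at x)"
        using elim by (auto simp: has_real_derivative_iff_has_vector_derivative)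
      then show "(w has_vector_derivative w' x) (at x)"
        unfolding w_def w'_def has_real_derivative_iff_has_vector_derivative[symmetric]
        by (auto intro!: derivative_eq_intros simp: algebra_simps)
    qed
  qed
  then have "(w' has_integral w b - w a) {a..b}" by (rule fundamental_theorem_acon[OF acw ab])
  moreover have "w' x \<le> 0" if "x \<in> {a..b}" for x
    using le[OF that] nn[OF that] unfolding w'_def H_def right_diff_distrib[symmetric]
    by (intro mult_nonpos_nonneg mult_nonneg_nonpos) auto
  ultimately have "w b - w a \<le> 0" by (metis has_integral_le has_integral_0)
  then have "H b * exp (- B b) \<le> c" by (simp add: w_def H_def B_def)
  then have "H b \<le> c * exp (B b)"
    by (simp add: exp_minus field_simps)
  then show ?thesis using le[of b] ab by (simp add: H_def B_def)
qed

text \<open>Reflection of the interval. This version carries estimates for the growing modes from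
  the right end to the left, the direction in which they are stable.\<close>

corollary gronwall_backward:
  fixes \<phi> \<alpha> :: "real \<Rightarrow> real"
  assumes \<phi>: "continuous_on {a..b} \<phi>" and \<alpha>: "\<alpha> absolutely_integrable_on {a..b}"
    and nn: "\<And>x. x \<in> {a..b} \<Longrightarrow> 0 \<le> \<alpha> x" and ab: "a \<le> b"
    and le: "\<And>x. x \<in> {a..b} \<Longrightarrow> \<phi> x \<le> c + integral {x..b} (\<lambda>t. \<alpha> t * \<phi> t)"
  shows "\<phi> a \<le> c * exp (integral {a..b} \<alpha>)"
proof -
  have "\<phi> (- (- a)) \<le> c * exp (integral {-b..-a} (\<lambda>x. \<alpha> (-x)))"
  proof (rule gronwall[where \<phi> = "\<lambda>x. \<phi> (-x)" and \<alpha> = "\<lambda>x. \<alpha> (-x)" and b = "-a" and a = "-b"])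
    show "continuous_on {- b..- a} (\<lambda>x. \<phi> (- x))"
      by (rule continuous_on_compose2[OF \<phi>]) (auto intro: continuous_intros)
    show "(\<lambda>x. \<alpha> (- x)) absolutely_integrable_on {- b..- a}"
      using \<alpha> by (simp add: absolutely_integrable_reflect_real)
    fix x assume x: "x \<in> {-b..-a}"
    then show "\<phi> (- x) \<le> c + integral {- b..x} (\<lambda>t. \<alpha> (- t) * \<phi> (- t))"
      using le[of "-x"] Henstock_Kurzweil_Integration.integral_reflect_real[of b "-x" "\<lambda>t. \<alpha> t * \<phi> t"] by auto
  qed (use ab nn in auto)
  then show ?thesis by (simp add: Henstock_Kurzweil_Integration.integral_reflect_real)
qed

section \<open>Linear systems with integrable coefficients\<close>

lemma absolutely_integrable_imp_integrable:
  fixes f :: "'a::euclidean_space \<Rightarrow> 'b::euclidean_space"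
  shows "f absolutely_integrable_on S \<Longrightarrow> f integrable_on S"
  by (rule set_lebesgue_integral_eq_integral(1))

lemma absolutely_integrable_subinterval:
  fixes f :: "real \<Rightarrow> 'a::euclidean_space"
  assumes "f absolutely_integrable_on {a..b}" "a \<le> c" "d \<le> b"
  shows "f absolutely_integrable_on {c..d}"
  using assms by (intro absolutely_integrable_on_subinterval[OF assms(1)]) auto

lemma absolutely_integrable_mult_continuous:
  fixes f g :: "real \<Rightarrow> 'a::{euclidean_space,real_normed_field}"
  assumes g: "g absolutely_integrable_on {a..b}" and f: "continuous_on {a..b} f"
  shows "(\<lambda>t. g t * f t) absolutely_integrable_on {a..b}"
proof -
  have "(\<lambda>t. f t * g t) absolutely_integrable_on {a..b}"
  proof (rule absolutely_integrable_bounded_measurable_product[OF bilinear_times _ _ _ g])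
    show "f \<in> borel_measurable (lebesgue_on {a..b})"
      using f by (intro continuous_imp_measurable_on_sets_lebesgue) auto
    show "bounded (f ` {a..b})" by (rule compact_imp_bounded[OF compact_continuous_image[OF f compact_Icc]])
  qed auto
  then show ?thesis by (simp add: mult.commute)
qed

lemma acon_cong:
  assumes "\<And>x. x \<in> {a..b} \<Longrightarrow> f x = g x" shows "acon a b f \<longleftrightarrow> acon a b g"
proof -
  have "acon a b g" if "acon a b f" "\<And>x. x \<in> {a..b} \<Longrightarrow> f x = g x" for f g :: "real \<Rightarrow> 'a"
    by (rule acon_lipschitz[OF that(1), of 1]) (use that(2) in auto)
  then show ?thesis using assms by metis
qed

lemma acon_power:
  fixes f :: "real \<Rightarrow> 'a::real_normed_algebra_1"
  shows "acon a b f \<Longrightarrow> acon a b (\<lambda>x. f x ^ n)"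
  by (induction n) (auto intro: acon_const acon_mult)

text \<open>The primitive of \<open>\<alpha>\<close> plays the part of the variable. This evaluates
  the iterated integrals of Picard's method and is the source of the factorials there.\<close>

lemma has_integral_power_of_primitive:
  fixes \<alpha> :: "real \<Rightarrow> real"
  assumes \<alpha>: "\<alpha> absolutely_integrable_on {a..b}" and x: "x \<in> {a..b}"
  shows "((\<lambda>t. \<alpha> t * (integral {a..t} \<alpha>) ^ m / fact m) has_integral
     (integral {a..x} \<alpha>) ^ Suc m / fact (Suc m)) {a..x}"
proof -
  define B where "B t = 0 + integral {a..t} \<alpha>" for t
  have \<alpha>x: "\<alpha> absolutely_integrable_on {a..x}" using absolutely_integrable_subinterval[OF \<alpha>, of a x] x by auto
  have ac: "acon a x B" unfolding B_def by (intro acon_integral \<alpha>x)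
  have "AE t in lborel. t \<in> {a<..<x} \<longrightarrow> (B has_vector_derivative \<alpha> t) (at t)"
    unfolding B_def by (intro AE_has_vector_derivative_integral absolutely_integrable_imp_integrable \<alpha>x)
  then have ae: "AE t in lborel. t \<in> {a<..<x} \<longrightarrow>
     ((\<lambda>t. B t ^ Suc m * (1 / fact (Suc m))) has_vector_derivative \<alpha> t * B t ^ m / fact m) (at t)"
  proof eventually_elim
    case (elim t)
    show ?case
    proof
      assume "t \<in> {a<..<x}"
      then have "(B has_real_derivative \<alpha> t) (at t)" using elim by (simp add: has_real_derivative_iff_has_vector_derivative)
      then have "((\<lambda>t. B t ^ Suc m * (1 / fact (Suc m))) has_real_derivative
          (of_nat (Suc m) * (\<alpha> t * B t ^ m)) * (1 / fact (Suc m))) (at t)"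
        using DERIV_power[of B "\<alpha> t" t UNIV "Suc m"] by (intro DERIV_cmult_right) (simp del: power_Suc)
      also have "(of_nat (Suc m) * (\<alpha> t * B t ^ m)) * (1 / fact (Suc m)) = \<alpha> t * B t ^ m / fact m"
        by (simp add: divide_simps)
      finally show "((\<lambda>t. B t ^ Suc m * (1 / fact (Suc m))) has_vector_derivative \<alpha> t * B t ^ m / fact m) (at t)"
        by (simp add: has_real_derivative_iff_has_vector_derivative)
    qed
  qed
  have "((\<lambda>t. \<alpha> t * B t ^ m / fact m) has_integral B x ^ Suc m * (1 / fact (Suc m)) - B a ^ Suc m * (1 / fact (Suc m))) {a..x}"
    by (rule fundamental_theorem_acon[OF acon_mult[OF acon_power[OF ac] acon_const] _ ae]) (use x in auto)
  then show ?thesis by (simp add: B_def)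
qed

definition lin_sol :: "nat \<Rightarrow> (nat \<Rightarrow> nat \<Rightarrow> real \<Rightarrow> complex) \<Rightarrow> (nat \<Rightarrow> real \<Rightarrow> complex) \<Rightarrow> bool" where
  "lin_sol n A y \<longleftrightarrow> (\<forall>i<n. acon 0 1 (y i)) \<and>
     (AE x in lborel. x \<in> {0<..<1} \<longrightarrow>
        (\<forall>i<n. (y i has_vector_derivative (\<Sum>j<n. A i j x * y j x)) (at x)))"

locale lin_sys =
  fixes n :: nat and A :: "nat \<Rightarrow> nat \<Rightarrow> real \<Rightarrow> complex"
  assumes A: "i < n \<Longrightarrow> j < n \<Longrightarrow> A i j absolutely_integrable_on {0..1}"
begin

lemma rhs_integrable:
  assumes "\<And>j. j < n \<Longrightarrow> continuous_on {0..1} (y j)" "i < n"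
  shows "(\<lambda>t. \<Sum>j<n. A i j t * y j t) absolutely_integrable_on {0..1}"
  using assms A by (intro absolutely_integrable_sum absolutely_integrable_mult_continuous) auto

lemma lin_sol_continuous: "lin_sol n A y \<Longrightarrow> i < n \<Longrightarrow> continuous_on {0..1} (y i)"
  by (auto simp: lin_sol_def intro: acon_continuous_on)

lemma lin_sol_integral_eq:
  assumes y: "lin_sol n A y" and i: "i < n" and x: "x \<in> {0..1}"
  shows "((\<lambda>t. \<Sum>j<n. A i j t * y j t) has_integral y i x - y i 0) {0..x}"
proof (rule fundamental_theorem_acon)
  show "acon 0 x (y i)" using y i x by (auto simp: lin_sol_def intro: acon_subset)
  have "AE x in lborel. x \<in> {0<..<1} \<longrightarrow>
        (\<forall>i<n. (y i has_vector_derivative (\<Sum>j<n. A i j x * y j x)) (at x))"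
    using y by (simp add: lin_sol_def)
  then show "AE t in lborel. t \<in> {0<..<x} \<longrightarrow> (y i has_vector_derivative (\<Sum>j<n. A i j t * y j t)) (at t)"
    by eventually_elim (use x i in auto)
qed (use x in auto)

lemma lin_solI:
  assumes cont: "\<And>i. i < n \<Longrightarrow> continuous_on {0..1} (y i)"
    and eq: "\<And>i x. i < n \<Longrightarrow> x \<in> {0..1} \<Longrightarrow> y i x = c i + integral {0..x} (\<lambda>t. \<Sum>j<n. A i j t * y j t)"
  shows "lin_sol n A y"
  unfolding lin_sol_def
proof (intro conjI allI impI)
  fix i assume i: "i < n"
  show "acon 0 1 (y i)"
    using acon_integral[OF rhs_integrable[of y i, OF cont i], of "c i"] acon_cong[of 0 1 "y i", OF eq[OF i]] by simp
next
  have ae: "AE x in lborel. \<forall>i<n. x \<in> {0<..<1} \<longrightarrow>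
    ((\<lambda>x. c i + integral {0..x} (\<lambda>t. \<Sum>j<n. A i j t * y j t)) has_vector_derivative (\<Sum>j<n. A i j x * y j x)) (at x)"
    by (intro AE_all_countable[THEN iffD2] allI AE_impI AE_has_vector_derivative_integral
        absolutely_integrable_imp_integrable rhs_integrable[of y, OF cont])
  then show "AE x in lborel. x \<in> {0<..<1} \<longrightarrow>
        (\<forall>i<n. (y i has_vector_derivative (\<Sum>j<n. A i j x * y j x)) (at x))"
  proof eventually_elim
    case (elim x)
    show ?case
    proof (intro impI allI)
      fix i assume x: "x \<in> {0<..<1}" and i: "i < n"
      show "(y i has_vector_derivative (\<Sum>j<n. A i j x * y j x)) (at x)"
        by (rule has_vector_derivative_transform_within_open[of
             "\<lambda>x. c i + integral {0..x} (\<lambda>t. \<Sum>j<n. A i j t * y j t)" _ _ "{0<..<1}"])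
           (use elim x i eq in auto)
    qed
  qed
qed

text \<open>Gronwall for the sum of the moduli of the components; the kernel that belongs to this
  norm is a bound for the column sums of the matrix.\<close>

lemma lin_sol_bound:
  assumes y: "lin_sol n A y" and a: "a absolutely_integrable_on {0..1}"
    and aA: "\<And>j t. j < n \<Longrightarrow> t \<in> {0..1} \<Longrightarrow> (\<Sum>i<n. cmod (A i j t)) \<le> a t"
    and nn: "\<And>t. t \<in> {0..1} \<Longrightarrow> 0 \<le> a t" and x: "x \<in> {0..1}"
  shows "(\<Sum>i<n. cmod (y i x)) \<le> (\<Sum>i<n. cmod (y i 0)) * exp (integral {0..x} a)"
proof (rule gronwall)
  note c = lin_sol_continuous[OF y]
  show "continuous_on {0..x} (\<lambda>x. \<Sum>i<n. cmod (y i x))"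
    using x by (intro continuous_intros continuous_on_subset[OF c]) auto
  show a': "a absolutely_integrable_on {0..x}" using absolutely_integrable_subinterval[OF a, of 0 x] x by auto
  fix u assume "u \<in> {0..x}"
  then have u: "u \<in> {0..1}" using x by auto
  have sub: "f absolutely_integrable_on {0..u}" if "f absolutely_integrable_on {0..1}" for f :: "real \<Rightarrow> 'a::euclidean_space"
    using absolutely_integrable_subinterval[OF that, of 0 u] u by auto
  have ai: "(\<lambda>t. cmod (A i j t) * cmod (y j t)) absolutely_integrable_on {0..1}" if "i < n" "j < n" for i j
    by (intro absolutely_integrable_mult_continuous continuous_intros c that)
       (use absolutely_integrable_norm[OF A[OF that]] in \<open>simp add: o_def\<close>)
  have 1: "cmod (y i u) \<le> cmod (y i 0) + integral {0..u} (\<lambda>t. \<Sum>j<n. cmod (A i j t) * cmod (y j t))" if i: "i < n" for i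
  proof -
    have "y i u - y i 0 = integral {0..u} (\<lambda>t. \<Sum>j<n. A i j t * y j t)"
      using lin_sol_integral_eq[OF y i u] by (simp add: integral_unique)
    also have "norm \<dots> \<le> integral {0..u} (\<lambda>t. \<Sum>j<n. cmod (A i j t) * cmod (y j t))"
    proof (rule integral_norm_bound_integral)
      show "(\<lambda>t. \<Sum>j<n. A i j t * y j t) integrable_on {0..u}"
        by (intro absolutely_integrable_imp_integrable sub rhs_integrable c i)
      show "(\<lambda>t. \<Sum>j<n. cmod (A i j t) * cmod (y j t)) integrable_on {0..u}"
        by (intro absolutely_integrable_imp_integrable sub absolutely_integrable_sum ai i) auto
      show "norm (\<Sum>j<n. A i j t * y j t) \<le> (\<Sum>j<n. cmod (A i j t) * cmod (y j t))" for t
        by (rule order_trans[OF norm_sum]) (simp add: norm_mult)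
    qed
    finally show ?thesis using norm_triangle_ineq2[of "y i u" "y i 0"] by simp
  qed
  have "(\<Sum>i<n. cmod (y i u)) \<le> (\<Sum>i<n. cmod (y i 0) + integral {0..u} (\<lambda>t. \<Sum>j<n. cmod (A i j t) * cmod (y j t)))"
    by (intro sum_mono 1) auto
  also have "\<dots> = (\<Sum>i<n. cmod (y i 0)) + integral {0..u} (\<lambda>t. \<Sum>i<n. \<Sum>j<n. cmod (A i j t) * cmod (y j t))"
    unfolding sum.distrib by (subst integral_sum)
      (auto intro!: absolutely_integrable_imp_integrable sub absolutely_integrable_sum ai)
  also have "integral {0..u} (\<lambda>t. \<Sum>i<n. \<Sum>j<n. cmod (A i j t) * cmod (y j t))
      \<le> integral {0..u} (\<lambda>t. a t * (\<Sum>j<n. cmod (y j t)))"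
  proof (rule integral_le)
    show "(\<lambda>t. \<Sum>i<n. \<Sum>j<n. cmod (A i j t) * cmod (y j t)) integrable_on {0..u}"
      by (intro absolutely_integrable_imp_integrable sub absolutely_integrable_sum ai) auto
    show "(\<lambda>t. a t * (\<Sum>j<n. cmod (y j t))) integrable_on {0..u}"
      by (intro absolutely_integrable_imp_integrable sub absolutely_integrable_mult_continuous a continuous_intros c) auto
    fix t assume t: "t \<in> {0..u}"
    have "(\<Sum>i<n. \<Sum>j<n. cmod (A i j t) * cmod (y j t)) = (\<Sum>j<n. (\<Sum>i<n. cmod (A i j t)) * cmod (y j t))"
      by (subst sum.swap) (simp add: sum_distrib_right)
    also have "\<dots> \<le> (\<Sum>j<n. a t * cmod (y j t))"
      using t u by (intro sum_mono mult_right_mono aA) auto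
    finally show "(\<Sum>i<n. \<Sum>j<n. cmod (A i j t) * cmod (y j t)) \<le> a t * (\<Sum>j<n. cmod (y j t))"
      by (simp add: sum_distrib_left)
  qed
  finally show "(\<Sum>i<n. cmod (y i u)) \<le> (\<Sum>i<n. cmod (y i 0)) + integral {0..u} (\<lambda>t. a t * (\<Sum>j<n. cmod (y j t)))"
    by simp
qed (use x nn in auto)

lemma lin_sol_diff: "lin_sol n A y \<Longrightarrow> lin_sol n A z \<Longrightarrow> lin_sol n A (\<lambda>i x. y i x - z i x)"
proof (unfold lin_sol_def, elim conjE, intro conjI)
  assume 1: "AE x in lborel. x \<in> {0<..<1} \<longrightarrow> (\<forall>i<n. (y i has_vector_derivative (\<Sum>j<n. A i j x * y j x)) (at x))"
    and 2: "AE x in lborel. x \<in> {0<..<1} \<longrightarrow> (\<forall>i<n. (z i has_vector_derivative (\<Sum>j<n. A i j x * z j x)) (at x))"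
  from 1 2 show "AE x in lborel. x \<in> {0<..<1} \<longrightarrow> (\<forall>i<n. ((\<lambda>x. y i x - z i x) has_vector_derivative (\<Sum>j<n. A i j x * (y j x - z j x))) (at x))"
    by eventually_elim (auto simp: algebra_simps sum_subtractf intro!: has_vector_derivative_diff)
qed (auto intro: acon_diff)

lemma lin_sol_unique:
  assumes y: "lin_sol n A y" and z: "lin_sol n A z" and eq: "\<And>i. i < n \<Longrightarrow> y i 0 = z i 0"
    and i: "i < n" and x: "x \<in> {0..1}"
  shows "y i x = z i x"
proof -
  define a where "a t = (\<Sum>i<n. \<Sum>j<n. cmod (A i j t))" for t
  have a: "a absolutely_integrable_on {0..1}" unfolding a_def
    by (intro absolutely_integrable_sum) (use absolutely_integrable_norm[OF A] in \<open>auto simp: o_def\<close>)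
  have "(\<Sum>i<n. cmod (y i x - z i x)) \<le> (\<Sum>i<n. cmod (y i 0 - z i 0)) * exp (integral {0..x} a)"
  proof (rule lin_sol_bound[OF lin_sol_diff[OF y z] a])
    fix j t assume "j < n"
    then show "(\<Sum>i<n. cmod (A i j t)) \<le> a t"
      unfolding a_def by (intro sum_mono member_le_sum) auto
  qed (use x in \<open>auto simp: a_def intro!: sum_nonneg\<close>)
  then have "(\<Sum>i<n. cmod (y i x - z i x)) \<le> 0" by (simp add: eq)
  moreover have "cmod (y i x - z i x) \<le> (\<Sum>i<n. cmod (y i x - z i x))" using i by (intro member_le_sum) auto
  ultimately have "cmod (y i x - z i x) \<le> 0" by linarith
  then show ?thesis by simp
qed

end


text \<open>This class contains all Picard iterates of a system that depends affinely on a parameter.\<close>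

inductive param_poly :: "(complex \<Rightarrow> real \<Rightarrow> complex) \<Rightarrow> bool" where
  coeff: "continuous_on {0..1} q \<Longrightarrow> param_poly (\<lambda>l. q)"
| add: "param_poly f \<Longrightarrow> param_poly g \<Longrightarrow> param_poly (\<lambda>l x. f l x + g l x)"
| param: "param_poly f \<Longrightarrow> param_poly (\<lambda>l x. l * f l x)"
| cong: "param_poly f \<Longrightarrow> (\<And>l x. x \<in> {0..1} \<Longrightarrow> g l x = f l x) \<Longrightarrow> param_poly g"

lemma param_poly_continuous: "param_poly f \<Longrightarrow> continuous_on {0..1} (f l)"
proof (induction rule: param_poly.induct)
  case (cong f g) then show ?case by (metis continuous_on_cong)
qed (auto intro!: continuous_intros)

lemma param_poly_holomorphic: "param_poly f \<Longrightarrow> x \<in> {0..1} \<Longrightarrow> (\<lambda>l. f l x) holomorphic_on S"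
proof (induction rule: param_poly.induct)
  case (cong f g) then show ?case by simp
qed (auto intro!: holomorphic_intros)

lemma param_poly_sum: "finite I \<Longrightarrow> (\<And>i. i \<in> I \<Longrightarrow> param_poly (f i)) \<Longrightarrow> param_poly (\<lambda>l x. \<Sum>i\<in>I. f i l x)"
  by (induction I rule: finite_induct) (auto intro: param_poly.intros)

lemma param_poly_integral:
  assumes g: "g absolutely_integrable_on {0..1}"
  shows "param_poly f \<Longrightarrow> param_poly (\<lambda>l x. integral {0..x} (\<lambda>t. g t * f l t))"
proof (induction rule: param_poly.induct)
  case (coeff q)
  have "(\<lambda>t. g t * q t) integrable_on {0..1}"
    by (intro absolutely_integrable_imp_integrable absolutely_integrable_mult_continuous g coeff)
  then show ?case by (intro param_poly.coeff indefinite_integral_continuous_1)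
next
  case (add f h)
  show ?case
  proof (rule param_poly.cong[OF param_poly.add[OF add.IH]])
    fix l and x :: real assume x: "x \<in> {0..1}"
    have "(\<lambda>t. g t * k l t) integrable_on {0..x}" if "param_poly k" for k
      using x by (intro absolutely_integrable_imp_integrable
         absolutely_integrable_subinterval[OF absolutely_integrable_mult_continuous[OF g param_poly_continuous[OF that]]]) auto
    then show "integral {0..x} (\<lambda>t. g t * (f l t + h l t))
       = integral {0..x} (\<lambda>t. g t * f l t) + integral {0..x} (\<lambda>t. g t * h l t)"
      using add.hyps by (simp add: distrib_left integral_add)
  qed
next
  case (param f)
  show ?case
    by (rule param_poly.cong[OF param_poly.param[OF param.IH]])
       (simp add: mult.left_commute)
next
  case (cong f h)
  show ?case
  proof (rule param_poly.cong[OF cong.IH])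
    fix l and x :: real assume "x \<in> {0..1}"
    then show "integral {0..x} (\<lambda>t. g t * h l t) = integral {0..x} (\<lambda>t. g t * f l t)"
      by (intro integral_cong) (use cong.hyps in auto)
  qed
qed

section \<open>Picard iteration for systems with a parameter\<close>

primrec picard :: "nat \<Rightarrow> (nat \<Rightarrow> nat \<Rightarrow> real \<Rightarrow> complex) \<Rightarrow> (nat \<Rightarrow> complex) \<Rightarrow> nat \<Rightarrow> nat \<Rightarrow> real \<Rightarrow> complex" where
  "picard n A c 0 = (\<lambda>i x. c i)"
| "picard n A c (Suc m) = (\<lambda>i x. c i + integral {0..x} (\<lambda>t. \<Sum>j<n. A i j t * picard n A c m j t))"

context lin_sys
begin

lemma picard_continuous: "i < n \<Longrightarrow> continuous_on {0..1} (picard n A c m i)"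
proof (induction m arbitrary: i)
  case (Suc m)
  have "(\<lambda>t. \<Sum>j<n. A i j t * picard n A c m j t) integrable_on {0..1}"
    by (intro absolutely_integrable_imp_integrable rhs_integrable Suc)
  then show ?case by (auto intro!: continuous_intros indefinite_integral_continuous_1)
qed auto

text \<open>Each iteration integrates the previous bound against \<open>a\<close>, so the
  differences are dominated by the terms of an exponential series. \<open>key\<close> is this single
  integration and serves both cases of the induction.\<close>

lemma picard_step_bound:
  assumes a: "a absolutely_integrable_on {0..1}"
    and aA: "\<And>j t. j < n \<Longrightarrow> t \<in> {0..1} \<Longrightarrow> (\<Sum>i<n. cmod (A i j t)) \<le> a t"
    and nn: "\<And>t. t \<in> {0..1} \<Longrightarrow> 0 \<le> a t"
  shows "x \<in> {0..1} \<Longrightarrow> (\<Sum>i<n. cmod (picard n A c (Suc m) i x - picard n A c m i x))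
    \<le> (\<Sum>i<n. cmod (c i)) * ((integral {0..x} a) ^ Suc m / fact (Suc m))"
proof (induction m arbitrary: x)
  note ai = absolutely_integrable_imp_integrable
  have key: "(\<Sum>i<n. cmod (integral {0..x} (\<lambda>t. \<Sum>j<n. A i j t * d j t)))
      \<le> C * ((integral {0..x} a) ^ Suc m / fact (Suc m))"
    if x: "x \<in> {0..1}" and d: "\<And>j. j < n \<Longrightarrow> continuous_on {0..1} (d j)"
      and le: "\<And>t. t \<in> {0..1} \<Longrightarrow> (\<Sum>j<n. cmod (d j t)) \<le> C * ((integral {0..t} a) ^ m / fact m)"
    for x d C m
  proof -
    have sub: "f absolutely_integrable_on {0..x}" if "f absolutely_integrable_on {0..1}" for f :: "real \<Rightarrow> 'a::euclidean_space"
      using absolutely_integrable_subinterval[OF that, of 0 x] x by auto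
    have Ai: "(\<lambda>t. cmod (A i j t) * cmod (d j t)) absolutely_integrable_on {0..1}" if "i < n" "j < n" for i j
      by (intro absolutely_integrable_mult_continuous continuous_intros d that)
         (use absolutely_integrable_norm[OF A[OF that]] in \<open>simp add: o_def\<close>)
    have "(\<Sum>i<n. cmod (integral {0..x} (\<lambda>t. \<Sum>j<n. A i j t * d j t)))
        \<le> (\<Sum>i<n. integral {0..x} (\<lambda>t. \<Sum>j<n. cmod (A i j t) * cmod (d j t)))"
    proof (rule sum_mono)
      fix i assume i: "i \<in> {..<n}"
      show "cmod (integral {0..x} (\<lambda>t. \<Sum>j<n. A i j t * d j t)) \<le> integral {0..x} (\<lambda>t. \<Sum>j<n. cmod (A i j t) * cmod (d j t))"
      proof (rule integral_norm_bound_integral)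
        show "(\<lambda>t. \<Sum>j<n. A i j t * d j t) integrable_on {0..x}" using i by (intro ai sub rhs_integrable d) auto
        show "(\<lambda>t. \<Sum>j<n. cmod (A i j t) * cmod (d j t)) integrable_on {0..x}"
          using i by (intro ai sub absolutely_integrable_sum Ai) auto
        show "norm (\<Sum>j<n. A i j t * d j t) \<le> (\<Sum>j<n. cmod (A i j t) * cmod (d j t))" for t
          by (rule order_trans[OF norm_sum]) (simp add: norm_mult)
      qed
    qed
    also have "\<dots> = integral {0..x} (\<lambda>t. \<Sum>i<n. \<Sum>j<n. cmod (A i j t) * cmod (d j t))"
      by (subst integral_sum) (auto intro!: ai sub absolutely_integrable_sum Ai)
    also have "\<dots> \<le> integral {0..x} (\<lambda>t. (a t * (integral {0..t} a) ^ m / fact m) * C)"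
    proof (rule integral_le)
      show "(\<lambda>t. \<Sum>i<n. \<Sum>j<n. cmod (A i j t) * cmod (d j t)) integrable_on {0..x}"
        by (intro ai sub absolutely_integrable_sum Ai) auto
      show "(\<lambda>t. (a t * (integral {0..t} a) ^ m / fact m) * C) integrable_on {0..x}"
        by (intro integrable_on_mult_left) (use has_integral_power_of_primitive[OF a x, of m] in blast)
      fix t assume "t \<in> {0..x}"
      then have t: "t \<in> {0..1}" using x by auto
      have "(\<Sum>i<n. \<Sum>j<n. cmod (A i j t) * cmod (d j t)) = (\<Sum>j<n. (\<Sum>i<n. cmod (A i j t)) * cmod (d j t))"
        by (subst sum.swap) (simp add: sum_distrib_right)
      also have "\<dots> \<le> (\<Sum>j<n. a t * cmod (d j t))"
        using t by (intro sum_mono mult_right_mono aA) auto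
      also have "\<dots> = a t * (\<Sum>j<n. cmod (d j t))" by (simp add: sum_distrib_left)
      also have "\<dots> \<le> a t * (C * ((integral {0..t} a) ^ m / fact m))" using nn t le by (intro mult_left_mono) auto
      finally show "(\<Sum>i<n. \<Sum>j<n. cmod (A i j t) * cmod (d j t)) \<le> (a t * (integral {0..t} a) ^ m / fact m) * C"
        by (simp add: algebra_simps)
    qed
    also have "\<dots> = ((integral {0..x} a) ^ Suc m / fact (Suc m)) * C"
      using has_integral_power_of_primitive[OF a x, of m]
      by (intro integral_unique has_integral_mult_left) auto
    finally show ?thesis by (simp only: mult.commute)
  qed
  {
    case 0
    show ?case using key[OF 0, of "\<lambda>j t. c j" "\<Sum>i<n. cmod (c i)" 0] by simp
  next
    case (Suc m)
    let ?d = "\<lambda>j t. picard n A c (Suc m) j t - picard n A c m j t"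
    have "integral {0..x} (\<lambda>t. \<Sum>j<n. A i j t * ?d j t)
        = picard n A c (Suc (Suc m)) i x - picard n A c (Suc m) i x" if i: "i < n" for i
    proof -
      have I: "(\<lambda>t. \<Sum>j<n. A i j t * picard n A c k j t) integrable_on {0..x}" for k
        using Suc.prems i
        by (intro ai absolutely_integrable_subinterval[OF rhs_integrable[of "picard n A c k" i]] picard_continuous) auto
      have "integral {0..x} (\<lambda>t. \<Sum>j<n. A i j t * ?d j t)
        = integral {0..x} (\<lambda>t. (\<Sum>j<n. A i j t * picard n A c (Suc m) j t) - (\<Sum>j<n. A i j t * picard n A c m j t))"
        by (simp only: right_diff_distrib sum_subtractf)
      also have "\<dots> = integral {0..x} (\<lambda>t. (\<Sum>j<n. A i j t * picard n A c (Suc m) j t)) -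
           integral {0..x} (\<lambda>t. (\<Sum>j<n. A i j t * picard n A c m j t))"
        by (intro integral_diff I)
      finally show ?thesis by simp
    qed
    then have "(\<Sum>i<n. cmod (picard n A c (Suc (Suc m)) i x - picard n A c (Suc m) i x))
       = (\<Sum>i<n. cmod (integral {0..x} (\<lambda>t. \<Sum>j<n. A i j t * ?d j t)))" by (intro sum.cong) auto
    also have "\<dots> \<le> (\<Sum>i<n. cmod (c i)) * ((integral {0..x} a) ^ Suc (Suc m) / fact (Suc (Suc m)))"
      by (rule key[OF Suc.prems]) (use Suc.IH in \<open>auto intro!: continuous_intros picard_continuous simp del: picard.simps\<close>)
    finally show ?case .
  }
qed

end


text \<open>The iterates are holomorphic in the parameter and converge uniformly for bounded
  \<open>l\<close> and all x at once, so the limit is entire in \<open>l\<close>. The solutions for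
  all \<open>l\<close> are produced as one family, since a separate choice for each \<open>l\<close>
  would lose holomorphy.\<close>

theorem lin_sol_param_exists:
  fixes A0 A1 :: "nat \<Rightarrow> nat \<Rightarrow> real \<Rightarrow> complex" and c :: "nat \<Rightarrow> complex"
  assumes A0: "\<And>i j. i < n \<Longrightarrow> j < n \<Longrightarrow> A0 i j absolutely_integrable_on {0..1}"
    and A1: "\<And>i j. i < n \<Longrightarrow> j < n \<Longrightarrow> A1 i j absolutely_integrable_on {0..1}"
  shows "\<exists>Y. (\<forall>l. lin_sol n (\<lambda>i j t. A0 i j t + l * A1 i j t) (Y l)) \<and> (\<forall>l. \<forall>i<n. Y l i 0 = c i) \<and>
    (\<forall>i<n. \<forall>x\<in>{0..1}. (\<lambda>l. Y l i x) holomorphic_on UNIV)"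
proof -
  define A where "A l i j t = A0 i j t + l * A1 i j t" for l i j t
  have sys: "lin_sys n (A l)" for l
    unfolding lin_sys_def A_def by (auto intro!: set_integral_add A0 A1)
  define S where "S l = picard n (A l) c" for l
  define Y where "Y l i x = lim (\<lambda>m. S l m i x)" for l i x
  have main: "uniform_limit (cball 0 R \<times> {0..1}) (\<lambda>m p. S (fst p) m i (snd p)) (\<lambda>p. Y (fst p) i (snd p)) sequentially
      \<and> (\<exists>K. \<forall>l\<in>cball 0 R. \<forall>m. \<forall>x\<in>{0..1}. cmod (S l m i x) \<le> K)"
    if i: "i < n" and R: "R \<ge> 0" for i R
  proof -
    define a where "a t = (\<Sum>i<n. \<Sum>j<n. cmod (A0 i j t) + R * cmod (A1 i j t))" for t
    have a: "a absolutely_integrable_on {0..1}" unfolding a_def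
      by (intro absolutely_integrable_sum set_integral_add(1) set_integrable_mult_right)
         (use absolutely_integrable_norm[OF A0] absolutely_integrable_norm[OF A1] in \<open>auto simp: o_def\<close>)
    have nn: "0 \<le> a t" for t unfolding a_def using R by (intro sum_nonneg) auto
    have aA: "(\<Sum>i<n. cmod (A l i j t)) \<le> a t" if "j < n" "l \<in> cball 0 R" for l j t
      unfolding a_def
    proof (rule sum_mono)
      fix i
      have "cmod (A l i j t) \<le> cmod (A0 i j t) + cmod l * cmod (A1 i j t)"
        unfolding A_def by (metis norm_mult norm_triangle_ineq)
      also have "\<dots> \<le> cmod (A0 i j t) + R * cmod (A1 i j t)"
        using that by (intro add_left_mono mult_right_mono) auto
      also have "\<dots> \<le> (\<Sum>j<n. cmod (A0 i j t) + R * cmod (A1 i j t))"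
        using that R by (intro member_le_sum) auto
      finally show "cmod (A l i j t) \<le> (\<Sum>j<n. cmod (A0 i j t) + R * cmod (A1 i j t))" .
    qed
    define b where "b = integral {0..1} a"
    define C where "C = (\<Sum>i<n. cmod (c i))"
    define M where "M m = C * (b ^ Suc m / fact (Suc m))" for m
    have C: "C \<ge> 0" unfolding C_def by (intro sum_nonneg) auto
    have "summable (\<lambda>m. b ^ m / fact m)" using summable_exp[of b] by (simp add: field_simps)
    then have sM: "summable M" unfolding M_def by (intro summable_mult summable_Suc_iff[THEN iffD2])
    have step: "cmod (S l (Suc m) i x - S l m i x) \<le> M m" if l: "l \<in> cball 0 R" and x: "x \<in> {0..1}" for l m x
    proof -
      interpret lin_sys n "A l" by (rule sys)
      have "cmod (S l (Suc m) i x - S l m i x) \<le> (\<Sum>i<n. cmod (S l (Suc m) i x - S l m i x))"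
        using i by (intro member_le_sum) auto
      also have "\<dots> \<le> C * ((integral {0..x} a) ^ Suc m / fact (Suc m))"
        unfolding S_def C_def by (rule picard_step_bound[OF a aA nn x]) (use l in auto)
      also have "\<dots> \<le> M m" unfolding M_def b_def
      proof (intro mult_left_mono divide_right_mono power_mono C)
        show "integral {0..x} a \<le> integral {0..1} a"
          using x nn by (intro integral_subset_le absolutely_integrable_imp_integrable a absolutely_integrable_subinterval[OF a]) auto
        show "0 \<le> integral {0..x} a"
          using x nn by (intro Henstock_Kurzweil_Integration.integral_nonneg absolutely_integrable_imp_integrable absolutely_integrable_subinterval[OF a]) auto
      qed auto
      finally show ?thesis .
    qed
    have tel: "S l m i x = c i + (\<Sum>k<m. S l (Suc k) i x - S l k i x)" for l m x
      unfolding sum_lessThan_telescope[of "\<lambda>k. S l k i x" m] by (simp add: S_def)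
    have Mn: "M m \<ge> 0" for m
    proof -
      have "0 \<le> b" unfolding b_def using nn a by (intro Henstock_Kurzweil_Integration.integral_nonneg absolutely_integrable_imp_integrable) auto
      then show ?thesis unfolding M_def using C by auto
    qed
    have bd: "cmod (S l m i x) \<le> cmod (c i) + suminf M" if l: "l \<in> cball 0 R" and x: "x \<in> {0..1}" for l m x
    proof -
      have "cmod (S l m i x) \<le> cmod (c i) + (\<Sum>k<m. cmod (S l (Suc k) i x - S l k i x))"
        unfolding tel[of l m x] by (rule norm_triangle_le, rule add_left_mono, rule norm_sum)
      also have "(\<Sum>k<m. cmod (S l (Suc k) i x - S l k i x)) \<le> (\<Sum>k<m. M k)"
        by (intro sum_mono step l x)
      also have "\<dots> \<le> suminf M" by (rule sum_le_suminf[OF sM]) (auto simp: Mn)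
      finally show ?thesis by simp
    qed
    let ?X = "cball 0 R \<times> {0..1::real}"
    let ?f = "\<lambda>k p. S (fst p) (Suc k) i (snd p) - S (fst p) k i (snd p)"
    have "uniform_limit ?X (\<lambda>m p. \<Sum>k<m. ?f k p) (\<lambda>p. suminf (\<lambda>k. ?f k p)) sequentially"
      by (rule Weierstrass_m_test[OF _ sM]) (auto intro!: step simp del: picard.simps)
    then have "uniform_limit ?X (\<lambda>m p. c i + (\<Sum>k<m. ?f k p)) (\<lambda>p. c i + suminf (\<lambda>k. ?f k p)) sequentially"
      by (rule uniform_limit_add[OF uniform_limit_const])
    then have ul: "uniform_limit ?X (\<lambda>m p. S (fst p) m i (snd p)) (\<lambda>p. c i + suminf (\<lambda>k. ?f k p)) sequentially"
      by (subst tel)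
    have "Y (fst p) i (snd p) = c i + suminf (\<lambda>k. ?f k p)" if "p \<in> ?X" for p
      unfolding Y_def by (rule limI) (use tendsto_uniform_limitI[OF ul that] in simp)
    then have "uniform_limit ?X (\<lambda>m p. S (fst p) m i (snd p)) (\<lambda>p. Y (fst p) i (snd p)) sequentially"
      using ul by (subst uniform_limit_cong'[where g = "\<lambda>m p. S (fst p) m i (snd p)"]) auto
    then show ?thesis using bd by blast
  qed
  have cont: "continuous_on {0..1} (Y l i)" if i: "i < n" for l i
  proof (rule uniform_limit_theorem)
    show "\<forall>\<^sub>F m in sequentially. continuous_on {0..1} (S l m i)"
      unfolding S_def using lin_sys.picard_continuous[OF sys i] by simp
    show "uniform_limit {0..1} (\<lambda>m x. S l m i x) (Y l i) sequentially"
      using uniform_limit_compose'[OF conjunct1[OF main[OF i norm_ge_zero[of l]]], of "\<lambda>x. (l, x)" "{0..1}"] by auto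
  qed auto
  have lim: "(\<lambda>m. S l m i x) \<longlonglongrightarrow> Y l i x" if "i < n" "x \<in> {0..1}" for l i x
    using tendsto_uniform_limitI[OF conjunct1[OF main[OF that(1) norm_ge_zero[of l]]], of "(l, x)"] that by auto
  have pp: "param_poly (\<lambda>l x. S l m i x)" if "i < n" for i m
    using that
  proof (induction m arbitrary: i)
    case 0 show ?case unfolding S_def by (auto intro!: param_poly.coeff continuous_intros)
  next
    case (Suc m)
    have P: "param_poly (\<lambda>l x. c i + (\<Sum>j<n. integral {0..x} (\<lambda>t. A0 i j t * S l m j t) + l * integral {0..x} (\<lambda>t. A1 i j t * S l m j t)))"
      by (intro param_poly.add param_poly.coeff continuous_intros param_poly_sum param_poly.param
          param_poly_integral A0 A1 Suc) (use Suc.prems in auto)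
    show ?case
    proof (rule param_poly.cong[OF P])
      fix l and x :: real assume x: "x \<in> {0..1}"
      have I: "(\<lambda>t. B t * S l m j t) integrable_on {0..x}" if "B absolutely_integrable_on {0..1}" "j < n" for B j
        using x that lin_sys.picard_continuous[OF sys that(2), of l c m]
        by (intro absolutely_integrable_imp_integrable absolutely_integrable_subinterval[OF
            absolutely_integrable_mult_continuous[OF that(1)]]) (auto simp: S_def)
      have "integral {0..x} (\<lambda>t. \<Sum>j<n. A l i j t * S l m j t)
        = integral {0..x} (\<lambda>t. \<Sum>j<n. A0 i j t * S l m j t + l * (A1 i j t * S l m j t))"
        by (simp add: A_def algebra_simps)
      also have "\<dots> = (\<Sum>j<n. integral {0..x} (\<lambda>t. A0 i j t * S l m j t) + l * integral {0..x} (\<lambda>t. A1 i j t * S l m j t))"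
      proof (subst integral_sum)
        show "(\<lambda>t. A0 i j t * S l m j t + l * (A1 i j t * S l m j t)) integrable_on {0..x}" if "j \<in> {..<n}" for j
          using Suc.prems that by (intro integrable_add integrable_on_mult_right I A0 A1) auto
        have "integral {0..x} (\<lambda>t. A0 i j t * S l m j t + l * (A1 i j t * S l m j t))
           = integral {0..x} (\<lambda>t. A0 i j t * S l m j t) + l * integral {0..x} (\<lambda>t. A1 i j t * S l m j t)" if "j < n" for j
          using Suc.prems that by (subst integral_add) (auto intro!: integrable_on_mult_right I A0 A1)
        then show "(\<Sum>j<n. integral {0..x} (\<lambda>t. A0 i j t * S l m j t + l * (A1 i j t * S l m j t)))
           = (\<Sum>j<n. integral {0..x} (\<lambda>t. A0 i j t * S l m j t) + l * integral {0..x} (\<lambda>t. A1 i j t * S l m j t))" by simp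
      qed auto
      finally show "S l (Suc m) i x = c i + (\<Sum>j<n. integral {0..x} (\<lambda>t. A0 i j t * S l m j t) + l * integral {0..x} (\<lambda>t. A1 i j t * S l m j t))"
        by (simp add: S_def)
    qed
  qed
  have "lin_sol n (A l) (Y l)" for l
  proof -
    interpret lin_sys n "A l" by (rule sys)
    show ?thesis
    proof (rule lin_solI)
      fix i x assume i: "i < n" and x: "x \<in> {0..1::real}"
      have "\<exists>K. \<forall>m. \<forall>x\<in>{0..1}. cmod (S l m j x) \<le> K" if "j < n" for j
      proof -
        have "l \<in> cball 0 (cmod l)" by simp
        then show ?thesis using conjunct2[OF main[OF that norm_ge_zero[of l]]] by blast
      qed
      then obtain K where K: "\<And>j m x. j < n \<Longrightarrow> x \<in> {0..1} \<Longrightarrow> cmod (S l m j x) \<le> K j" by metis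
      \<comment> \<open>The coefficients need not be bounded, so the limit passes under the integral
        by dominated convergence, with the uniform bounds of the iterates in the majorant.\<close>
      have "(\<lambda>m. integral {0..x} (\<lambda>t. \<Sum>j<n. A l i j t * S l m j t)) \<longlonglongrightarrow> integral {0..x} (\<lambda>t. \<Sum>j<n. A l i j t * Y l j t)"
      proof (rule dominated_convergence(2)[where h = "\<lambda>t. \<Sum>j<n. cmod (A l i j t) * K j"])
        show "(\<lambda>t. \<Sum>j<n. A l i j t * S l m j t) integrable_on {0..x}" for m
          using x i by (intro absolutely_integrable_imp_integrable absolutely_integrable_subinterval[OF rhs_integrable[of "S l m" i]])
             (auto simp: S_def intro: picard_continuous)
        show "(\<lambda>t. \<Sum>j<n. cmod (A l i j t) * K j) integrable_on {0..x}"
        proof (intro integrable_sum integrable_on_mult_left)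
          fix j assume "j \<in> {..<n}"
          then have "(\<lambda>t. cmod (A l i j t)) absolutely_integrable_on {0..1}"
            using absolutely_integrable_norm[OF A[OF i, of j]] by (simp add: o_def)
          then show "(\<lambda>t. cmod (A l i j t)) integrable_on {0..x}"
            using x by (intro absolutely_integrable_imp_integrable) (rule absolutely_integrable_subinterval, auto)
        qed auto
        fix t assume t: "t \<in> {0..x}"
        then have t1: "t \<in> {0..1}" using x by auto
        show "norm (\<Sum>j<n. A l i j t * S l m j t) \<le> (\<Sum>j<n. cmod (A l i j t) * K j)" for m
          by (rule order_trans[OF norm_sum], rule sum_mono) (auto simp: norm_mult intro!: mult_left_mono K t1[simplified])
        show "(\<lambda>m. \<Sum>j<n. A l i j t * S l m j t) \<longlonglongrightarrow> (\<Sum>j<n. A l i j t * Y l j t)"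
          by (intro tendsto_intros lim t1) auto
      qed
      then have "(\<lambda>m. c i + integral {0..x} (\<lambda>t. \<Sum>j<n. A l i j t * S l m j t)) \<longlonglongrightarrow> c i + integral {0..x} (\<lambda>t. \<Sum>j<n. A l i j t * Y l j t)"
        by (intro tendsto_intros)
      moreover have "(\<lambda>m. c i + integral {0..x} (\<lambda>t. \<Sum>j<n. A l i j t * S l m j t)) = (\<lambda>m. S l (Suc m) i x)"
        by (simp add: S_def)
      ultimately show "Y l i x = c i + integral {0..x} (\<lambda>t. \<Sum>j<n. A l i j t * Y l j t)"
        using LIMSEQ_unique[OF LIMSEQ_Suc[OF lim[OF i x, of l]]] by simp
    qed (rule cont)
  qed
  moreover have "Y l i 0 = c i" if "i < n" for l i
  proof -
    have "S l m i 0 = c i" for m unfolding S_def by (cases m) auto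
    then show ?thesis unfolding Y_def by simp
  qed
  moreover have "(\<lambda>l. Y l i x) holomorphic_on UNIV" if i: "i < n" and x: "x \<in> {0..1}" for i x
  proof (rule holomorphic_uniform_sequence[OF open_UNIV])
    show "(\<lambda>l. S l m i x) holomorphic_on UNIV" for m by (rule param_poly_holomorphic[OF pp[OF i] x])
    fix z :: complex
    have R: "0 \<le> cmod z + 1" by simp
    have "uniform_limit (cball z 1) (\<lambda>m l. S l m i x) (\<lambda>l. Y l i x) sequentially"
    proof -
      have "cball z 1 \<subseteq> cball 0 (cmod z + 1)"
      proof
        fix w assume "w \<in> cball z 1"
        then show "w \<in> cball 0 (cmod z + 1)"
          using norm_triangle_ineq2[of w z] by (auto simp: dist_norm norm_minus_commute)
      qed
      then have "(\<lambda>l. (l, x)) \<in> cball z 1 \<rightarrow> cball 0 (cmod z + 1) \<times> {0..1}" using x by blast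
      from uniform_limit_compose'[OF conjunct1[OF main[OF i R]] this] show ?thesis by simp
    qed
    then show "\<exists>d>0. cball z d \<subseteq> UNIV \<and> uniform_limit (cball z d) (\<lambda>m l. S l m i x) (\<lambda>l. Y l i x) sequentially"
      by (intro exI[of _ 1]) auto
  qed
  ultimately show ?thesis unfolding A_def[abs_def] by (intro exI[of _ Y]) blast
qed

section \<open>Entire functions of order one quarter\<close>

text \<open>Growth of order at most 1/4 and finite type, the natural class for solutions of a
  fourth-order equation as functions of the spectral parameter: their exponents are of the size of a
  fourth root of it.\<close>

definition ord14 :: "(complex \<Rightarrow> complex) \<Rightarrow> bool" where
  "ord14 f \<longleftrightarrow> (\<exists>C\<ge>0. \<forall>z. cmod (f z) \<le> exp (C * (1 + cmod z powr (1/4))))"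

lemma power_powr_eq: "(t::real) > 0 \<Longrightarrow> (t ^ n) powr a = t powr (real n * a)"
  using powr_powr[of t "real n" a] by (simp add: powr_realpow)

lemma powr_quarter_add_le:
  fixes x y :: real assumes "x \<ge> 0" "y \<ge> 0"
  shows "(x + y) powr (1/4) \<le> 2 * (x powr (1/4) + y powr (1/4))"
proof -
  have "(x + y) powr (1/4) \<le> (2 * max x y) powr (1/4)" using assms by (intro powr_mono2) auto
  also have "\<dots> = 2 powr (1/4) * max x y powr (1/4)" using assms by (simp add: powr_mult)
  also have "\<dots> \<le> 2 * max x y powr (1/4)"
    using powr_mono[of "1/4" 1 "2::real"] by (intro mult_right_mono) auto
  also have "max x y powr (1/4) \<le> x powr (1/4) + y powr (1/4)" using assms by (auto simp: max_def)
  finally show ?thesis by simp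
qed

text \<open>A constant factor is absorbed because D \<le> exp D and the bracket in the exponent is
  at least 1.\<close>

lemma ord14I:
  assumes "C \<ge> 0" "D \<ge> 0" and le: "\<And>z. cmod (f z) \<le> D * exp (C * (1 + cmod z powr (1/4)))"
  shows "ord14 f"
  unfolding ord14_def
proof (intro exI[of _ "C + D"] conjI allI)
  fix z
  let ?t = "1 + cmod z powr (1/4)"
  have t: "?t \<ge> 1" by simp
  have "D \<le> exp D" using exp_ge_add_one_self[of D] by linarith
  also have "\<dots> \<le> exp (D * ?t)" using t assms(2) mult_left_mono[of 1 ?t D] by simp
  finally have "D * exp (C * ?t) \<le> exp (D * ?t) * exp (C * ?t)" by (rule mult_right_mono) simp
  also have "\<dots> = exp ((C + D) * ?t)" by (simp add: exp_add[symmetric] algebra_simps)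
  finally show "cmod (f z) \<le> exp ((C + D) * ?t)" using le[of z] by linarith
qed (use assms in auto)

lemma ord14_const: "ord14 (\<lambda>z. c)"
  by (rule ord14I[of 0 "cmod c"]) auto

lemma ord14_mult: assumes "ord14 f" "ord14 g" shows "ord14 (\<lambda>z. f z * g z)"
proof -
  obtain C D where C: "C \<ge> 0" "\<And>z. cmod (f z) \<le> exp (C * (1 + cmod z powr (1/4)))"
    and D: "D \<ge> 0" "\<And>z. cmod (g z) \<le> exp (D * (1 + cmod z powr (1/4)))"
    using assms unfolding ord14_def by blast
  have "cmod (f z * g z) \<le> exp ((C + D) * (1 + cmod z powr (1/4)))" for z
    unfolding norm_mult distrib_right exp_add using C(2)[of z] D(2)[of z] by (intro mult_mono) auto
  then show ?thesis unfolding ord14_def using C(1) D(1) by (intro exI[of _ "C + D"]) auto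
qed

lemma ord14_add: assumes "ord14 f" "ord14 g" shows "ord14 (\<lambda>z. f z + g z)"
proof -
  obtain C D where C: "C \<ge> 0" "\<And>z. cmod (f z) \<le> exp (C * (1 + cmod z powr (1/4)))"
    and D: "D \<ge> 0" "\<And>z. cmod (g z) \<le> exp (D * (1 + cmod z powr (1/4)))"
    using assms unfolding ord14_def by blast
  show ?thesis
  proof (rule ord14I[of "C + D" 2])
    fix z
    let ?t = "1 + cmod z powr (1/4)"
    have t: "?t \<ge> 1" by simp
    have "exp (C * ?t) \<le> exp ((C + D) * ?t)" "exp (D * ?t) \<le> exp ((C + D) * ?t)"
      using t C D by (auto intro!: mult_right_mono)
    then show "cmod (f z + g z) \<le> 2 * exp ((C + D) * ?t)"
      using C(2)[of z] D(2)[of z] norm_triangle_ineq[of "f z" "g z"] by linarith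
  qed (use C D in auto)
qed

lemma ord14_minus: "ord14 f \<Longrightarrow> ord14 (\<lambda>z. - f z)"
  unfolding ord14_def by simp

lemma ord14_diff: "ord14 f \<Longrightarrow> ord14 g \<Longrightarrow> ord14 (\<lambda>z. f z - g z)"
  using ord14_add[OF _ ord14_minus] by fastforce

lemma ord14_translate: assumes "ord14 f" shows "ord14 (\<lambda>z. f (z + w))"
proof -
  obtain C where C: "C \<ge> 0" "\<And>z. cmod (f z) \<le> exp (C * (1 + cmod z powr (1/4)))"
    using assms unfolding ord14_def by blast
  show ?thesis
  proof (rule ord14I[of "2 * C" "exp (C * (2 * cmod w powr (1/4)))"])
    fix z
    have "cmod (z + w) powr (1/4) \<le> (cmod z + cmod w) powr (1/4)"
      by (intro powr_mono2) (auto intro: norm_triangle_ineq)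
    also have "\<dots> \<le> 2 * (cmod z powr (1/4) + cmod w powr (1/4))" by (intro powr_quarter_add_le) auto
    finally have "C * (1 + cmod (z + w) powr (1/4)) \<le> C * (2 * cmod w powr (1/4) + 2 * (1 + cmod z powr (1/4)))"
      using C(1) by (intro mult_left_mono) auto
    then have "exp (C * (1 + cmod (z + w) powr (1/4))) \<le> exp (C * (2 * cmod w powr (1/4)) + 2 * C * (1 + cmod z powr (1/4)))"
      by (simp add: algebra_simps)
    then show "cmod (f (z + w)) \<le> exp (C * (2 * cmod w powr (1/4))) * exp (2 * C * (1 + cmod z powr (1/4)))"
      unfolding exp_add[symmetric] using C(2)[of "z + w"] order_trans by blast
  qed (use C in auto)
qed

text \<open>The map u / (2 A - u) carries the half plane Re u < A into the unit disc and fixes 0, so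
  Schwarz's lemma applies to its composition with \<open>\<phi>\<close>. Denominators are cleared in
  the conclusion.\<close>

lemma borel_caratheodory:
  assumes hol: "\<phi> holomorphic_on ball 0 R" and R: "R > 0" and 0: "\<phi> 0 = 0"
    and A: "\<And>z. cmod z < R \<Longrightarrow> Re (\<phi> z) < A" and z: "cmod z < R"
  shows "cmod (\<phi> z) * (R - cmod z) \<le> 2 * A * cmod z"
proof -
  have A0: "A > 0" using A[of 0] R 0 by simp
  define f where "f w = \<phi> (of_real R * w) / (2 * of_real A - \<phi> (of_real R * w))" for w
  have in_ball: "cmod (of_real R * w) < R" if "cmod w < 1" for w
    using that R by (simp add: norm_mult)
  have lt: "cmod u < cmod (2 * of_real A - u)" if "Re u < A" for u :: complex
  proof -
    have "(cmod u)\<^sup>2 < (cmod (2 * of_real A - u))\<^sup>2"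
    proof -
      have "(cmod (2 * of_real A - u))\<^sup>2 - (cmod u)\<^sup>2 = 4 * A * (A - Re u)"
        unfolding cmod_power2 by (simp add: power2_eq_square algebra_simps)
      moreover have "4 * A * (A - Re u) > 0" using A0 that by simp
      ultimately show ?thesis by linarith
    qed
    then show ?thesis by (rule power_less_imp_less_base) auto
  qed
  have nz: "2 * of_real A - \<phi> (of_real R * w) \<noteq> 0" if "cmod w < 1" for w
    using lt[OF A[OF in_ball[OF that]]] by (metis norm_ge_zero norm_zero not_le)
  define w where "w = z / of_real R"
  have w: "cmod w < 1" "of_real R * w = z" using z R by (auto simp: w_def norm_divide)
  have "cmod (f w) \<le> cmod w"
  proof (rule Schwarz_Lemma(1))
    have "(\<lambda>w. \<phi> (of_real R * w)) holomorphic_on ball 0 1"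
      using in_ball by (intro holomorphic_on_compose_gen[OF _ hol, unfolded o_def] holomorphic_intros) auto
    then show "f holomorphic_on ball 0 1" unfolding f_def using nz by (intro holomorphic_intros) auto
    show "f 0 = 0" by (simp add: f_def 0)
    show "cmod (f u) < 1" if "cmod u < 1" for u
      unfolding f_def norm_divide using lt[OF A[OF in_ball[OF that]]] nz[OF that] by simp
  qed fact
  then have "cmod (\<phi> z) \<le> cmod w * cmod (2 * of_real A - \<phi> z)"
    using nz[OF w(1)] w(2) by (simp add: f_def norm_divide divide_simps)
  also have "\<dots> \<le> cmod w * (2 * A + cmod (\<phi> z))"
    using norm_triangle_ineq4[of "2 * of_real A" "\<phi> z"] A0 by (intro mult_left_mono) (auto simp: norm_mult)
  finally have "R * cmod (\<phi> z) \<le> R * (cmod w * (2 * A + cmod (\<phi> z)))" using R by (intro mult_left_mono) auto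
  also have "R * (cmod w * (2 * A + cmod (\<phi> z))) = cmod z * (2 * A + cmod (\<phi> z))" using R by (simp add: w_def norm_divide)
  finally show ?thesis by (simp add: algebra_simps)
qed

text \<open>Write g = g 0 * exp \<open>\<phi>\<close>. An upper bound A for Re \<open>\<phi>\<close>
  yields the bound 2 A for its modulus in the disc of half the radius, and thereby a lower bound for
  Re \<open>\<phi>\<close>. With exp A = 2 M / |g 0| the factor exp(-2 A) equals |g 0|^2 / (4 M^2),
  which explains the third power.\<close>

lemma zero_free_lower_bound:
  assumes hol: "g holomorphic_on ball 0 r" and r: "r > 0" and nz: "\<And>z. cmod z < r \<Longrightarrow> g z \<noteq> 0"
    and M: "\<And>z. cmod z < r \<Longrightarrow> cmod (g z) \<le> M" and z: "cmod z \<le> r / 2"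
  shows "cmod (g 0) ^ 3 \<le> 4 * M\<^sup>2 * cmod (g z)"
proof -
  obtain \<psi> where \<psi>: "\<psi> holomorphic_on ball 0 r" "\<And>z. z \<in> ball 0 r \<Longrightarrow> g z = exp (\<psi> z)"
    using contractible_imp_holomorphic_log[OF hol convex_imp_contractible[OF convex_ball]] nz by auto
  define \<phi> where "\<phi> z = \<psi> z - \<psi> 0" for z
  have g0: "g 0 \<noteq> 0" using nz[of 0] r by auto
  have M0: "M > 0" using M[of 0] g0 r by (metis norm_zero norm_le_zero_iff not_le order_trans)
  have eq: "g z = g 0 * exp (\<phi> z)" if "cmod z < r" for z
    using \<psi>(2)[of z] \<psi>(2)[of 0] that r by (simp add: \<phi>_def exp_diff)
  \<comment> \<open>The factor 2 makes A positive and the bound for Re \<open>\<phi>\<close> strict,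
    as \<open>borel_caratheodory\<close> demands.\<close>
  define A where "A = ln (2 * M / cmod (g 0))"
  have eA: "exp A = 2 * M / cmod (g 0)" using M0 g0 by (simp add: A_def)
  have "cmod (\<phi> z) * (r - cmod z) \<le> 2 * A * cmod z"
  proof (rule borel_caratheodory)
    show "\<phi> holomorphic_on ball 0 r" unfolding \<phi>_def by (intro holomorphic_intros \<psi>)
    fix u assume u: "cmod u < r"
    have "cmod (g 0) * exp (Re (\<phi> u)) \<le> M" using M[OF u] eq[OF u] by (simp add: norm_mult)
    also have "\<dots> < 2 * M" using M0 by simp
    finally have "exp (Re (\<phi> u)) < exp A" using g0 by (simp add: eA field_simps)
    then show "Re (\<phi> u) < A" by simp
  qed (use z r in \<open>auto simp: \<phi>_def\<close>)
  moreover have A0: "A > 0"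
  proof -
    have "1 < exp A" using M[of 0] r g0 M0 by (auto simp: eA field_simps)
    then show ?thesis by simp
  qed
  moreover have "cmod (\<phi> z) * (r / 2) \<le> cmod (\<phi> z) * (r - cmod z)" using z by (intro mult_left_mono) auto
  moreover have "2 * A * cmod z \<le> 2 * A * (r / 2)" using z A0 by (intro mult_left_mono) auto
  ultimately have "cmod (\<phi> z) * (r / 2) \<le> (2 * A) * (r / 2)" by linarith
  then have "cmod (\<phi> z) \<le> 2 * A" using r by (simp add: mult_le_cancel_right)
  then have "Re (\<phi> z) \<ge> - (2 * A)" using abs_Re_le_cmod[of "\<phi> z"] by linarith
  then have "exp (- (2 * A)) \<le> exp (Re (\<phi> z))" by simp
  moreover have "cmod (g z) = cmod (g 0) * exp (Re (\<phi> z))" using eq[of z] z r by (simp add: norm_mult)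
  ultimately have "cmod (g 0) * exp (- (2 * A)) \<le> cmod (g z)" by (simp add: mult_left_mono)
  moreover have "exp (- (2 * A)) = (cmod (g 0))\<^sup>2 / (4 * M\<^sup>2)"
  proof -
    have "exp (- (2 * A)) = 1 / (exp A)\<^sup>2" by (simp add: exp_minus exp_double inverse_eq_divide)
    also have "\<dots> = (cmod (g 0))\<^sup>2 / (4 * M\<^sup>2)" by (simp add: eA power_divide power_mult_distrib)
    finally show ?thesis .
  qed
  ultimately have "cmod (g 0) * ((cmod (g 0))\<^sup>2 / (4 * M\<^sup>2)) \<le> cmod (g z)" by simp
  then have "cmod (g 0) * (cmod (g 0))\<^sup>2 \<le> cmod (g z) * (4 * M\<^sup>2)" using M0 by (simp add: field_simps)
  then show ?thesis by (simp add: power2_eq_square power3_eq_cube algebra_simps)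
qed

lemma cmod_blaschke_eq:
  assumes "cmod z = R" shows "cmod (of_real (R\<^sup>2) - cnj a * z) = R * cmod (z - a)"
proof -
  have "of_real (R\<^sup>2) = z * cnj z" using assms by (simp add: complex_norm_square[symmetric])
  then have "of_real (R\<^sup>2) - cnj a * z = z * cnj (z - a)" by (simp add: algebra_simps)
  then have "cmod (of_real (R\<^sup>2) - cnj a * z) = cmod z * cmod (cnj (z - a))" by (simp only: norm_mult)
  then show ?thesis by (simp only: complex_mod_cnj assms)
qed

text \<open>The zeros of the denominator in the disc of radius r are removed one at a time by Blaschke
  factors of radius R. Each removal multiplies the value at 0 by at least R/r without changing the
  bound on the circle, so that the exponent n bounds the number of steps.\<close>

lemma quotient_bound_blaschke:
  assumes r: "0 < r" "r < R"
  shows "f holomorphic_on UNIV \<Longrightarrow> g holomorphic_on UNIV \<Longrightarrow> h holomorphic_on UNIV \<Longrightarrow>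
    (\<And>z. f z = h z * g z) \<Longrightarrow> g 0 \<noteq> 0 \<Longrightarrow>
    (\<And>z. cmod z = R \<Longrightarrow> cmod (f z) \<le> Mf) \<Longrightarrow> (\<And>z. cmod z = R \<Longrightarrow> cmod (g z) \<le> Mg) \<Longrightarrow>
    Mg < cmod (g 0) * (R / r) ^ n \<Longrightarrow> cmod z \<le> r / 2 \<Longrightarrow>
    cmod (h z) * cmod (g 0) ^ 3 \<le> Mf * (4 * Mg\<^sup>2)"
proof (induction n arbitrary: f g)
  have mm: "cmod (k z) \<le> M" if "k holomorphic_on UNIV" "\<And>z. cmod z = R \<Longrightarrow> cmod (k z) \<le> M" "cmod z \<le> R"
    for k M z
    by (rule maximum_modulus_frontier[of k "cball 0 R"])
       (use that r in \<open>auto intro: holomorphic_on_subset holomorphic_on_imp_continuous_on[OF holomorphic_on_subset]\<close>)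
  {
    case (0 f g)
    \<comment> \<open>For exponent 0 the hypotheses contradict the maximum principle: the value at 0
      cannot exceed the bound on the circle.\<close>
    then show ?case using mm[of g Mg 0] r by force
  next
    case (Suc n f g)
    have Mg: "cmod (g u) \<le> Mg" and Mf: "cmod (f u) \<le> Mf" if "cmod u \<le> R" for u
      using mm[OF Suc.prems(2,7) that] mm[OF Suc.prems(1,6) that] by auto
    show ?case
    proof (cases "\<exists>a. cmod a < r \<and> g a = 0")
      case False
      have "cmod (g 0) ^ 3 \<le> 4 * Mg\<^sup>2 * cmod (g z)"
        by (rule zero_free_lower_bound[of g r]) (use Suc.prems False r Mg in \<open>auto intro: holomorphic_on_subset\<close>)
      then have "cmod (h z) * cmod (g 0) ^ 3 \<le> cmod (h z) * (4 * Mg\<^sup>2 * cmod (g z))" by (intro mult_left_mono) auto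
      also have "\<dots> = cmod (f z) * (4 * Mg\<^sup>2)" using Suc.prems(4)[of z] by (simp add: norm_mult)
      also have "\<dots> \<le> Mf * (4 * Mg\<^sup>2)" using Mf[of z] Suc.prems(9) r by (intro mult_right_mono) auto
      finally show ?thesis .
    next
      case True
      then obtain a where a: "cmod a < r" "g a = 0" by blast
      have a0: "a \<noteq> 0" using a Suc.prems(5) by auto
      define q where "q z = (if z = a then deriv g a else (g z - g a) / (z - a))" for z
      have q: "q holomorphic_on UNIV" unfolding q_def by (rule pole_lemma[OF Suc.prems(2)]) auto
      have qg: "q z * (z - a) = g z" for z using a by (auto simp: q_def)
      define g1 where "g1 z = q z * ((of_real (R\<^sup>2) - cnj a * z) / of_real R)" for z
      have g1: "g1 holomorphic_on UNIV" unfolding g1_def using r by (intro holomorphic_intros q) auto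
      have ng1: "cmod (g1 z) = cmod (g z)" if "cmod z = R" for z
      proof -
        have "cmod (g1 z) = cmod (q z) * (R * cmod (z - a) / R)"
          unfolding g1_def norm_mult norm_divide cmod_blaschke_eq[OF that] using r by simp
        also have "\<dots> = cmod (q z * (z - a))" using r by (simp add: norm_mult)
        finally show ?thesis by (simp only: qg)
      qed
      have g10: "cmod (g1 0) = cmod (g 0) * (R / cmod a)"
      proof -
        have "cmod (g1 0) = cmod (q 0) * R" using r by (simp add: g1_def norm_mult norm_divide power2_eq_square)
        moreover have "cmod (q 0) * cmod a = cmod (g 0)" using qg[of 0] by (metis norm_mult norm_minus_cancel diff_0)
        ultimately show ?thesis using a0 by (simp add: field_simps)
      qed
      have Ra: "R / cmod a \<ge> R / r" using a a0 r by (intro divide_left_mono) auto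
      then have ge: "cmod (g1 0) \<ge> cmod (g 0) * (R / r)" unfolding g10 by (intro mult_left_mono) auto
      have ge1: "cmod (g1 0) \<ge> cmod (g 0)"
        using ge mult_left_mono[of 1 "R / r" "cmod (g 0)"] r by simp
      have "cmod (h z) * cmod (g1 0) ^ 3 \<le> Mf * (4 * Mg\<^sup>2)"
      proof (rule Suc.IH[where f = "\<lambda>z. h z * g1 z"])
        show "(\<lambda>z. h z * g1 z) holomorphic_on UNIV" by (intro holomorphic_intros g1 Suc.prems)
        show "g1 0 \<noteq> 0" using ge1 Suc.prems(5) by auto
        show "cmod (h z * g1 z) \<le> Mf" if "cmod z = R" for z
          using Suc.prems(6)[OF that] ng1[OF that] Suc.prems(4)[of z] by (simp add: norm_mult)
        show "cmod (g1 z) \<le> Mg" if "cmod z = R" for z using Suc.prems(7)[OF that] ng1[OF that] by simp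
        have "cmod (g 0) * (R / r) ^ Suc n = cmod (g 0) * (R / r) * (R / r) ^ n" by simp
        also have "\<dots> \<le> cmod (g1 0) * (R / r) ^ n" using ge r by (intro mult_right_mono) auto
        finally show "Mg < cmod (g1 0) * (R / r) ^ n" using Suc.prems(8) by linarith
      qed (use g1 Suc.prems in auto)
      moreover have "cmod (h z) * cmod (g 0) ^ 3 \<le> cmod (h z) * cmod (g1 0) ^ 3"
        using ge1 by (intro mult_left_mono power_mono) auto
      ultimately show ?thesis by linarith
    qed
  }
qed

text \<open>Near the zeros of \<open>g\<close> the quotient cannot be estimated pointwise. After a
  translation that moves a point with nonzero \<open>g\<close> to the origin,
  \<open>quotient_bound_blaschke\<close> is applied with radii proportional to 1 + |z|; its bound is
  a product of powers of circle maxima and so has the same order.\<close>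

theorem ord14_quotient:
  assumes "f holomorphic_on UNIV" "g holomorphic_on UNIV" "h holomorphic_on UNIV"
    and eq: "\<And>z. f z = h z * g z" and g0: "g w \<noteq> 0" and f: "ord14 f" and g: "ord14 g"
  shows "ord14 h"
proof -
  define F G H where "F z = f (z + w)" and "G z = g (z + w)" and "H z = h (z + w)" for z
  have tr: "(\<lambda>z. k (z + w)) holomorphic_on UNIV" if "k holomorphic_on UNIV" for k
  proof -
    have "(\<lambda>z. z + w) holomorphic_on UNIV" by (intro holomorphic_intros)
    then show ?thesis using holomorphic_on_compose_gen[OF _ that, of "\<lambda>z. z + w" UNIV] by (auto simp: o_def)
  qed
  have "ord14 F" "ord14 G" unfolding F_def G_def by (intro ord14_translate f g)+
  then obtain C D where C: "C \<ge> 0" "\<And>z. cmod (F z) \<le> exp (C * (1 + cmod z powr (1/4)))"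
    and D: "D \<ge> 0" "\<And>z. cmod (G z) \<le> exp (D * (1 + cmod z powr (1/4)))"
    unfolding ord14_def by blast
  have G0: "G 0 \<noteq> 0" by (simp add: G_def g0)
  have "ord14 H"
  proof (rule ord14I[of "9 * C + 18 * D" "4 / cmod (G 0) ^ 3"])
    fix z
    define t where "t = 1 + cmod z powr (1/4)"
    \<comment> \<open>This makes |z| smaller than r / 2, while the fourth root of the outer radius 2
      r stays comparable with 1 + |z|^(1/4).\<close>
    define r where "r = 2 * (cmod z + 1)"
    have r: "0 < r" "r < 2 * r" using norm_ge_zero[of z] by (simp_all add: r_def add_nonneg_pos del: norm_ge_zero)
    have tR: "1 + (2 * r) powr (1/4) \<le> 9 * t"
    proof -
      have "(2 * r) powr (1/4) = 4 powr (1/4) * (cmod z + 1) powr (1/4)" by (simp add: r_def powr_mult[symmetric])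
      also have "\<dots> \<le> 4 * (2 * (cmod z powr (1/4) + 1 powr (1/4)))"
        using powr_mono[of "1/4" 1 "4::real"] by (intro mult_mono powr_quarter_add_le) auto
      finally have "(2 * r) powr (1/4) \<le> 8 * cmod z powr (1/4) + 8" by simp
      moreover have "1 + X \<le> 9 * (1 + Y)" if "X \<le> 8 * Y + 8" "0 \<le> Y" for X Y :: real using that by simp
      ultimately show ?thesis unfolding t_def using powr_ge_zero by blast
    qed
    define Mf Mg where "Mf = exp (C * (9 * t))" and "Mg = exp (D * (9 * t))"
    \<comment> \<open>This exponent varies with z and has no uniform bound, but it does not enter
      the resulting estimate.\<close>
    obtain n where n: "Mg / cmod (G 0) < 2 ^ n" using real_arch_pow[of 2] by auto
    have "cmod (H z) * cmod (G 0) ^ 3 \<le> Mf * (4 * Mg\<^sup>2)"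
    proof (rule quotient_bound_blaschke[OF r, where f = F and g = G and h = H and n = n])
      show "F holomorphic_on UNIV" "G holomorphic_on UNIV" "H holomorphic_on UNIV"
        unfolding F_def G_def H_def by (intro tr assms)+
      show "Mg < cmod (G 0) * (2 * r / r) ^ n" using n G0 r by (simp add: field_simps)
      show "cmod (F u) \<le> Mf" if "cmod u = 2 * r" for u
      proof -
        have "C * (1 + (2 * r) powr (1/4)) \<le> C * (9 * t)" using tR C(1) by (rule mult_left_mono)
        then have "exp (C * (1 + (2 * r) powr (1/4))) \<le> Mf" by (simp add: Mf_def)
        then show ?thesis using C(2)[of u] that by simp
      qed
      show "cmod (G u) \<le> Mg" if "cmod u = 2 * r" for u
      proof -
        have "D * (1 + (2 * r) powr (1/4)) \<le> D * (9 * t)" using tR D(1) by (rule mult_left_mono)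
        then have "exp (D * (1 + (2 * r) powr (1/4))) \<le> Mg" by (simp add: Mg_def)
        then show ?thesis using D(2)[of u] that by simp
      qed
    qed (auto simp: F_def G_def H_def eq g0 r_def)
    also have "Mf * (4 * Mg\<^sup>2) = 4 * exp ((9 * C + 18 * D) * t)"
      by (simp add: Mf_def Mg_def exp_add[symmetric] exp_double[symmetric] algebra_simps)
    finally show "cmod (H z) \<le> (4 / cmod (G 0) ^ 3) * exp ((9 * C + 18 * D) * (1 + cmod z powr (1/4)))"
      using G0 unfolding t_def by (simp add: field_simps)
  qed (use C D in auto)
  then have "ord14 (\<lambda>z. H (z + (- w)))" by (rule ord14_translate)
  then show ?thesis by (simp add: H_def)
qed

text \<open>A zero-free \<open>h\<close> is the exponential of an entire function whose real part is
  O(t) on the circle of radius t^4. Borel-Caratheodory then bounds its increment at a fixed z by O(t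
  / t^4), which tends to 0.\<close>

theorem ord14_zero_free_constant:
  assumes hol: "h holomorphic_on UNIV" and nz: "\<And>z. h z \<noteq> 0" and "ord14 h"
  shows "h z = h 0"
proof -
  obtain C where C: "C \<ge> 0" "\<And>z. cmod (h z) \<le> exp (C * (1 + cmod z powr (1/4)))"
    using assms(3) unfolding ord14_def by blast
  obtain \<psi> where \<psi>: "\<psi> holomorphic_on UNIV" "\<And>z. h z = exp (\<psi> z)"
    using contractible_imp_holomorphic_log[OF hol contractible_UNIV] nz by auto
  define \<phi> where "\<phi> z = \<psi> z - \<psi> 0" for z
  define K where "K = \<bar>ln (cmod (h 0))\<bar> + 1 + C"
  have K: "K > 0" using C(1) by (simp add: K_def)
  have bd: "cmod (\<phi> z) * (t ^ 4 - cmod z) \<le> 2 * (K * (1 + t)) * cmod z" if t: "t > 0" "t ^ 4 > cmod z" for t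
  proof (rule borel_caratheodory)
    show "\<phi> holomorphic_on ball 0 (t ^ 4)" unfolding \<phi>_def using \<psi>(1) by (auto intro!: holomorphic_intros intro: holomorphic_on_subset)
    fix u assume u: "cmod u < t ^ 4"
    have "exp (Re (\<phi> u)) = cmod (h u) / cmod (h 0)" by (simp add: \<phi>_def \<psi>(2) exp_diff)
    then have "ln (exp (Re (\<phi> u))) = ln (cmod (h u)) - ln (cmod (h 0))" using nz by (simp add: ln_div)
    then have "Re (\<phi> u) = ln (cmod (h u)) - ln (cmod (h 0))" by simp
    moreover have "ln (cmod (h u)) \<le> ln (exp (C * (1 + cmod u powr (1/4))))"
      using C(2)[of u] nz[of u] by (subst ln_le_cancel_iff) auto
    moreover have "cmod u powr (1/4) \<le> t"
    proof -
      have "cmod u powr (1/4) \<le> (t ^ 4) powr (1/4)" using u by (intro powr_mono2) auto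
      also have "(t ^ 4) powr (1/4) = t" using t power_powr_eq[of t 4 "1/4"] by simp
      finally show ?thesis .
    qed
    then have "C * (1 + cmod u powr (1/4)) \<le> C * (1 + t)" using C(1) by (simp add: mult_left_mono)
    ultimately have "Re (\<phi> u) \<le> C * (1 + t) + \<bar>ln (cmod (h 0))\<bar>" unfolding ln_exp by linarith
    also have "\<dots> < C * (1 + t) + (\<bar>ln (cmod (h 0))\<bar> + 1) * (1 + t)"
      using t by (intro add_strict_left_mono) (simp add: algebra_simps add_pos_nonneg)
    finally show "Re (\<phi> u) < K * (1 + t)" by (simp add: K_def algebra_simps)
  qed (use t in \<open>auto simp: \<phi>_def\<close>)
  have "\<phi> z = 0"
  proof (rule ccontr)
    assume "\<phi> z \<noteq> 0"
    define p where "p = cmod (\<phi> z)"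
    have p: "p > 0" using \<open>\<phi> z \<noteq> 0\<close> by (simp add: p_def)
    \<comment> \<open>Large enough for t^4 > 2 |z| and for p t > 8 K |z|; the estimate p t^4 \<le> 8
      K |z| t then becomes p t^4 < p t^2, impossible for t \<ge> 1.\<close>
    define t where "t = 1 + 2 * cmod z + 8 * K * cmod z / p"
    have t1: "t \<ge> 1" using p K by (auto simp: t_def)
    have "t \<le> t ^ 4" using t1 by (simp add: self_le_power)
    have t4: "2 * cmod z < t ^ 4"
    proof -
      have "2 * cmod z < t" unfolding t_def using p K by (simp add: add_pos_nonneg)
      then show ?thesis using \<open>t \<le> t ^ 4\<close> by linarith
    qed
    have "p * (t ^ 4 / 2) \<le> p * (t ^ 4 - cmod z)" using p t4 by (intro mult_left_mono) auto
    also have "\<dots> \<le> 2 * (K * (1 + t)) * cmod z"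
      unfolding p_def by (rule bd) (use t4 t1 norm_ge_zero[of z] in linarith)+
    also have "\<dots> \<le> 2 * (K * (2 * t)) * cmod z" using t1 K by (intro mult_right_mono mult_left_mono) auto
    finally have "p * t ^ 4 \<le> (8 * K * cmod z) * t" by (simp add: algebra_simps)
    also have "8 * K * cmod z < p * t" using p by (simp add: t_def field_simps add_pos_nonneg)
    finally have "p * t ^ 4 < p * t * t" using t1 by simp
    moreover have "p * t * t \<le> p * t ^ 4"
      using p t1 power_increasing[of 2 4 t] by (simp add: power2_eq_square mult.assoc)
    ultimately show False by linarith
  qed
  then show ?thesis by (simp add: \<phi>_def \<psi>(2))
qed


section \<open>Phragmen-Lindelof along the negative ray\<close>

lemma nonpos_ray_cases:
  fixes x :: real assumes "x \<ge> 0"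
  obtains s where "s \<ge> 0" "x = 4 * s ^ 4"
proof
  show "root 4 (x / 4) \<ge> 0" "x = 4 * root 4 (x / 4) ^ 4" using assms by auto
qed

text \<open>Arbitrarily large radii at which a damping of exponent 3/4 beats growth of exponent 1/2.
  Writing the radius as t^4 turns both powers into integral ones.\<close>

lemma half_plane_growth:
  assumes C: "C \<ge> 0" and e: "e > 0"
  obtains \<rho> where "\<rho> \<ge> (B::real)" "\<rho> > 0" "C * (1 + \<rho> powr (1/2)) \<le> e * \<rho> powr (3/4)"
proof -
  define t where "t = 1 + \<bar>B\<bar> + 2 * C / e"
  have t1: "t \<ge> 1" using C e by (simp add: t_def)
  have "t ^ 4 \<ge> t" using t1 by (simp add: self_le_power)
  moreover have "t \<ge> B" using C e by (simp add: t_def add_increasing2)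
  ultimately have 1: "t ^ 4 \<ge> B" by linarith
  have p: "(t ^ 4) powr (1/2) = t ^ 2" "(t ^ 4) powr (3/4) = t ^ 3"
    using t1 power_powr_eq[of t 4 "1/2"] power_powr_eq[of t 4 "3/4"] by (simp_all add: powr_numeral)
  have "C * (1 + t\<^sup>2) \<le> C * (2 * t\<^sup>2)" using C t1 by (intro mult_left_mono) (auto simp: one_le_power)
  also have "\<dots> = (2 * C) * t\<^sup>2" by simp
  also have "\<dots> \<le> (e * t) * t\<^sup>2"
    using e C by (intro mult_right_mono) (auto simp: t_def field_simps intro: add_nonneg_nonneg)
  also have "\<dots> = e * t ^ 3" by (simp add: power2_eq_square power3_eq_cube)
  finally have "C * (1 + (t ^ 4) powr (1/2)) \<le> e * (t ^ 4) powr (3/4)" by (simp only: p)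
  with 1 show thesis using that[of "t ^ 4"] t1 by auto
qed

text \<open>Phragmen-Lindelof: substituting w^2 maps the right half plane onto the plane slit along the
  negative ray, and the square-root growth there is beaten by the damping exponent 3/4.\<close>

theorem ord14_bounded_on_ray_constant:
  assumes hol: "h holomorphic_on UNIV" and "ord14 h"
    and bd: "\<And>s. s \<ge> s0 \<Longrightarrow> cmod (h (- 4 * of_real (s ^ 4))) \<le> B"
  shows "h z = h 0"
proof -
  obtain C where C: "C \<ge> 0" "\<And>z. cmod (h z) \<le> exp (C * (1 + cmod z powr (1/4)))"
    using assms(2) unfolding ord14_def by blast
  have conth: "continuous_on UNIV h" by (rule holomorphic_on_imp_continuous_on[OF hol])
  have "compact ((\<lambda>s. h (- 4 * of_real (s ^ 4))) ` {0..max s0 0})"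
    by (intro compact_continuous_image compact_Icc continuous_on_compose2[OF conth] continuous_intros) auto
  then have "bounded ((\<lambda>s. h (- 4 * of_real (s ^ 4))) ` {0..max s0 0})" by (rule compact_imp_bounded)
  then obtain B0 where B0: "\<And>s. s \<in> {0..max s0 0} \<Longrightarrow> cmod (h (- 4 * of_real (s ^ 4))) \<le> B0"
    unfolding bounded_iff by blast
  define M where "M = max 1 (max B B0)"
  have ray: "cmod (h (- of_real x)) \<le> M" if "x \<ge> 0" for x
  proof -
    obtain s where s: "s \<ge> 0" "x = 4 * s ^ 4" using nonpos_ray_cases[OF \<open>x \<ge> 0\<close>] by blast
    show ?thesis using bd[of s] B0[of s] s by (cases "s \<ge> s0") (auto simp: M_def le_max_iff_disj)
  qed
  have half: "cmod (h (w\<^sup>2)) \<le> M * exp (e * cmod ((1 + w) powr (3/4)))" if w: "Re w > 0" and e: "e > 0" for w e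
  proof -
    \<comment> \<open>For Re u \<ge> 0 the argument of 1 + u is below pi / 2 in modulus, hence that
      of its power 3/4 below 3 pi / 8, and the damping has real part at least c times its modulus.
      The shift by 1 keeps the branch point away from the closed half plane.\<close>
    define c where "c = cos (3 * pi / 8)"
    have c: "c > 0" unfolding c_def by (rule cos_gt_zero) (use pi_gt_zero in linarith)+
    have pw: "Re ((1 + u) powr (3/4)) \<ge> c * cmod (1 + u) powr (3/4)" if u: "Re u \<ge> 0" for u
    proof -
      have nz: "1 + u \<noteq> 0" using u by (auto simp: complex_eq_iff)
      have arg: "\<bar>Im (Ln (1 + u))\<bar> < pi / 2" using u nz by (intro Re_Ln_pos_lt[THEN iffD2]) auto
      have "(1 + u) powr (3/4) = exp ((3/4) * Ln (1 + u))" using nz by (simp add: powr_def)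
      then have "Re ((1 + u) powr (3/4)) = exp (3/4 * ln (cmod (1 + u))) * cos (3/4 * Im (Ln (1 + u)))"
        using nz by (simp add: Re_exp)
      moreover have "cos (3/4 * Im (Ln (1 + u))) \<ge> c"
      proof -
        have "cos \<bar>3/4 * Im (Ln (1 + u))\<bar> \<ge> cos (3 * pi / 8)"
          using arg pi_gt_zero by (intro cos_monotone_0_pi_le) auto
        then show ?thesis unfolding c_def cos_abs_real .
      qed
      moreover have "exp (3/4 * ln (cmod (1 + u))) = cmod (1 + u) powr (3/4)" using nz by (simp add: powr_def)
      ultimately show ?thesis
        using mult_right_mono[of c "cos (3/4 * Im (Ln (1 + u)))" "cmod (1 + u) powr (3/4)"] by (simp add: mult.commute)
    qed
    define k where "k u = h (u\<^sup>2) * exp (- of_real e * (1 + u) powr (3/4))" for u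
    obtain \<rho> where \<rho>: "\<rho> \<ge> cmod w + 1" "\<rho> > 0" "C * (1 + \<rho> powr (1/2)) \<le> (e * c) * \<rho> powr (3/4)"
      by (rule half_plane_growth[OF C(1) mult_pos_pos[OF e c], of "cmod w + 1"])
    define S where "S = {u. Re u > 0} \<inter> ball 0 \<rho>"
    have opS: "open S" unfolding S_def by (intro open_Int open_halfspace_Re_gt open_ball)
    have clS: "closure S \<subseteq> {u. Re u \<ge> 0} \<inter> cball 0 \<rho>"
      by (rule closure_minimal) (auto simp: S_def intro: closed_Int closed_halfspace_Re_ge)
    have "(\<lambda>u. h (u\<^sup>2)) holomorphic_on {u. Re u > - 1}"
    proof -
      have "(\<lambda>u. u\<^sup>2) holomorphic_on {u. Re u > - 1}" by (intro holomorphic_intros)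
      then show ?thesis using holomorphic_on_compose_gen[OF _ hol, of "\<lambda>u. u\<^sup>2"] by (auto simp: o_def)
    qed
    then have holk: "k holomorphic_on {u. Re u > - 1}"
      unfolding k_def by (intro holomorphic_intros) (auto simp: complex_nonpos_Reals_iff)
    have "cmod (k w) \<le> M"
    proof (rule maximum_modulus_frontier[where f = k and S = S and \<xi> = w])
      show "k holomorphic_on interior S"
        by (rule holomorphic_on_subset[OF holk]) (use interior_subset[of S] in \<open>auto simp: S_def\<close>)
      show "continuous_on (closure S) k"
        by (rule holomorphic_on_imp_continuous_on, rule holomorphic_on_subset[OF holk]) (use clS in force)
      show "bounded S" unfolding S_def by (auto intro: bounded_Int)
      show "w \<in> S" using w \<rho>(1) by (auto simp: S_def)
      fix u assume "u \<in> frontier S"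
      then have fr: "u \<in> closure S" "u \<notin> S" using opS by (auto simp: frontier_def interior_open)
      then have u: "Re u \<ge> 0" "cmod u \<le> \<rho>" using clS by auto
      have nk: "cmod (k u) = cmod (h (u\<^sup>2)) * exp (- (e * Re ((1 + u) powr (3/4))))"
        by (simp add: k_def norm_mult)
      show "cmod (k u) \<le> M"
      proof (cases "Re u = 0")
        case True
        have "u\<^sup>2 = - of_real ((Im u)\<^sup>2)" using True by (simp add: complex_eq_iff power2_eq_square)
        then have "cmod (h (u\<^sup>2)) \<le> M" using ray[of "(Im u)\<^sup>2"] by simp
        moreover have "exp (- (e * Re ((1 + u) powr (3/4)))) \<le> 1"
        proof -
          have "0 \<le> c * cmod (1 + u) powr (3/4)" using c by simp
          then have "0 \<le> Re ((1 + u) powr (3/4))" using pw[OF u(1)] by linarith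
          then show ?thesis using e by simp
        qed
        ultimately show ?thesis unfolding nk using mult_mono[of "cmod (h (u\<^sup>2))" M _ 1] by (simp add: M_def)
      next
        case False
        then have cu: "cmod u = \<rho>" using u fr by (auto simp: S_def)
        have "cmod (h (u\<^sup>2)) \<le> exp (C * (1 + cmod (u\<^sup>2) powr (1/4)))" by (rule C(2))
        also have "cmod (u\<^sup>2) powr (1/4) = \<rho> powr (1/2)"
          using \<rho>(2) power_powr_eq[of \<rho> 2 "1/4"] by (simp add: norm_power cu)
        also have "exp (C * (1 + \<rho> powr (1/2))) \<le> exp ((e * c) * \<rho> powr (3/4))" using \<rho>(3) by simp
        also have "(e * c) * \<rho> powr (3/4) \<le> e * Re ((1 + u) powr (3/4))"
        proof -
          have "(cmod u)\<^sup>2 \<le> (cmod (1 + u))\<^sup>2" unfolding cmod_power2 using u by (simp add: power2_eq_square algebra_simps)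
          then have "cmod u \<le> cmod (1 + u)" by (rule power2_le_imp_le) simp
          then have "\<rho> powr (3/4) \<le> cmod (1 + u) powr (3/4)" using cu \<rho>(2) by (intro powr_mono2) auto
          then have "c * \<rho> powr (3/4) \<le> Re ((1 + u) powr (3/4))"
            using pw[OF u(1)] mult_left_mono[of _ _ c] c by (smt (verit))
          then show ?thesis using e by (simp add: mult.assoc)
        qed
        then have "exp ((e * c) * \<rho> powr (3/4)) \<le> exp (e * Re ((1 + u) powr (3/4)))" by simp
        finally have "cmod (k u) \<le> exp (e * Re ((1 + u) powr (3/4))) * exp (- (e * Re ((1 + u) powr (3/4))))"
          unfolding nk by (rule mult_right_mono) simp
        also have "\<dots> = 1" by (simp add: exp_add[symmetric])
        finally show ?thesis by (simp add: M_def)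
      qed
    qed
    moreover have "cmod (h (w\<^sup>2)) = cmod (k w) * exp (e * Re ((1 + w) powr (3/4)))"
      by (simp add: k_def norm_mult mult.assoc exp_add[symmetric])
    moreover have "exp (e * Re ((1 + w) powr (3/4))) \<le> exp (e * cmod ((1 + w) powr (3/4)))"
      using e complex_Re_le_cmod by (simp add: mult_left_mono)
    ultimately show ?thesis using mult_mono[of "cmod (k w)" M] by (simp add: M_def)
  qed
  \<comment> \<open>Every z is the square of its principal root. If the root has real part 0, then z
    lies on the ray; otherwise \<open>half\<close> applies and the damping parameter tends to 0 with
    z fixed.\<close>
  have bounded: "cmod (h z) \<le> M" for z
  proof (cases "Re (csqrt z) > 0")
    case False
    then have "Re (csqrt z) = 0" using csqrt_principal[of z] by auto
    then have "z = - of_real ((Im (csqrt z))\<^sup>2)"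
      by (metis (no_types, lifting) complex_eq complex_of_real_def mult_zero_left power2_csqrt power2_i power_mult_distrib add_0 of_real_0 mult_minus1 of_real_power)
    then show ?thesis using ray[of "(Im (csqrt z))\<^sup>2"] by (metis zero_le_power2)
  next
    case True
    define q where "q = cmod ((1 + csqrt z) powr (3/4))"
    have "((\<lambda>e. M * exp (e * q)) \<longlongrightarrow> M * exp (0 * q)) (at_right 0)" by (intro tendsto_intros)
    moreover have "\<forall>\<^sub>F e in at_right 0. cmod (h z) \<le> M * exp (e * q)"
      using half[OF True] by (intro eventually_at_right_less[THEN eventually_mono]) (simp add: q_def)
    ultimately have "cmod (h z) \<le> M * exp (0 * q)"
      by (intro tendsto_lowerbound[of _ _ "at_right (0::real)"]) auto
    then show ?thesis by simp
  qed
  obtain c where "\<And>z. h z = c"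
  proof -
    have "bounded (range h)" unfolding bounded_iff using bounded by auto
    then have "h constant_on UNIV" by (rule Liouville_theorem[OF hol])
    then show thesis using that unfolding constant_on_def by auto
  qed
  then show ?thesis by simp
qed

text \<open>Decay implies boundedness on the ray, so h is constant, and the constant equals the
  limit 0.\<close>

corollary ord14_decaying_on_ray_zero:
  assumes hol: "h holomorphic_on UNIV" and o: "ord14 h" and s0: "s0 \<ge> 1"
    and bd: "\<And>s. s \<ge> s0 \<Longrightarrow> cmod (h (- 4 * of_real (s ^ 4))) \<le> B / s"
  shows "h z = 0"
proof -
  have hc: "h z = h 0" for z
  proof (rule ord14_bounded_on_ray_constant[OF hol o, of s0 "\<bar>B\<bar>"])
    fix s assume s: "s \<ge> s0"
    have "B / s \<le> \<bar>B\<bar> / s" using s s0 by (intro divide_right_mono) auto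
    also have "\<dots> \<le> \<bar>B\<bar> / 1" using s s0 by (intro divide_left_mono) auto
    finally show "cmod (h (- 4 * of_real (s ^ 4))) \<le> \<bar>B\<bar>" using bd[OF s] by simp
  qed
  have "((\<lambda>s. B / s) \<longlongrightarrow> 0) at_top" by (intro tendsto_divide_0[OF tendsto_const] filterlim_at_top_imp_at_infinity filterlim_ident)
  moreover have "\<forall>\<^sub>F s in at_top. cmod (h 0) \<le> B / s"
    using eventually_ge_at_top[of s0] by eventually_elim (metis bd hc)
  ultimately have "cmod (h 0) \<le> 0" by (intro tendsto_lowerbound[of "\<lambda>s. B / s" 0 at_top]) auto
  then show ?thesis using hc[of z] by simp
qed


section \<open>Entire functions with the same zeros and multiplicities\<close>

lemma zorder_eq_zero_mult:
  assumes f: "f holomorphic_on UNIV" and nz: "f w \<noteq> 0"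
  shows "zero_mult f z = enat (nat (zorder f z))" "zorder f z \<ge> 0"
proof -
  have ex: "\<exists>k. (deriv ^^ k) f z \<noteq> 0"
  proof (rule ccontr)
    assume "\<not> ?thesis"
    then have "f w = 0"
      by (intro holomorphic_fun_eq_0_on_connected[OF f open_UNIV connected_UNIV, of z w]) auto
    then show False using nz by simp
  qed
  define k where "k = (LEAST k. (deriv ^^ k) f z \<noteq> 0)"
  have "(deriv ^^ k) f z \<noteq> 0" unfolding k_def using ex by (rule LeastI_ex)
  moreover have "(deriv ^^ i) f z = 0" if "i < k" for i using not_less_Least[OF that[unfolded k_def]] by auto
  ultimately have "zorder f z = int k" by (intro zorder_zero_eqI[OF f]) auto
  then show "zero_mult f z = enat (nat (zorder f z))" "zorder f z \<ge> 0"
    using ex by (simp_all add: zero_mult_def k_def)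
qed

text \<open>Near each point both functions are the same power times nonvanishing factors, so f / g
  has a removable singularity with a nonzero value. The points w and w' exclude the zero function,
  whose \<open>zero_mult\<close> is infinite everywhere.\<close>

lemma same_zeros_quotient:
  assumes f: "f holomorphic_on UNIV" "f w \<noteq> 0" and g: "g holomorphic_on UNIV" "g w' \<noteq> 0"
    and eq: "zero_mult f = zero_mult g"
  obtains h where "h holomorphic_on UNIV" "\<And>z. h z \<noteq> 0" "\<And>z. f z = h z * g z"
proof -
  define h where "h = remove_sings (\<lambda>z. f z / g z)"
  have main: "h analytic_on {z} \<and> h z \<noteq> 0 \<and> f z = h z * g z" for z
  proof -
    define n where "n = zorder f z"
    have n: "n \<ge> 0" "zorder g z = n"
      using zorder_eq_zero_mult[OF f, of z] zorder_eq_zero_mult[OF g, of z] eq by (auto simp: n_def fun_eq_iff)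
    obtain r1 where r1: "r1 > 0" "zor_poly f z holomorphic_on cball z r1"
      "\<And>u. u \<in> cball z r1 \<Longrightarrow> f u = zor_poly f z u * (u - z) ^ nat n \<and> zor_poly f z u \<noteq> 0"
      using zorder_exist_zero[OF f(1) open_UNIV connected_UNIV UNIV_I, of z] bexI[of "\<lambda>w. f w \<noteq> 0" w UNIV, OF f(2) UNIV_I] unfolding n_def by blast
    obtain r2 where r2: "r2 > 0" "zor_poly g z holomorphic_on cball z r2"
      "\<And>u. u \<in> cball z r2 \<Longrightarrow> g u = zor_poly g z u * (u - z) ^ nat n \<and> zor_poly g z u \<noteq> 0"
      using zorder_exist_zero[OF g(1) open_UNIV connected_UNIV UNIV_I, of z] bexI[of "\<lambda>w. g w \<noteq> 0" w' UNIV, OF g(2) UNIV_I] unfolding n(2) by blast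
    define r where "r = min r1 r2"
    define k where "k u = zor_poly f z u / zor_poly g z u" for u
    have r: "r > 0" using r1(1) r2(1) by (simp add: r_def)
    have kh: "k holomorphic_on ball z r"
      unfolding k_def using r2(3)
      by (intro holomorphic_intros holomorphic_on_subset[OF r1(2)] holomorphic_on_subset[OF r2(2)]) (auto simp: r_def)
    have fg: "f u / g u = k u" if "u \<in> ball z r - {z}" for u
      using r1(3)[of u] r2(3)[of u] that by (auto simp: k_def r_def)
    have "isCont k z" using holomorphic_on_imp_continuous_on[OF kh] r by (simp add: continuous_on_eq_continuous_at)
    then have "k \<midarrow>z\<rightarrow> k z" by (simp add: isCont_def)
    then have lim: "(\<lambda>u. f u / g u) \<midarrow>z\<rightarrow> k z"
      by (rule Lim_transform_within_open[of _ _ _ _ "ball z r"]) (use r fg in auto)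
    have "(\<lambda>u. f u / g u) holomorphic_on ball z r - {z}"
      by (rule holomorphic_transform[OF holomorphic_on_subset[OF kh]]) (use fg in auto)
    then have iso: "isolated_singularity_at (\<lambda>u. f u / g u) z"
      using r by (meson analytic_on_open isolated_singularity_at_def open_ball open_delete)
    have hz: "h z = k z" unfolding h_def by (rule remove_sings_eqI[OF lim])
    have k0: "k z \<noteq> 0" "zor_poly g z z \<noteq> 0" using r1(3)[of z] r2(3)[of z] r1(1) r2(1) by (auto simp: k_def)
    have "f z = k z * g z" using r1(3)[of z] r2(3)[of z] r1(1) r2(1) by (auto simp: k_def)
    then show ?thesis using remove_sings_analytic_at[OF iso lim] hz k0 by (simp add: h_def)
  qed
  show thesis
  proof (rule that)
    show "h holomorphic_on UNIV"
      using main by (metis analytic_imp_holomorphic analytic_on_analytic_at)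
  qed (use main in auto)
qed

corollary ord14_same_zeros_proportional:
  assumes f: "f holomorphic_on UNIV" "ord14 f" "f w \<noteq> 0" and g: "g holomorphic_on UNIV" "ord14 g" "g w' \<noteq> 0"
    and eq: "zero_mult f = zero_mult g"
  obtains c where "c \<noteq> 0" "\<And>z. f z = c * g z"
proof -
  obtain h where h: "h holomorphic_on UNIV" "\<And>z. h z \<noteq> 0" "\<And>z. f z = h z * g z"
    using same_zeros_quotient[OF f(1,3) g(1,3) eq] by blast
  have "ord14 h" by (rule ord14_quotient[OF f(1) g(1) h(1,3) g(3) f(2) g(2)])
  then have "h z = h 0" for z by (rule ord14_zero_free_constant[OF h(1,2)])
  then show thesis using that[of "h 0"] h by metis
qed

section \<open>The first-order system of the fourth-order equation\<close>

lemma mult_le_sum_squares: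
  fixes a b :: real assumes "0 \<le> a" "0 \<le> b" shows "a * b \<le> a\<^sup>2 + b\<^sup>2"
proof -
  have "0 \<le> a * b" using assms by simp
  then show ?thesis using sum_squares_bound[of a b] unfolding mult.assoc by linarith
qed

lemma absolutely_integrable_mult_L2:
  assumes f: "L2_01 f" and g: "L2_01 g"
  shows "(\<lambda>x. f x * g x) absolutely_integrable_on {0..1}"
proof -
  have "integrable lborel (\<lambda>x. indicat_real {0..1} x *\<^sub>R (f x * g x))"
  proof (rule Bochner_Integration.integrable_bound)
    show "integrable lborel (\<lambda>x. indicat_real {0..1} x *\<^sub>R complex_of_real ((cmod (f x))\<^sup>2) +
        indicat_real {0..1} x *\<^sub>R complex_of_real ((cmod (g x))\<^sup>2))"
      using f g by (intro Bochner_Integration.integrable_add) (auto simp: L2_01_def set_integrable_def)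
    have "(\<lambda>x. (indicat_real {0..1} x *\<^sub>R f x) * (indicat_real {0..1} x *\<^sub>R g x)) \<in> borel_measurable lborel"
      using f g by (intro borel_measurable_times) (auto simp: L2_01_def set_borel_measurable_def)
    moreover have "(\<lambda>x. (indicat_real {0..1} x *\<^sub>R f x) * (indicat_real {0..1} x *\<^sub>R g x))
        = (\<lambda>x. indicat_real {0..1} x *\<^sub>R (f x * g x))" by (auto simp: indicator_def)
    ultimately show "(\<lambda>x. indicat_real {0..1} x *\<^sub>R (f x * g x)) \<in> borel_measurable lborel" by simp
    show "AE x in lborel. norm (indicat_real {0..1} x *\<^sub>R (f x * g x)) \<le> norm (indicat_real {0..1} x *\<^sub>R complex_of_real ((cmod (f x))\<^sup>2) +
        indicat_real {0..1} x *\<^sub>R complex_of_real ((cmod (g x))\<^sup>2))"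
    proof (rule AE_I2)
      fix x
      have "cmod (f x) * cmod (g x) \<le> (cmod (f x))\<^sup>2 + (cmod (g x))\<^sup>2"
        by (rule mult_le_sum_squares) auto
      moreover have "cmod (complex_of_real ((cmod (f x))\<^sup>2) + complex_of_real ((cmod (g x))\<^sup>2)) = (cmod (f x))\<^sup>2 + (cmod (g x))\<^sup>2"
        unfolding of_real_add[symmetric] norm_of_real by simp
      ultimately show "norm (indicat_real {0..1} x *\<^sub>R (f x * g x)) \<le> norm (indicat_real {0..1} x *\<^sub>R complex_of_real ((cmod (f x))\<^sup>2) +
        indicat_real {0..1} x *\<^sub>R complex_of_real ((cmod (g x))\<^sup>2))"
        by (auto simp: indicator_def norm_mult)
    qed
  qed
  then show ?thesis unfolding set_integrable_def
    by (subst integrable_completion) (auto dest: borel_measurable_integrable)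
qed

lemma L2_01_const: "L2_01 (\<lambda>x. c)"
  unfolding L2_01_def set_borel_measurable_def set_integrable_def by auto

lemma absolutely_integrable_L2: "L2_01 f \<Longrightarrow> f absolutely_integrable_on {0..1}"
  using absolutely_integrable_mult_L2[OF L2_01_const[of 1]] by simp

lemma sum_lessThan_4: "(\<Sum>j<(4::nat). f j) = f 0 + f 1 + f 2 + (f 3 :: 'a::comm_monoid_add)"
  by (simp add: eval_nat_numeral add.assoc)

lemma all_less_4: "(\<forall>i<(4::nat). P i) \<longleftrightarrow> P 0 \<and> P 1 \<and> P 2 \<and> P 3"
  by (auto simp: eval_nat_numeral less_Suc_eq)

lemma less_4_cases: "(i::nat) < 4 \<Longrightarrow> i = 0 \<or> i = 1 \<or> i = 2 \<or> i = 3" by auto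

text \<open>Coefficients of the first-order system satisfied by the quasi-derivatives of a solution.\<close>
definition coef :: "(real \<Rightarrow> complex) \<Rightarrow> (real \<Rightarrow> complex) \<Rightarrow> complex \<Rightarrow> nat \<Rightarrow> nat \<Rightarrow> real \<Rightarrow> complex" where
  "coef t1 t2 l i j x = Fmat t1 t2 (Suc i) (Suc j) x + l * (if i = 3 \<and> j = 0 then 1 else 0)"

lemma coef_sum:
  "(\<Sum>j<4. coef t1 t2 l 0 j x * y j) = y 1"
  "(\<Sum>j<4. coef t1 t2 l 1 j x * y j) = - t2 x * y 0 + t1 x * y 1 + y 2"
  "(\<Sum>j<4. coef t1 t2 l 2 j x * y j) = t1 x * t2 x * y 0 + (2 * t2 x - (t1 x)\<^sup>2) * y 1 - t1 x * y 2 + y 3"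
  "(\<Sum>j<4. coef t1 t2 l 3 j x * y j) = ((t2 x)\<^sup>2 + l) * y 0 - t1 x * t2 x * y 1 - t2 x * y 2"
  by (simp_all add: sum_lessThan_4 coef_def Fmat_def algebra_simps)

lemma lin_sol_coef_iff:
  "lin_sol 4 (coef t1 t2 l) y \<longleftrightarrow> (\<forall>i<4. acon 0 1 (y i)) \<and> (AE x in lborel. x \<in> {0<..<1} \<longrightarrow>
     (y 0 has_vector_derivative y 1 x) (at x) \<and>
     (y 1 has_vector_derivative - t2 x * y 0 x + t1 x * y 1 x + y 2 x) (at x) \<and>
     (y 2 has_vector_derivative t1 x * t2 x * y 0 x + (2 * t2 x - (t1 x)\<^sup>2) * y 1 x - t1 x * y 2 x + y 3 x) (at x) \<and>
     (y 3 has_vector_derivative ((t2 x)\<^sup>2 + l) * y 0 x - t1 x * t2 x * y 1 x - t2 x * y 2 x) (at x))"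
  unfolding lin_sol_def all_less_4 coef_sum[where y = "\<lambda>j. y j _"] by simp

lemma sum_atLeast1_atMost:
  "(\<Sum>j=1..1::nat. f j) = f 1" "(\<Sum>j=1..2::nat. f j) = f 1 + f 2" "(\<Sum>j=1..3::nat. f j) = f 1 + f 2 + f 3"
  "(\<Sum>j=1..4::nat. f j) = f 1 + f 2 + f 3 + (f 4 :: 'a::comm_monoid_add)"
  by (simp_all add: eval_nat_numeral add.assoc)

lemma ball_atLeast1_atMost_4: "(\<forall>k\<in>{1..4::nat}. P k) \<longleftrightarrow> P 1 \<and> P 2 \<and> P 3 \<and> P 4"
  by (auto simp: eval_nat_numeral le_Suc_eq atLeastAtMost_def)

text \<open>In \<open>is_solution\<close> the fourth quasi-derivative is a component of
  \<open>Y\<close> in its own right; replacing it by l * Y 0 closes the system of the first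
  four.\<close>

lemma is_solution_iff_lin_sol:
  "is_solution 4 (Fmat t1 t2) l Y \<longleftrightarrow> lin_sol 4 (coef t1 t2 l) Y \<and> (AE x in lborel. x \<in> {0<..<1} \<longrightarrow> Y 4 x = l * Y 0 x)"
proof -
  let ?P = "\<lambda>x. \<forall>k\<in>{1..4}. (Y (k - 1) has_vector_derivative
                        (Y k x + (\<Sum>j=1..k. Fmat t1 t2 k j x * Y (j - 1) x))) (at x)"
  let ?Q = "\<lambda>x. (Y 0 has_vector_derivative Y 1 x) (at x) \<and>
     (Y 1 has_vector_derivative - t2 x * Y 0 x + t1 x * Y 1 x + Y 2 x) (at x) \<and>
     (Y 2 has_vector_derivative t1 x * t2 x * Y 0 x + (2 * t2 x - (t1 x)\<^sup>2) * Y 1 x - t1 x * Y 2 x + Y 3 x) (at x) \<and>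
     (Y 3 has_vector_derivative ((t2 x)\<^sup>2 + l) * Y 0 x - t1 x * t2 x * Y 1 x - t2 x * Y 2 x) (at x)"
  have pt: "?P x \<longleftrightarrow> ?Q x" if "Y 4 x = l * Y 0 x" for x
  proof -
    have 1: "Y 1 x + (\<Sum>j=1..1. Fmat t1 t2 1 j x * Y (j - 1) x) = Y 1 x"
      by (simp add: Fmat_def)
    have 2: "Y 2 x + (\<Sum>j=1..2. Fmat t1 t2 2 j x * Y (j - 1) x) = - t2 x * Y 0 x + t1 x * Y 1 x + Y 2 x"
      unfolding sum_atLeast1_atMost by (simp add: Fmat_def)
    have 3: "Y 3 x + (\<Sum>j=1..3. Fmat t1 t2 3 j x * Y (j - 1) x)
        = t1 x * t2 x * Y 0 x + (2 * t2 x - (t1 x)\<^sup>2) * Y 1 x - t1 x * Y 2 x + Y 3 x"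
      unfolding sum_atLeast1_atMost by (simp add: Fmat_def algebra_simps)
    have 4: "Y 4 x + (\<Sum>j=1..4. Fmat t1 t2 4 j x * Y (j - 1) x)
        = ((t2 x)\<^sup>2 + l) * Y 0 x - t1 x * t2 x * Y 1 x - t2 x * Y 2 x"
      unfolding sum_atLeast1_atMost that by (simp add: Fmat_def algebra_simps)
    show ?thesis unfolding ball_atLeast1_atMost_4 1 2 3 4 by simp
  qed
  have "(AE x in lborel. x \<in> {0<..<1} \<longrightarrow> ?P x) \<longleftrightarrow> (AE x in lborel. x \<in> {0<..<1} \<longrightarrow> ?Q x)"
    if *: "AE x in lborel. x \<in> {0<..<1} \<longrightarrow> Y 4 x = l * Y 0 x"
  proof
    assume "AE x in lborel. x \<in> {0<..<1} \<longrightarrow> ?P x"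
    with * show "AE x in lborel. x \<in> {0<..<1} \<longrightarrow> ?Q x" by eventually_elim (use pt in blast)
  next
    assume "AE x in lborel. x \<in> {0<..<1} \<longrightarrow> ?Q x"
    with * show "AE x in lborel. x \<in> {0<..<1} \<longrightarrow> ?P x" by eventually_elim (use pt in blast)
  qed
  then show ?thesis
    unfolding is_solution_def quasi_derivs_def lin_sol_coef_iff acon_iff_abs_cont_on by blast
qed

text \<open>The solution esol t1 t2 l k has initial quasi-derivatives (0, .., 1, .., 0) with 1 at
  position k, so that it is the solution C with index 4 - k of the paper.\<close>
definition esol :: "(real \<Rightarrow> complex) \<Rightarrow> (real \<Rightarrow> complex) \<Rightarrow> complex \<Rightarrow> nat \<Rightarrow> nat \<Rightarrow> real \<Rightarrow> complex" where
  "esol t1 t2 l k = (SOME Y. \<forall>l. lin_sol 4 (coef t1 t2 l) (Y l) \<and> (\<forall>i<4. Y l i 0 = (if i = k then 1 else 0)) \<and>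
    (\<forall>i<4. \<forall>x\<in>{0..1}. (\<lambda>l. Y l i x) holomorphic_on UNIV)) l"

lemma lin_sol_lincomb:
  assumes "lin_sol n A y" "lin_sol n A z"
  shows "lin_sol n A (\<lambda>i x. a * y i x + b * z i x)"
  unfolding lin_sol_def
proof
  show "\<forall>i<n. acon 0 1 (\<lambda>x. a * y i x + b * z i x)"
    using assms by (auto simp: lin_sol_def intro!: acon_add acon_mult acon_const)
  have "AE x in lborel. x \<in> {0<..<1} \<longrightarrow> (\<forall>i<n. (y i has_vector_derivative (\<Sum>j<n. A i j x * y j x)) (at x))"
    "AE x in lborel. x \<in> {0<..<1} \<longrightarrow> (\<forall>i<n. (z i has_vector_derivative (\<Sum>j<n. A i j x * z j x)) (at x))"
    using assms by (auto simp: lin_sol_def)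
  then show "AE x in lborel. x \<in> {0<..<1} \<longrightarrow> (\<forall>i<n. ((\<lambda>x. a * y i x + b * z i x) has_vector_derivative
      (\<Sum>j<n. A i j x * (a * y j x + b * z j x))) (at x))"
  proof eventually_elim
    case (elim x)
    have "(\<Sum>j<n. A i j x * (a * y j x + b * z j x)) = a * (\<Sum>j<n. A i j x * y j x) + b * (\<Sum>j<n. A i j x * z j x)" for i
      by (simp add: sum_distrib_left sum.distrib algebra_simps)
    then show ?case using elim by (auto intro!: has_vector_derivative_add has_vector_derivative_mult_right)
  qed
qed

lemma lin_sol_scale:
  assumes "lin_sol n A y" "\<And>i. i < n \<Longrightarrow> c i \<noteq> 0"
  shows "lin_sol n (\<lambda>i j x. c i / c j * A i j x) (\<lambda>i x. c i * y i x)"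
  unfolding lin_sol_def
proof
  show "\<forall>i<n. acon 0 1 (\<lambda>x. c i * y i x)"
    using assms by (auto simp: lin_sol_def intro!: acon_mult acon_const)
  have "AE x in lborel. x \<in> {0<..<1} \<longrightarrow> (\<forall>i<n. (y i has_vector_derivative (\<Sum>j<n. A i j x * y j x)) (at x))"
    using assms by (auto simp: lin_sol_def)
  then show "AE x in lborel. x \<in> {0<..<1} \<longrightarrow> (\<forall>i<n. ((\<lambda>x. c i * y i x) has_vector_derivative
      (\<Sum>j<n. c i / c j * A i j x * (c j * y j x))) (at x))"
  proof eventually_elim
    case (elim x)
    have "(\<Sum>j<n. c i / c j * A i j x * (c j * y j x)) = c i * (\<Sum>j<n. A i j x * y j x)" for i
      unfolding sum_distrib_left by (intro sum.cong) (use assms(2) in auto)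
    then show ?case using elim by (auto intro!: has_vector_derivative_mult_right)
  qed
qed

locale fourth_order =
  fixes t1 t2 :: "real \<Rightarrow> complex"
  assumes t1: "L2_01 t1" and t2: "L2_01 t2"
begin

text \<open>A common integrable majorant of the entries formed from \<open>t1\<close> and
  \<open>t2\<close>: all of them are at most quadratic in these functions.\<close>

definition m :: "real \<Rightarrow> real" where "m x = 1 + (cmod (t1 x))\<^sup>2 + (cmod (t2 x))\<^sup>2"

lemma m_integrable: "m absolutely_integrable_on {0..1}"
proof -
  have "(\<lambda>x. (cmod (f x))\<^sup>2) absolutely_integrable_on {0..1}" if "L2_01 f" for f
    using absolutely_integrable_norm[OF absolutely_integrable_mult_L2[OF that that]]
    by (simp add: o_def norm_mult power2_eq_square)
  moreover have "(\<lambda>x::real. 1::real) absolutely_integrable_on {0..1}"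
    by (intro absolutely_integrable_continuous_real continuous_intros)
  ultimately show ?thesis unfolding m_def[abs_def] using t1 t2 by (intro set_integral_add(1)) auto
qed

lemma m_ge:
  "cmod (t1 x) \<le> m x" "cmod (t2 x) \<le> m x" "cmod (t1 x * t2 x) \<le> m x" "cmod ((t2 x)\<^sup>2) \<le> m x"
  "cmod (2 * t2 x - (t1 x)\<^sup>2) \<le> m x" "0 \<le> m x"
proof -
  have sq: "2 * a * b \<le> a\<^sup>2 + b\<^sup>2" for a b :: real using sum_squares_bound[of a b] by simp
  show "cmod (t1 x) \<le> m x" "cmod (t2 x) \<le> m x"
    using sq[of 1 "cmod (t1 x)"] sq[of 1 "cmod (t2 x)"] by (simp_all add: m_def) (smt (verit) norm_ge_zero zero_le_power2)+
  show "cmod (t1 x * t2 x) \<le> m x"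
    using mult_le_sum_squares[of "cmod (t1 x)" "cmod (t2 x)"] by (simp add: m_def norm_mult)
  show "cmod ((t2 x)\<^sup>2) \<le> m x" by (simp add: m_def norm_power)
  have "cmod (2 * t2 x - (t1 x)\<^sup>2) \<le> 2 * cmod (t2 x) + (cmod (t1 x))\<^sup>2"
    using norm_triangle_ineq4[of "2 * t2 x" "(t1 x)\<^sup>2"] by (simp add: norm_mult norm_power)
  then show "cmod (2 * t2 x - (t1 x)\<^sup>2) \<le> m x" using sq[of 1 "cmod (t2 x)"] by (simp add: m_def)
  show "0 \<le> m x" by (simp add: m_def)
qed

lemma Fmat_integrable: "Fmat t1 t2 k j absolutely_integrable_on {0..1}"
proof -
  have c: "(\<lambda>x::real. c::complex) absolutely_integrable_on {0..1}" for c
    by (intro absolutely_integrable_continuous_real continuous_intros)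
  have p: "(\<lambda>x. t1 x * t2 x) absolutely_integrable_on {0..1}" "(\<lambda>x. (t2 x)\<^sup>2) absolutely_integrable_on {0..1}"
    "(\<lambda>x. (t1 x)\<^sup>2) absolutely_integrable_on {0..1}" "t1 absolutely_integrable_on {0..1}" "t2 absolutely_integrable_on {0..1}"
    using absolutely_integrable_mult_L2[OF t1 t2] absolutely_integrable_mult_L2[OF t2 t2]
      absolutely_integrable_mult_L2[OF t1 t1] t1 t2
    by (auto simp: power2_eq_square intro: absolutely_integrable_L2)
  have mi: "(\<lambda>x. - f x) absolutely_integrable_on {0..1}" if "f absolutely_integrable_on {0..1}" for f :: "real \<Rightarrow> complex"
    using set_integrable_mult_right[of "-1" lebesgue "{0..1}" f] that by simp
  have q1: "(\<lambda>x. - (t1 x)\<^sup>2 + 2 * t2 x) absolutely_integrable_on {0..1}"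
    using p by (intro set_integral_add(1) mi set_integrable_mult_right)
  have q2: "(\<lambda>x. - t1 x * t2 x) absolutely_integrable_on {0..1}" using mi[OF p(1)] by simp
  have ite: "(\<lambda>x. if P then f x else g x) absolutely_integrable_on {0..1}"
    if "f absolutely_integrable_on {0..1}" "g absolutely_integrable_on {0..1}" for P and f g :: "real \<Rightarrow> complex"
    using that by (cases P) auto
  show ?thesis unfolding Fmat_def[abs_def]
    by (intro ite p c q1 q2 mi[OF p(4)] mi[OF p(5)])
qed

sublocale lin_sys 4 "coef t1 t2 l" for l
proof
  fix i j :: nat
  show "coef t1 t2 l i j absolutely_integrable_on {0..1}"
    unfolding coef_def[abs_def] by (intro set_integral_add(1) Fmat_integrable
      absolutely_integrable_continuous_real continuous_intros)
qed

lemma esol_props: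
  "lin_sol 4 (coef t1 t2 l) (esol t1 t2 l k)"
  "i < 4 \<Longrightarrow> esol t1 t2 l k i 0 = (if i = k then 1 else 0)"
  "i < 4 \<Longrightarrow> x \<in> {0..1} \<Longrightarrow> (\<lambda>l. esol t1 t2 l k i x) holomorphic_on UNIV"
proof -
  let ?P = "\<lambda>Y. \<forall>l. lin_sol 4 (coef t1 t2 l) (Y l) \<and> (\<forall>i<4. Y l i 0 = (if i = k then 1 else 0)) \<and>
    (\<forall>i<4. \<forall>x\<in>{0..1}. (\<lambda>l. Y l i x) holomorphic_on UNIV)"
  have "(\<lambda>x::real. c::complex) absolutely_integrable_on {0..1}" for c
    by (intro absolutely_integrable_continuous_real continuous_intros)
  then have "\<exists>Y. ?P Y"
    using lin_sol_param_exists[of 4 "\<lambda>i j. Fmat t1 t2 (Suc i) (Suc j)" "\<lambda>i j x. if i = 3 \<and> j = 0 then 1 else 0"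
       "\<lambda>i. if i = k then 1 else 0", OF Fmat_integrable]
    unfolding coef_def[abs_def] by blast
  then have "?P (\<lambda>l. esol t1 t2 l k)" unfolding esol_def by (rule someI_ex)
  then show "lin_sol 4 (coef t1 t2 l) (esol t1 t2 l k)"
    "i < 4 \<Longrightarrow> esol t1 t2 l k i 0 = (if i = k then 1 else 0)"
    "i < 4 \<Longrightarrow> x \<in> {0..1} \<Longrightarrow> (\<lambda>l. esol t1 t2 l k i x) holomorphic_on UNIV" by blast+
qed

text \<open>\<open>fund_sol\<close> is chosen separately for each \<open>l\<close> and is arbitrary
  outside [0, 1]. Uniqueness identifies it on [0, 1] with the family \<open>esol\<close>, which is
  entire in \<open>l\<close>.\<close>

lemma fund_sol_eq:
  assumes r: "r \<in> {1..4}" and i: "i < 4" and x: "x \<in> {0..1}"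
  shows "fund_sol 4 (Fmat t1 t2) l r i x = esol t1 t2 l (4 - r) i x"
proof -
  let ?P = "\<lambda>Y. is_solution 4 (Fmat t1 t2) l Y \<and> (\<forall>s\<in>{1..4}. Y (4 - s) 0 = (if s = r then 1 else 0))"
  define Y where "Y j x = (if j = 4 then l * esol t1 t2 l (4 - r) 0 x else esol t1 t2 l (4 - r) j x)" for j x
  have "lin_sol 4 (coef t1 t2 l) Y"
    using esol_props(1)[of l "4 - r"] unfolding lin_sol_coef_iff all_less_4 Y_def[abs_def] by simp
  then have "?P Y"
    unfolding is_solution_iff_lin_sol using r by (auto simp: Y_def esol_props(2))
  then have P: "?P (fund_sol 4 (Fmat t1 t2) l r)" unfolding fund_sol_def by (rule someI[where P = ?P])
  show ?thesis
  proof (rule lin_sol_unique[OF _ esol_props(1) _ i x])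
    show "lin_sol 4 (coef t1 t2 l) (fund_sol 4 (Fmat t1 t2) l r)" using P is_solution_iff_lin_sol by blast
    fix j :: nat assume j: "j < 4"
    have "fund_sol 4 (Fmat t1 t2) l r (4 - (4 - j)) 0 = (if 4 - j = r then 1 else 0)"
      using P j by (metis (no_types, lifting) atLeastAtMost_iff diff_le_self less_imp_diff_less zero_less_diff Suc_leI One_nat_def)
    then show "fund_sol 4 (Fmat t1 t2) l r j 0 = esol t1 t2 l (4 - r) j 0"
      using j r by (auto simp: esol_props(2))
  qed
qed

text \<open>Component i is divided by \<open>\<rho>\<close>^i, where \<open>\<rho>\<close> = 1 +
  |l|^(1/4). The ones above the diagonal become \<open>\<rho>\<close>, the parameter l becomes at
  most \<open>\<rho>\<close>, and the entries on or below the diagonal do not grow, so the column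
  sums are at most \<open>\<rho>\<close> + 3 m. Undoing the scaling costs \<open>\<rho>\<close>^3
  \<le> 6 exp \<open>\<rho>\<close>.\<close>

lemma esol_growth:
  assumes i: "i < 4" and k: "k < 4" and x: "x \<in> {0..1}"
  shows "ord14 (\<lambda>l. esol t1 t2 l k i x)"
proof (rule ord14I[of 2 "6 * exp (3 * integral {0..1} m)"])
  fix l :: complex
  define \<rho> where "\<rho> = 1 + cmod l powr (1/4)"
  have \<rho>: "\<rho> \<ge> 1" by (simp add: \<rho>_def)
  have l4: "cmod l \<le> \<rho> ^ 4"
  proof -
    have "cmod l = (cmod l powr (1/4)) ^ 4"
      by (cases "l = 0") (auto simp: powr_powr simp flip: powr_realpow)
    also have "\<dots> \<le> \<rho> ^ 4" by (intro power_mono) (auto simp: \<rho>_def)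
    finally show ?thesis .
  qed
  define c where "c i = complex_of_real (1 / \<rho> ^ i)" for i :: nat
  have c0: "c i \<noteq> 0" for i using \<rho> by (simp add: c_def)
  define A where "A i j x = c i / c j * coef t1 t2 l i j x" for i j x
  define a where "a x = \<rho> + 3 * m x" for x
  have sys: "lin_sys 4 A"
    unfolding lin_sys_def A_def[abs_def] by (intro allI impI set_integrable_mult_right) (use A in auto)
  have col: "(\<Sum>i<4. cmod (A i j x)) \<le> a x" if j: "j < 4" for j x
  proof -
    have cc: "cmod (c i / c j * z) = cmod z * \<rho> ^ j / \<rho> ^ i" for i j z
      using \<rho> by (simp add: c_def norm_mult norm_divide norm_power)
    have dv: "a / \<rho> ^ n \<le> a" if "a \<ge> 0" for a n
      using divide_left_mono[of 1 "\<rho> ^ n" a] that \<rho> by simp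
    have l3: "cmod l / \<rho> ^ 3 \<le> \<rho>" using l4 \<rho> by (simp add: divide_simps power_def numeral_eq_Suc mult.assoc)
    have t: "cmod ((t2 x)\<^sup>2 + l) / \<rho> ^ 3 \<le> m x + \<rho>"
    proof -
      have "cmod ((t2 x)\<^sup>2 + l) / \<rho> ^ 3 \<le> cmod ((t2 x)\<^sup>2) / \<rho> ^ 3 + cmod l / \<rho> ^ 3"
        using \<rho> norm_triangle_ineq[of "(t2 x)\<^sup>2" l] by (simp add: add_divide_distrib[symmetric] divide_right_mono)
      then show ?thesis using l3 dv[of "cmod ((t2 x)\<^sup>2)" 3] m_ge(4)[of x] by simp
    qed
    note M = m_ge[of x]
    have e: "cmod z * \<rho> ^ j / \<rho> ^ i \<le> m x" if "cmod z \<le> m x" "j \<le> i" for z i j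
    proof -
      have "cmod z * \<rho> ^ j / \<rho> ^ i = cmod z / \<rho> ^ (i - j)" using \<rho> that(2) by (simp add: power_diff field_simps)
      also have "\<dots> \<le> cmod z" by (rule dv) simp
      finally show ?thesis using that(1) by simp
    qed
    consider "j = 0" | "j = 1" | "j = 2" | "j = 3" using less_4_cases[OF j] by blast
    then show ?thesis
    proof cases
      case 1
      have "cmod (A 1 0 x) \<le> m x" "cmod (A 2 0 x) \<le> m x" "cmod (A 3 0 x) \<le> m x + \<rho>" "A 0 0 x = 0"
        unfolding A_def cc using e[of "- t2 x" 0 1] e[of "t1 x * t2 x" 0 2] M t
        by (auto simp: coef_def Fmat_def)
      then show ?thesis using 1 M(6) by (simp add: sum_lessThan_4 a_def)
    next
      case 2
      have "cmod (A 0 1 x) = \<rho>" "cmod (A 1 1 x) \<le> m x" "cmod (A 2 1 x) \<le> m x" "cmod (A 3 1 x) \<le> m x"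
        unfolding A_def cc using e[of "t1 x" 1 1] e[of "2 * t2 x - (t1 x)\<^sup>2" 1 2] e[of "t1 x * t2 x" 1 3] M
        by (auto simp: coef_def Fmat_def)
      then show ?thesis using 2 M(6) by (simp add: sum_lessThan_4 a_def)
    next
      case 3
      have "A 0 2 x = 0" "cmod (A 1 2 x) = \<rho>" "cmod (A 2 2 x) \<le> m x" "cmod (A 3 2 x) \<le> m x"
        unfolding A_def cc using e[of "- t1 x" 2 2] e[of "- t2 x" 2 3] M \<rho>
        by (auto simp: coef_def Fmat_def power2_eq_square)
      then show ?thesis using 3 M(6) by (simp add: sum_lessThan_4 a_def)
    next
      case 4
      have "A 0 3 x = 0" "A 1 3 x = 0" "cmod (A 2 3 x) = \<rho>" "A 3 3 x = 0"
        unfolding A_def cc using \<rho> by (auto simp: coef_def Fmat_def power2_eq_square power3_eq_cube)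
      then show ?thesis using 4 M(6) by (simp add: sum_lessThan_4 a_def)
    qed
  qed
  have sol: "lin_sol 4 A (\<lambda>i x. c i * esol t1 t2 l k i x)"
    unfolding A_def[abs_def] by (rule lin_sol_scale[OF esol_props(1) c0])
  have a: "a absolutely_integrable_on {0..1}"
    unfolding a_def[abs_def] by (intro set_integral_add(1) set_integrable_mult_right m_integrable
       absolutely_integrable_continuous_real continuous_intros)
  have "(\<Sum>i<4. cmod (c i * esol t1 t2 l k i x)) \<le> (\<Sum>i<4. cmod (c i * esol t1 t2 l k i 0)) * exp (integral {0..x} a)"
    by (rule lin_sys.lin_sol_bound[OF sys sol a col _ x]) (use \<rho> m_ge(6) in \<open>auto simp: a_def\<close>)
  also have "(\<Sum>i<4. cmod (c i * esol t1 t2 l k i 0)) = cmod (c k)"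
    using less_4_cases[OF k] by (auto simp: sum_lessThan_4 esol_props(2))
  also have "cmod (c k) \<le> 1" using \<rho> by (simp add: c_def norm_divide norm_power one_le_power)
  also have "integral {0..x} a \<le> \<rho> + 3 * integral {0..1} m"
  proof -
    have "integral {0..x} a \<le> integral {0..1} a"
      using x \<rho> m_ge(6) by (intro integral_subset_le absolutely_integrable_imp_integrable a absolutely_integrable_subinterval[OF a])
        (auto simp: a_def)
    also have "\<dots> = \<rho> + 3 * integral {0..1} m"
      unfolding a_def[abs_def] by (subst integral_add)
        (auto intro!: integrable_on_mult_right absolutely_integrable_imp_integrable m_integrable)
    finally show ?thesis .
  qed
  finally have S: "(\<Sum>i<4. cmod (c i * esol t1 t2 l k i x)) \<le> exp (\<rho> + 3 * integral {0..1} m)"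
    by (simp add: mult_left_mono)
  have "cmod (esol t1 t2 l k i x) = \<rho> ^ i * cmod (c i * esol t1 t2 l k i x)"
    using \<rho> by (simp add: c_def norm_mult norm_divide norm_power)
  also have "\<dots> \<le> \<rho> ^ 3 * (\<Sum>i<4. cmod (c i * esol t1 t2 l k i x))"
    using i \<rho> by (intro mult_mono power_increasing member_le_sum) auto
  also have "\<dots> \<le> (6 * exp \<rho>) * exp (\<rho> + 3 * integral {0..1} m)"
  proof (rule mult_mono[OF _ S])
    have "\<rho> ^ 3 / fact 3 \<le> exp \<rho>"
      using exp_lower_Taylor_quadratic \<rho> sum_le_suminf[OF summable_exp, of "{3}" \<rho>]
      by (auto simp: exp_def field_simps)
    then show "\<rho> ^ 3 \<le> 6 * exp \<rho>" by (simp add: fact_numeral)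
  qed (auto intro: sum_nonneg)
  also have "\<dots> = 6 * exp (3 * integral {0..1} m) * exp (2 * \<rho>)"
    by (simp add: exp_add[symmetric] algebra_simps)
  finally show "cmod (esol t1 t2 l k i x) \<le> 6 * exp (3 * integral {0..1} m) * exp (2 * (1 + cmod l powr (1/4)))"
    by (simp add: \<rho>_def)
qed auto

end

section \<open>Solutions on the negative ray\<close>

text \<open>For \<open>\<lambda> = -4 s^4\<close> the characteristic exponents are \<open>s \<mu>\<close> with \<open>\<mu>\<close> one of the four numbers
  \<open>\<plusminus>1 \<plusminus> i\<close>; \<open>mode s \<mu> y\<close> is the corresponding left eigenvector applied to the scaled vector
  \<open>(y 0, y 1 / s, y 2 / s^2, y 3 / s^3)\<close>.\<close>

definition mode :: "real \<Rightarrow> complex \<Rightarrow> (nat \<Rightarrow> real \<Rightarrow> complex) \<Rightarrow> real \<Rightarrow> complex" where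
  "mode s \<mu> y x = \<mu>^3 * y 0 x + \<mu>\<^sup>2 * (y 1 x / s) + \<mu> * (y 2 x / s^2) + y 3 x / s^3"

definition grow :: "real \<Rightarrow> (nat \<Rightarrow> real \<Rightarrow> complex) \<Rightarrow> real \<Rightarrow> real" where
  "grow s y x = cmod (mode s (1 + \<i>) y x) + cmod (mode s (1 - \<i>) y x)"

definition decay :: "real \<Rightarrow> (nat \<Rightarrow> real \<Rightarrow> complex) \<Rightarrow> real \<Rightarrow> real" where
  "decay s y x = cmod (mode s (- 1 + \<i>) y x) + cmod (mode s (- 1 - \<i>) y x)"

text \<open>Discrete Fourier inversion over the four roots of \<mu>^4 = -4: the sum of \<mu>^j over
  the roots vanishes unless 4 divides j, so the coefficient of \<mu>^j is a quarter of the sum of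
  z(\<mu>) / \<mu>^j.\<close>

lemma modes_inverse:
  fixes wa wb wc wd :: complex
  defines "z \<equiv> \<lambda>\<mu>. \<mu>^3 * wa + \<mu>\<^sup>2 * wb + \<mu> * wc + wd"
  shows "16 * wa = (- 1 - \<i>) * z (1 + \<i>) + (- 1 + \<i>) * z (1 - \<i>) + (1 - \<i>) * z (- 1 + \<i>) + (1 + \<i>) * z (- 1 - \<i>)"
    "8 * wb = - \<i> * z (1 + \<i>) + \<i> * z (1 - \<i>) + \<i> * z (- 1 + \<i>) - \<i> * z (- 1 - \<i>)"
    "8 * wc = (1 - \<i>) * z (1 + \<i>) + (1 + \<i>) * z (1 - \<i>) + (- 1 - \<i>) * z (- 1 + \<i>) + (- 1 + \<i>) * z (- 1 - \<i>)"
    "4 * wd = z (1 + \<i>) + z (1 - \<i>) + z (- 1 + \<i>) + z (- 1 - \<i>)"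
proof -
  have i2: "\<i> * \<i> = - 1" by simp
  show "16 * wa = (- 1 - \<i>) * z (1 + \<i>) + (- 1 + \<i>) * z (1 - \<i>) + (1 - \<i>) * z (- 1 + \<i>) + (1 + \<i>) * z (- 1 - \<i>)"
    "8 * wb = - \<i> * z (1 + \<i>) + \<i> * z (1 - \<i>) + \<i> * z (- 1 + \<i>) - \<i> * z (- 1 - \<i>)"
    "8 * wc = (1 - \<i>) * z (1 + \<i>) + (1 + \<i>) * z (1 - \<i>) + (- 1 - \<i>) * z (- 1 + \<i>) + (- 1 + \<i>) * z (- 1 - \<i>)"
    "4 * wd = z (1 + \<i>) + z (1 - \<i>) + z (- 1 + \<i>) + z (- 1 - \<i>)"
    unfolding z_def using i2 by algebra+
qed

lemma modes_bound:
  fixes wa wb wc wd :: complex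
  defines "z \<equiv> \<lambda>\<mu>. \<mu>^3 * wa + \<mu>\<^sup>2 * wb + \<mu> * wc + wd"
  defines "N \<equiv> cmod (z (1 + \<i>)) + cmod (z (1 - \<i>)) + (cmod (z (- 1 + \<i>)) + cmod (z (- 1 - \<i>)))"
  shows "4 * cmod wa \<le> N" "4 * cmod wb \<le> N" "4 * cmod wc \<le> N" "4 * cmod wd \<le> N"
proof -
  have c: "cmod (1 + \<i>) \<le> 2" "cmod (1 - \<i>) \<le> 2" "cmod (- 1 + \<i>) \<le> 2" "cmod (- 1 - \<i>) \<le> 2"
    using norm_triangle_ineq[of 1 \<i>] norm_triangle_ineq4[of 1 \<i>] norm_triangle_ineq[of "- 1" \<i>] norm_triangle_ineq4[of "- 1" \<i>]
    by auto
  have four: "cmod (a + b + c + d) \<le> cmod a + cmod b + cmod c + cmod d" for a b c d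
    using norm_triangle_ineq[of "a + b + c" d] norm_triangle_ineq[of "a + b" c] norm_triangle_ineq[of a b] by linarith
  have m: "cmod (a * b) \<le> 2 * cmod b" if "cmod a \<le> 2" for a b
    unfolding norm_mult using that by (rule mult_right_mono) simp
  have comb: "cmod (p * a + q * b + r * c + t * d) \<le> 2 * (cmod a + cmod b + (cmod c + cmod d))"
    if "cmod p \<le> 2" "cmod q \<le> 2" "cmod r \<le> 2" "cmod t \<le> 2" for p q r t a b c d
    using four[of "p * a" "q * b" "r * c" "t * d"] m[OF that(1), of a] m[OF that(2), of b] m[OF that(3), of c] m[OF that(4), of d]
    unfolding distrib_left by linarith
  note inv = modes_inverse[where wa = wa and wb = wb and wc = wc and wd = wd]
  have "cmod (16 * wa) \<le> 2 * N"
    unfolding inv(1) N_def z_def by (intro comb c)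
  moreover have N0: "0 \<le> N" by (auto simp: N_def)
  ultimately show "4 * cmod wa \<le> N" by (simp add: norm_mult)
  have "8 * wb = - \<i> * z (1 + \<i>) + \<i> * z (1 - \<i>) + \<i> * z (- 1 + \<i>) + (- \<i>) * z (- 1 - \<i>)" using inv(2) unfolding z_def by simp
  then have "cmod (8 * wb) \<le> N"
    unfolding N_def using four[of "- \<i> * z (1 + \<i>)" "\<i> * z (1 - \<i>)" "\<i> * z (- 1 + \<i>)" "(- \<i>) * z (- 1 - \<i>)"] by (simp add: norm_mult)
  then show "4 * cmod wb \<le> N" using N0 by (simp add: norm_mult)
  have "cmod (8 * wc) \<le> 2 * N"
    unfolding inv(3) N_def z_def by (intro comb c)
  then show "4 * cmod wc \<le> N" by (simp add: norm_mult)
  have "cmod (4 * wd) \<le> N" unfolding inv(4) N_def z_def using four[of "z (1 + \<i>)" "z (1 - \<i>)" "z (- 1 + \<i>)" "z (- 1 - \<i>)"] by (simp add: z_def)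
  then show "4 * cmod wd \<le> N" by (simp add: norm_mult)
qed

lemma component_bound:
  assumes "i < 4" shows "4 * cmod (y i x / of_real s ^ i) \<le> grow s y x + decay s y x"
  using modes_bound[where wa = "y 0 x" and wb = "y 1 x / s" and wc = "y 2 x / s^2" and wd = "y 3 x / s^3"] less_4_cases[OF assms]
  unfolding grow_def decay_def mode_def by auto

lemma mode_exponents:
  "(1 + \<i>) ^ 4 = - 4" "(1 - \<i>) ^ 4 = - 4" "(- 1 + \<i>) ^ 4 = - 4" "(- 1 - \<i>) ^ 4 = - 4"
proof -
  have i2: "\<i> * \<i> = - 1" by simp
  show "(1 + \<i>) ^ 4 = - 4" "(1 - \<i>) ^ 4 = - 4" "(- 1 + \<i>) ^ 4 = - 4" "(- 1 - \<i>) ^ 4 = - 4"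
    using i2 by algebra+
qed

lemma mode_numbers:
  "cmod (1 + \<i>) \<le> 2" "cmod (1 - \<i>) \<le> 2" "cmod (- 1 + \<i>) \<le> 2" "cmod (- 1 - \<i>) \<le> 2"
  "cmod ((1 + \<i>)\<^sup>2) \<le> 2" "cmod ((1 - \<i>)\<^sup>2) \<le> 2" "cmod ((- 1 + \<i>)\<^sup>2) \<le> 2" "cmod ((- 1 - \<i>)\<^sup>2) \<le> 2"
proof -
  show "cmod (1 + \<i>) \<le> 2" "cmod (1 - \<i>) \<le> 2" "cmod (- 1 + \<i>) \<le> 2" "cmod (- 1 - \<i>) \<le> 2"
    using norm_triangle_ineq[of 1 \<i>] norm_triangle_ineq4[of 1 \<i>] norm_triangle_ineq[of "- 1" \<i>] norm_triangle_ineq4[of "- 1" \<i>]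
    by auto
  show "cmod ((1 + \<i>)\<^sup>2) \<le> 2" "cmod ((1 - \<i>)\<^sup>2) \<le> 2" "cmod ((- 1 + \<i>)\<^sup>2) \<le> 2" "cmod ((- 1 - \<i>)\<^sup>2) \<le> 2"
    unfolding norm_power cmod_power2 by auto
qed

context fourth_order
begin

definition ray_sol :: "real \<Rightarrow> (nat \<Rightarrow> real \<Rightarrow> complex) \<Rightarrow> bool" where
  "ray_sol s y \<longleftrightarrow> lin_sol 4 (coef t1 t2 (- 4 * of_real (s ^ 4))) y"

text \<open>The inhomogeneity in the equation of a mode: its derivative is s \<mu> times the mode
  plus this term, which collects the contributions of \<open>t1\<close> and
  \<open>t2\<close>.\<close>

definition pert :: "real \<Rightarrow> complex \<Rightarrow> (nat \<Rightarrow> real \<Rightarrow> complex) \<Rightarrow> real \<Rightarrow> complex" where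
  "pert s \<mu> y x = \<mu>\<^sup>2 * ((- t2 x * y 0 x + t1 x * y 1 x) / s) +
     \<mu> * ((t1 x * t2 x * y 0 x + (2 * t2 x - (t1 x)\<^sup>2) * y 1 x - t1 x * y 2 x) / s^2) +
     ((t2 x)\<^sup>2 * y 0 x - t1 x * t2 x * y 1 x - t2 x * y 2 x) / s^3"

text \<open>\<open>pert_bound\<close> produces the factor 13/4 in front of \<open>m\<close>, rounded
  up to 5.\<close>

definition al :: "real \<Rightarrow> real" where "al x = 5 * m x"

lemma al_integrable: "al absolutely_integrable_on {0..1}"
  unfolding al_def[abs_def] by (intro set_integrable_mult_right m_integrable)

lemma al_nonneg: "0 \<le> al x" unfolding al_def using m_ge(6) by simp

lemma al_mult_integrable:
  assumes "continuous_on {0..1} f" "0 \<le> u" "v \<le> 1"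
  shows "(\<lambda>t. al t * f t) integrable_on {u..v}"
  by (intro absolutely_integrable_imp_integrable absolutely_integrable_subinterval[OF
      absolutely_integrable_mult_continuous[OF al_integrable assms(1)]] assms(2,3))

lemma ray_sol_continuous: "ray_sol s y \<Longrightarrow> i < 4 \<Longrightarrow> continuous_on {0..1} (y i)"
  unfolding ray_sol_def by (rule lin_sol_continuous)

lemma mode_continuous: "ray_sol s y \<Longrightarrow> s \<ge> 1 \<Longrightarrow> continuous_on {0..1} (mode s \<mu> y)"
  unfolding mode_def[abs_def]
  by (intro continuous_intros ray_sol_continuous[of s y]) auto

lemma grow_decay_continuous:
  assumes "ray_sol s y" "s \<ge> 1"
  shows "continuous_on {0..1} (grow s y)" "continuous_on {0..1} (decay s y)"
  unfolding grow_def[abs_def] decay_def[abs_def] by (intro continuous_intros mode_continuous assms)+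

text \<open>Each y j occurs in \<open>pert\<close> divided by at least s^j, so it is controlled by
  its scaled component. The term \<open>t1\<close> * y 1 / s gains no further power of s: the
  perturbation stays of the size of the modes, and smallness has to come from
  \<open>concentration\<close>.\<close>

lemma pert_bound:
  assumes s: "s \<ge> 1" and \<mu>: "cmod \<mu> \<le> 2" "cmod (\<mu>\<^sup>2) \<le> 2"
  shows "cmod (pert s \<mu> y x) \<le> al x * (grow s y x + decay s y x)"
proof -
  define N where "N = grow s y x + decay s y x"
  have w: "cmod (y 0 x) \<le> N / 4" "cmod (y 1 x) / s \<le> N / 4" "cmod (y 2 x) / s^2 \<le> N / 4"
    using component_bound[of 0 y x s] component_bound[of 1 y x s] component_bound[of 2 y x s] s
    by (simp_all add: N_def norm_divide norm_power mult.commute)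
  have N0: "N \<ge> 0" using order_trans[OF norm_ge_zero w(1)] by simp
  note M = m_ge[of x]
  have q: "cmod (y 0 x) / s^k \<le> N / 4" for k
    using order_trans[OF divide_left_mono[of 1 "s ^ k" "cmod (y 0 x)"], of "N / 4"] w(1) s by (simp add: one_le_power)
  have q1: "cmod (y 1 x) / s^k \<le> N / 4" if "k \<ge> 1" for k
    by (rule order_trans[OF divide_left_mono[of s "s ^ k" "cmod (y 1 x)"] w(2)]) (use s power_increasing[of 1 k s] that in auto)
  have q2: "cmod (y 2 x) / s^k \<le> N / 4" if "k \<ge> 2" for k
    by (rule order_trans[OF divide_left_mono[of "s^2" "s ^ k" "cmod (y 2 x)"] w(3)]) (use s power_increasing[of 2 k s] that in auto)
  define P where "P = m x * (N / 4)"
  have tm: "cmod (a * b) / s^k \<le> P" if "cmod a \<le> m x" "cmod b / s^k \<le> N / 4" for a b k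
  proof -
    have "cmod (a * b) / s^k = cmod a * (cmod b / s^k)" by (simp add: norm_mult)
    also have "\<dots> \<le> P" unfolding P_def using that M(6) N0 s by (intro mult_mono) auto
    finally show ?thesis .
  qed
  have two: "cmod ((a + b) / s) \<le> cmod a / s^1 + cmod b / s^1" for a b :: complex
    using s norm_triangle_ineq[of a b]
    by (simp add: norm_divide add_divide_distrib[symmetric] divide_right_mono)
  have three: "cmod ((a + b - c) / s^k) \<le> cmod a / s^k + cmod b / s^k + cmod c / s^k"
    "cmod ((a - b - c) / s^k) \<le> cmod a / s^k + cmod b / s^k + cmod c / s^k" for a b c :: complex and k
  proof -
    have "cmod (a + b - c) \<le> cmod a + cmod b + cmod c" "cmod (a - b - c) \<le> cmod a + cmod b + cmod c"
      using norm_triangle_ineq4[of "a - b" c] norm_triangle_ineq4[of a b]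
        norm_triangle_ineq4[of "a + b" c] norm_triangle_ineq[of a b] by linarith+
    then show "cmod ((a + b - c) / s^k) \<le> cmod a / s^k + cmod b / s^k + cmod c / s^k"
      "cmod ((a - b - c) / s^k) \<le> cmod a / s^k + cmod b / s^k + cmod c / s^k"
      using s by (simp_all add: norm_divide norm_power add_divide_distrib[symmetric] divide_right_mono)
  qed
  have 1: "cmod ((- t2 x * y 0 x + t1 x * y 1 x) / s) \<le> P + P"
    by (rule order_trans[OF two add_mono[OF tm tm]]) (use M q[of 1] q1[of 1] in auto)
  have 2: "cmod ((t1 x * t2 x * y 0 x + (2 * t2 x - (t1 x)\<^sup>2) * y 1 x - t1 x * y 2 x) / s^2) \<le> P + P + P"
    by (rule order_trans[OF three(1) add_mono[OF add_mono[OF tm tm] tm]]) (use M q q1 q2 in auto)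
  have 3: "cmod (((t2 x)\<^sup>2 * y 0 x - t1 x * t2 x * y 1 x - t2 x * y 2 x) / s^3) \<le> P + P + P"
    by (rule order_trans[OF three(2) add_mono[OF add_mono[OF tm tm] tm]]) (use M q q1 q2 in auto)
  have mu: "cmod (a * b) \<le> 2 * c" if "cmod a \<le> 2" "cmod b \<le> c" for a b c
    unfolding norm_mult using that by (intro mult_mono) auto
  have "cmod (pert s \<mu> y x) \<le> 2 * (P + P) + 2 * (P + P + P) + (P + P + P)"
    unfolding pert_def
    by (intro norm_triangle_le[OF add_mono] order_trans[OF norm_triangle_ineq add_mono] mu \<mu> 1 2 3)
  also have "\<dots> \<le> al x * N" using M(6) N0 mult_nonneg_nonneg[of "m x" N] by (simp add: al_def P_def)
  finally show ?thesis by (simp add: N_def)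
qed

text \<open>The integrating factor exp(-s \<mu> t) removes the principal part of the equation of the
  mode and leaves the integral of \<open>pert\<close>.\<close>

lemma mode_variation:
  assumes y: "ray_sol s y" and s: "s \<ge> 1" and \<mu>: "\<mu> ^ 4 = - 4" "cmod \<mu> \<le> 2" "cmod (\<mu>\<^sup>2) \<le> 2"
    and uv: "0 \<le> u" "u \<le> v" "v \<le> 1"
  shows "cmod (exp (- (s * \<mu> * v)) * mode s \<mu> y v - exp (- (s * \<mu> * u)) * mode s \<mu> y u)
    \<le> integral {u..v} (\<lambda>t. al t * (exp (- (s * Re \<mu> * t)) * (grow s y t + decay s y t)))"
proof -
  define E where "E t = exp (- (complex_of_real s * \<mu> * of_real t))" for t :: real
  have E': "(E has_vector_derivative - (s * \<mu>) * E t) (at t)" for t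
    unfolding E_def
    by (rule has_vector_derivative_real_field) (auto intro!: derivative_eq_intros)
  have nE: "cmod (E t) = exp (- (s * Re \<mu> * t))" for t by (simp add: E_def)
  have sol: "lin_sol 4 (coef t1 t2 (- 4 * of_real (s ^ 4))) y" using y by (simp add: ray_sol_def)
  define c where "c = complex_of_real s"
  define r where "r = inverse c"
  have cr: "c * r = 1" using s by (simp add: c_def r_def)
  have mode_eq: "mode s \<mu> y t = \<mu>^3 * y 0 t + \<mu>\<^sup>2 * (y 1 t * r) + \<mu> * (y 2 t * r^2) + y 3 t * r^3" for t
    by (simp add: mode_def r_def c_def divide_inverse power_inverse)
  have pert_eq: "pert s \<mu> y t = \<mu>\<^sup>2 * ((- t2 t * y 0 t + t1 t * y 1 t) * r) +
     \<mu> * ((t1 t * t2 t * y 0 t + (2 * t2 t - (t1 t)\<^sup>2) * y 1 t - t1 t * y 2 t) * r^2) +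
     ((t2 t)\<^sup>2 * y 0 t - t1 t * t2 t * y 1 t - t2 t * y 2 t) * r^3" for t
    by (simp add: pert_def r_def c_def divide_inverse power_inverse)
  have ac: "acon u v (\<lambda>t. E t * mode s \<mu> y t)"
  proof (rule acon_mult)
    have "continuous_on {u..v} (\<lambda>t. - (s * \<mu>) * E t)" unfolding E_def by (intro continuous_intros)
    then have "bounded ((\<lambda>t. - (s * \<mu>) * E t) ` {u..v})"
      by (intro compact_imp_bounded compact_continuous_image compact_Icc)
    then obtain B where "\<forall>t\<in>{u..v}. cmod (- (s * \<mu>) * E t) \<le> B" unfolding bounded_iff by blast
    then show "acon u v E" using E' by (intro acon_C1[where B = B and f' = "\<lambda>t. - (s * \<mu>) * E t"]) auto
    have yi: "acon u v (y i)" if "i < 4" for i using sol that uv by (auto simp: lin_sol_def intro: acon_subset)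
    have "acon u v (\<lambda>x. \<mu>^3 * y 0 x + \<mu>\<^sup>2 * (y 1 x * r) + \<mu> * (y 2 x * r^2) + y 3 x * r^3)"
      by (intro acon_add acon_mult acon_const yi) auto
    then show "acon u v (mode s \<mu> y)" unfolding mode_eq[abs_def] .
  qed
  have "AE x in lborel. x \<in> {0<..<1} \<longrightarrow>
     (y 0 has_vector_derivative y 1 x) (at x) \<and>
     (y 1 has_vector_derivative - t2 x * y 0 x + t1 x * y 1 x + y 2 x) (at x) \<and>
     (y 2 has_vector_derivative t1 x * t2 x * y 0 x + (2 * t2 x - (t1 x)\<^sup>2) * y 1 x - t1 x * y 2 x + y 3 x) (at x) \<and>
     (y 3 has_vector_derivative ((t2 x)\<^sup>2 + (- 4 * of_real (s ^ 4))) * y 0 x - t1 x * t2 x * y 1 x - t2 x * y 2 x) (at x)"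
    using sol unfolding lin_sol_coef_iff by blast
  then have ae: "AE t in lborel. t \<in> {u<..<v} \<longrightarrow>
     ((\<lambda>t. E t * mode s \<mu> y t) has_vector_derivative E t * pert s \<mu> y t) (at t)"
  proof eventually_elim
    case (elim t)
    show ?case
    proof
      assume t: "t \<in> {u<..<v}"
      then have d: "(y 0 has_vector_derivative y 1 t) (at t)"
       "(y 1 has_vector_derivative - t2 t * y 0 t + t1 t * y 1 t + y 2 t) (at t)"
       "(y 2 has_vector_derivative t1 t * t2 t * y 0 t + (2 * t2 t - (t1 t)\<^sup>2) * y 1 t - t1 t * y 2 t + y 3 t) (at t)"
       "(y 3 has_vector_derivative ((t2 t)\<^sup>2 + (- 4 * of_real (s ^ 4))) * y 0 t - t1 t * t2 t * y 1 t - t2 t * y 2 t) (at t)"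
        using elim uv by auto
      have "((\<lambda>t. E t * (\<mu>^3 * y 0 t + \<mu>\<^sup>2 * (y 1 t * r) + \<mu> * (y 2 t * r^2) + y 3 t * r^3))
         has_vector_derivative E t * (\<mu>^3 * y 1 t + \<mu>\<^sup>2 * ((- t2 t * y 0 t + t1 t * y 1 t + y 2 t) * r) +
           \<mu> * ((t1 t * t2 t * y 0 t + (2 * t2 t - (t1 t)\<^sup>2) * y 1 t - t1 t * y 2 t + y 3 t) * r^2) +
           (((t2 t)\<^sup>2 + (- 4 * c ^ 4)) * y 0 t - t1 t * t2 t * y 1 t - t2 t * y 2 t) * r^3)
           + (- (c * \<mu>) * E t) * (\<mu>^3 * y 0 t + \<mu>\<^sup>2 * (y 1 t * r) + \<mu> * (y 2 t * r^2) + y 3 t * r^3)) (at t)"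
        using d E' unfolding of_real_power c_def[symmetric]
        by (intro has_vector_derivative_mult has_vector_derivative_add has_vector_derivative_mult_right
            has_vector_derivative_mult_left)
      also have "E t * (\<mu>^3 * y 1 t + \<mu>\<^sup>2 * ((- t2 t * y 0 t + t1 t * y 1 t + y 2 t) * r) +
           \<mu> * ((t1 t * t2 t * y 0 t + (2 * t2 t - (t1 t)\<^sup>2) * y 1 t - t1 t * y 2 t + y 3 t) * r^2) +
           (((t2 t)\<^sup>2 + (- 4 * c ^ 4)) * y 0 t - t1 t * t2 t * y 1 t - t2 t * y 2 t) * r^3)
           + (- (c * \<mu>) * E t) * (\<mu>^3 * y 0 t + \<mu>\<^sup>2 * (y 1 t * r) + \<mu> * (y 2 t * r^2) + y 3 t * r^3)
         = E t * pert s \<mu> y t"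
        \<comment> \<open>The term -4 s^4 y 0 / s^3 coming from the spectral parameter cancels
          against - s \<mu> * \<mu>^3 y 0, since \<mu>^4 = -4. The other principal terms cancel in
          pairs.\<close>
        unfolding pert_eq using cr \<mu>(1) by algebra
      finally show "((\<lambda>t. E t * mode s \<mu> y t) has_vector_derivative E t * pert s \<mu> y t) (at t)"
        unfolding mode_eq .
    qed
  qed
  have I: "((\<lambda>t. E t * pert s \<mu> y t) has_integral E v * mode s \<mu> y v - E u * mode s \<mu> y u) {u..v}"
    by (rule fundamental_theorem_acon[OF ac uv(2) ae])
  have "cmod (integral {u..v} (\<lambda>t. E t * pert s \<mu> y t))
     \<le> integral {u..v} (\<lambda>t. al t * (exp (- (s * Re \<mu> * t)) * (grow s y t + decay s y t)))"
  proof (rule integral_norm_bound_integral)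
    show "(\<lambda>t. E t * pert s \<mu> y t) integrable_on {u..v}" using I by blast
    show "(\<lambda>t. al t * (exp (- (s * Re \<mu> * t)) * (grow s y t + decay s y t))) integrable_on {u..v}"
      by (intro al_mult_integrable continuous_intros grow_decay_continuous[OF y s] uv)
    fix t
    have "cmod (E t * pert s \<mu> y t) \<le> exp (- (s * Re \<mu> * t)) * (al t * (grow s y t + decay s y t))"
      unfolding norm_mult nE by (intro mult_left_mono pert_bound s \<mu>) auto
    then show "norm (E t * pert s \<mu> y t) \<le> al t * (exp (- (s * Re \<mu> * t)) * (grow s y t + decay s y t))"
      by (simp add: algebra_simps)
  qed
  then show ?thesis using integral_unique[OF I] by (simp add: E_def)
qed

lemma mode_variation_norm:
  assumes y: "ray_sol s y" and s: "s \<ge> 1" and \<mu>: "\<mu> ^ 4 = - 4" "cmod \<mu> \<le> 2" "cmod (\<mu>\<^sup>2) \<le> 2"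
    and uv: "0 \<le> u" "u \<le> v" "v \<le> 1"
  shows "\<bar>exp (- (s * Re \<mu> * v)) * cmod (mode s \<mu> y v) - exp (- (s * Re \<mu> * u)) * cmod (mode s \<mu> y u)\<bar>
    \<le> integral {u..v} (\<lambda>t. al t * (exp (- (s * Re \<mu> * t)) * (grow s y t + decay s y t)))"
proof -
  let ?a = "exp (- (s * \<mu> * v)) * mode s \<mu> y v" and ?b = "exp (- (s * \<mu> * u)) * mode s \<mu> y u"
  have "\<bar>cmod ?a - cmod ?b\<bar> \<le> cmod (?a - ?b)" by (rule norm_triangle_ineq3)
  also have "\<dots> \<le> integral {u..v} (\<lambda>t. al t * (exp (- (s * Re \<mu> * t)) * (grow s y t + decay s y t)))"
    by (rule mode_variation[OF assms])
  finally show ?thesis by (simp add: norm_mult)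
qed

text \<open>Stated with an absolute value because it serves in both directions: forwards from 0 in
  \<open>ray_growth\<close>, backwards from 1 in \<open>clamped_decay\<close>.\<close>

lemma grow_variation:
  assumes y: "ray_sol s y" and s: "s \<ge> 1" and uv: "0 \<le> u" "u \<le> v" "v \<le> 1"
  shows "\<bar>exp (- (s * v)) * grow s y v - exp (- (s * u)) * grow s y u\<bar>
    \<le> 2 * integral {u..v} (\<lambda>t. al t * (exp (- (s * t)) * (grow s y t + decay s y t)))"
  using mode_variation_norm[OF y s mode_exponents(1) mode_numbers(1,5) uv]
    mode_variation_norm[OF y s mode_exponents(2) mode_numbers(2,6) uv]
  unfolding grow_def[of s y v] grow_def[of s y u] distrib_left by simp

lemma decay_variation:
  assumes y: "ray_sol s y" and s: "s \<ge> 1" and uv: "0 \<le> u" "u \<le> v" "v \<le> 1"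
  shows "\<bar>exp (s * v) * decay s y v - exp (s * u) * decay s y u\<bar>
    \<le> 2 * integral {u..v} (\<lambda>t. al t * (exp (s * t) * (grow s y t + decay s y t)))"
  using mode_variation_norm[OF y s mode_exponents(3) mode_numbers(3,7) uv]
    mode_variation_norm[OF y s mode_exponents(4) mode_numbers(4,8) uv]
  unfolding decay_def[of s y v] decay_def[of s y u] distrib_left by simp

definition IA :: real where "IA = integral {0..1} al"

lemma IA_nonneg: "0 \<le> IA"
  unfolding IA_def using al_nonneg al_integrable
  by (intro Henstock_Kurzweil_Integration.integral_nonneg absolutely_integrable_imp_integrable) auto

lemma integral_al_mult_mono:
  assumes f: "continuous_on {0..1} f" and g: "continuous_on {0..1} g" and uv: "0 \<le> u" "v \<le> 1"
    and le: "\<And>t. t \<in> {u..v} \<Longrightarrow> f t \<le> g t"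
  shows "integral {u..v} (\<lambda>t. al t * f t) \<le> integral {u..v} (\<lambda>t. al t * g t)"
  by (intro integral_le al_mult_integrable f g uv mult_left_mono le al_nonneg)

lemma integral_al_mult_subset:
  assumes f: "continuous_on {0..1} f" and uv: "0 \<le> u'" "u' \<le> u" "v \<le> v'" "v' \<le> 1"
    and nn: "\<And>t. t \<in> {u'..v'} \<Longrightarrow> 0 \<le> f t"
  shows "integral {u..v} (\<lambda>t. al t * f t) \<le> integral {u'..v'} (\<lambda>t. al t * f t)"
  using uv nn al_nonneg by (intro integral_subset_le al_mult_integrable f) auto

lemma integral_al_le: "0 \<le> u \<Longrightarrow> v \<le> 1 \<Longrightarrow> integral {u..v} al \<le> IA"
  unfolding IA_def using integral_al_mult_subset[of "\<lambda>_. 1" 0 u v 1] by simp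

lemma grow_decay_nonneg: "0 \<le> grow s y x" "0 \<le> decay s y x"
  by (auto simp: grow_def decay_def)

lemma two_al: "(\<lambda>t. 2 * al t) absolutely_integrable_on {0..1}" "(\<lambda>t. 4 * al t) absolutely_integrable_on {0..1}"
  by (intro set_integrable_mult_right al_integrable)+

text \<open>All modes are compared with exp(s x). The natural weight exp(s t) of the decaying ones
  satisfies exp(s t) \<le> exp(2 s u - s t) for t \<le> u, so both variation formulas can be written
  with the weight of the growing ones and added. The factor exp(4 IA) does not depend on s.\<close>

lemma ray_growth:
  assumes y: "ray_sol s y" and s: "s \<ge> 1" and x: "x \<in> {0..1}"
  shows "grow s y x + decay s y x \<le> exp (4 * IA) * (grow s y 0 + decay s y 0) * exp (s * x)"
proof -
  note c = grow_decay_continuous[OF y s]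
  define N where "N t = grow s y t + decay s y t" for t
  have N: "continuous_on {0..1} N" unfolding N_def by (intro continuous_intros c)
  have N0: "0 \<le> N t" for t unfolding N_def using grow_decay_nonneg by (simp add: add_nonneg_nonneg)
  define \<phi> where "\<phi> t = exp (- (s * t)) * N t" for t
  have \<phi>c: "continuous_on {0..1} \<phi>" unfolding \<phi>_def by (intro continuous_intros N)
  have "\<phi> x \<le> N 0 * exp (integral {0..x} (\<lambda>t. 4 * al t))"
  proof (rule gronwall)
    show "continuous_on {0..x} \<phi>" using x by (intro continuous_on_subset[OF \<phi>c]) auto
    show "(\<lambda>t. 4 * al t) absolutely_integrable_on {0..x}"
      using x by (intro absolutely_integrable_subinterval[OF two_al(2)]) auto
    fix u assume u: "u \<in> {0..x}"
    then have u1: "0 \<le> (0::real)" "0 \<le> u" "u \<le> 1" using x by auto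
    have g: "exp (- (s * u)) * grow s y u \<le> grow s y 0 + 2 * integral {0..u} (\<lambda>t. al t * \<phi> t)"
      using grow_variation[OF y s u1] by (simp add: \<phi>_def N_def)
    have "exp (s * u) * decay s y u \<le> decay s y 0 + 2 * integral {0..u} (\<lambda>t. al t * (exp (s * t) * N t))"
      using decay_variation[OF y s u1] by (simp add: N_def)
    also have "integral {0..u} (\<lambda>t. al t * (exp (s * t) * N t)) \<le> integral {0..u} (\<lambda>t. al t * (exp (2 * s * u) * \<phi> t))"
    proof (rule integral_al_mult_mono)
      fix t assume t: "t \<in> {0..u}"
      have "exp (s * t) \<le> exp (2 * s * u - s * t)" using t s by (simp add: mult_left_mono)
      then have "exp (s * t) * N t \<le> exp (2 * s * u - s * t) * N t" using N0 by (intro mult_right_mono) auto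
      also have "\<dots> = exp (2 * s * u) * \<phi> t" by (simp add: \<phi>_def mult.assoc[symmetric] exp_add[symmetric])
      finally show "exp (s * t) * N t \<le> exp (2 * s * u) * \<phi> t" .
    qed (use u1 in \<open>auto intro!: continuous_intros N \<phi>c\<close>)
    also have "\<dots> = exp (2 * s * u) * integral {0..u} (\<lambda>t. al t * \<phi> t)"
      unfolding integral_mult_right[symmetric] by (simp add: mult.left_commute)
    finally have "exp (s * u) * decay s y u \<le> decay s y 0 + 2 * (exp (2 * s * u) * integral {0..u} (\<lambda>t. al t * \<phi> t))" by simp
    also have "\<dots> \<le> exp (2 * s * u) * (decay s y 0 + 2 * integral {0..u} (\<lambda>t. al t * \<phi> t))"
    proof -
      have "1 * decay s y 0 \<le> exp (2 * s * u) * decay s y 0"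
        using s u1 grow_decay_nonneg by (intro mult_right_mono) auto
      then show ?thesis by (simp add: algebra_simps)
    qed
    finally have "exp (- (2 * s * u)) * (exp (s * u) * decay s y u)
       \<le> exp (- (2 * s * u)) * (exp (2 * s * u) * (decay s y 0 + 2 * integral {0..u} (\<lambda>t. al t * \<phi> t)))"
      by (intro mult_left_mono) auto
    then have d: "exp (- (s * u)) * decay s y u \<le> decay s y 0 + 2 * integral {0..u} (\<lambda>t. al t * \<phi> t)"
      by (simp add: mult.assoc[symmetric] exp_add[symmetric])
    have "integral {0..u} (\<lambda>t. 4 * al t * \<phi> t) = 4 * integral {0..u} (\<lambda>t. al t * \<phi> t)"
      by (simp add: mult.assoc)
    then show "\<phi> u \<le> N 0 + integral {0..u} (\<lambda>t. 4 * al t * \<phi> t)"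
      using g d by (simp add: \<phi>_def N_def distrib_left)
  qed (use x al_nonneg in auto)
  also have "\<dots> \<le> N 0 * exp (4 * IA)"
    using integral_al_le[of 0 x] x N0 by (intro mult_left_mono) auto
  finally have "exp (s * x) * \<phi> x \<le> exp (s * x) * (N 0 * exp (4 * IA))" by (intro mult_left_mono) auto
  then show ?thesis by (simp add: \<phi>_def N_def mult.assoc[symmetric] exp_add[symmetric]) (simp add: mult.commute mult.left_commute)
qed

text \<open>Near x the kernel is at most 1 and the mass of \<open>al\<close> is small by uniform
  continuity of its primitive; farther away the kernel itself is small. The width h comes from that
  modulus of continuity, hence the absence of a rate.\<close>

lemma concentration:
  assumes d: "\<delta> > 0"
  shows "\<exists>s1\<ge>1. \<forall>s\<ge>s1. \<forall>x\<in>{0..1}. integral {0..1} (\<lambda>t. al t * exp (- (2 * s * \<bar>t - x\<bar>))) \<le> \<delta>"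
proof -
  have ali: "al integrable_on {0..1}" by (rule absolutely_integrable_imp_integrable[OF al_integrable])
  have "uniformly_continuous_on {0..1} (\<lambda>x. integral {0..x} al)"
    by (intro compact_uniformly_continuous indefinite_integral_continuous_1 ali) auto
  then obtain h0 where h0: "h0 > 0" "\<And>x y. x \<in> {0..1} \<Longrightarrow> y \<in> {0..1} \<Longrightarrow> dist y x < h0 \<Longrightarrow> dist (integral {0..y} al) (integral {0..x} al) < \<delta> / 2"
    using d half_gt_zero unfolding uniformly_continuous_on_def by metis
  define h where "h = h0 / 3"
  have h: "h > 0" "2 * h < h0" using h0 by (auto simp: h_def)
  \<comment> \<open>Since exp(-2 s h) \<le> 1 / (2 s h), the two far parts contribute at most IA /
    (s h), which is at most \<open>\<delta>\<close> / 2 for these s.\<close>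
  define s1 where "s1 = 1 + 2 * IA / (h * \<delta>)"
  show ?thesis
  proof (intro exI[of _ s1] conjI allI impI ballI)
    show "s1 \<ge> 1" using IA_nonneg h d by (simp add: s1_def)
    fix s x :: real assume s: "s \<ge> s1" and x: "x \<in> {0..1}"
    have s0: "s > 0" using s \<open>s1 \<ge> 1\<close> by linarith
    define e where "e = exp (- (2 * s * h))"
    define p q where "p = max 0 (x - h)" and "q = min 1 (x + h)"
    have pq: "0 \<le> p" "p \<le> q" "q \<le> 1" "p \<le> 1" "0 \<le> q" "dist q p < h0" using x h by (auto simp: p_def q_def dist_real_def)
    define f where "f t = exp (- (2 * s * \<bar>t - x\<bar>))" for t
    have fc: "continuous_on {0..1} f" unfolding f_def by (intro continuous_intros)
    have I: "(\<lambda>t. al t * f t) integrable_on {u..v}" if "0 \<le> u" "v \<le> 1" for u v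
      using that by (intro al_mult_integrable fc)
    have split: "integral {0..1} (\<lambda>t. al t * f t) = integral {0..p} (\<lambda>t. al t * f t) + integral {p..q} (\<lambda>t. al t * f t) + integral {q..1} (\<lambda>t. al t * f t)"
      using Henstock_Kurzweil_Integration.integral_combine[of 0 p q "\<lambda>t. al t * f t"] Henstock_Kurzweil_Integration.integral_combine[of 0 q 1 "\<lambda>t. al t * f t"] pq I by simp
    have far: "integral {u..v} (\<lambda>t. al t * f t) \<le> e * IA" if uv: "0 \<le> u" "v \<le> 1" and far: "\<And>t. t \<in> {u..v} \<Longrightarrow> t \<le> x - h \<or> x + h \<le> t \<or> u = v" for u v
    proof (cases "u = v")
      case True
      then show ?thesis using IA_nonneg by (simp add: e_def)
    next
      case False
      have "integral {u..v} (\<lambda>t. al t * f t) \<le> integral {u..v} (\<lambda>t. al t * e)"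
      proof (rule integral_al_mult_mono[OF fc _ uv])
        fix t assume "t \<in> {u..v}"
        then have "h \<le> \<bar>t - x\<bar>" using far[of t] False by auto
        then show "f t \<le> e" using s0 by (simp add: f_def e_def)
      qed auto
      also have "\<dots> = e * integral {u..v} al" by (simp add: mult.commute)
      also have "\<dots> \<le> e * IA" using integral_al_le[OF uv] by (simp add: e_def)
      finally show ?thesis .
    qed
    have 1: "integral {0..p} (\<lambda>t. al t * f t) \<le> e * IA" by (rule far) (use pq in \<open>auto simp: p_def max_def split: if_splits\<close>)
    have 3: "integral {q..1} (\<lambda>t. al t * f t) \<le> e * IA" by (rule far) (use pq in \<open>auto simp: q_def min_def split: if_splits\<close>)
    have "integral {p..q} (\<lambda>t. al t * f t) \<le> integral {p..q} (\<lambda>t. al t * 1)"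
      using s0 pq by (intro integral_al_mult_mono fc) (auto simp: f_def)
    also have "\<dots> = integral {0..q} al - integral {0..p} al"
      using Henstock_Kurzweil_Integration.integral_combine[of 0 p q al] pq integrable_on_subinterval[OF ali, of 0 q] by auto
    also have "\<dots> \<le> \<delta> / 2"
    proof -
      have "dist (integral {0..q} al) (integral {0..p} al) < \<delta> / 2" by (rule h0(2)) (use pq in auto)
      then show ?thesis unfolding dist_real_def by linarith
    qed
    finally have 2: "integral {p..q} (\<lambda>t. al t * f t) \<le> \<delta> / 2" .
    have "2 * (e * IA) \<le> \<delta> / 2"
    proof -
      have sh: "2 * s * h > 0" using s0 h by simp
      have "2 * s * h \<le> exp (2 * s * h)" using exp_ge_add_one_self[of "2 * s * h"] by linarith
      then have "e \<le> 1 / (2 * s * h)" unfolding e_def exp_minus inverse_eq_divide using sh by (intro divide_left_mono) auto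
      then have "2 * (e * IA) \<le> 2 * (1 / (2 * s * h) * IA)" using IA_nonneg by (intro mult_left_mono mult_right_mono) auto
      also have "\<dots> = IA / (s * h)" using s0 h by simp
      also have "\<dots> \<le> \<delta> / 2"
      proof -
        have "2 * IA / (h * \<delta>) \<le> s" using s by (simp add: s1_def)
        then have "2 * IA \<le> s * (h * \<delta>)" using h d by (simp add: pos_divide_le_eq)
        then show ?thesis using s0 h by (simp add: divide_simps mult.commute mult.left_commute)
      qed
      finally show ?thesis .
    qed
    then show "integral {0..1} (\<lambda>t. al t * exp (- (2 * s * \<bar>t - x\<bar>))) \<le> \<delta>"
      using split 1 2 3 unfolding f_def by linarith
  qed
qed

text \<open>With y 0 and y 1 zero at the end point every mode has the form \<mu> a + b, so two of
  the four values determine the others; the coefficients that occur here have modulus at most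
  2.\<close>

lemma clamped_grow_le_decay:
  assumes "y 0 1 = 0" "y 1 1 = 0" and s: "s \<ge> 1" shows "grow s y 1 \<le> 4 * decay s y 1"
proof -
  define a where "a = y 2 1 / complex_of_real (s ^ 2)"
  define b where "b = y 3 1 / complex_of_real (s ^ 3)"
  have m: "mode s \<mu> y 1 = \<mu> * a + b" for \<mu> using assms by (simp add: mode_def a_def b_def)
  have i2: "\<i> * \<i> = - 1" by simp
  let ?p = "mode s (- 1 + \<i>) y 1" and ?q = "mode s (- 1 - \<i>) y 1"
  have p: "mode s (1 + \<i>) y 1 = (1 - \<i>) * ?p + \<i> * ?q"
    unfolding m using i2 by algebra
  have q: "mode s (1 - \<i>) y 1 = (- \<i>) * ?p + (1 + \<i>) * ?q"
    unfolding m using i2 by algebra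
  have "cmod (mode s (1 + \<i>) y 1) \<le> 2 * cmod ?p + 1 * cmod ?q" "cmod (mode s (1 - \<i>) y 1) \<le> 1 * cmod ?p + 2 * cmod ?q"
    unfolding p q by (intro order_trans[OF norm_triangle_ineq] add_mono, unfold norm_mult, (intro mult_right_mono; use mode_numbers in simp)+)+
  then show ?thesis using norm_ge_zero[of ?p] norm_ge_zero[of ?q] unfolding grow_def decay_def distrib_left by linarith
qed

text \<open>A solution clamped at the right end decays from the left end: the growing modes are slaved to
  the decaying ones, and the coupling between the two families is weighted by the kernels of the
  lemma concentration, hence small.\<close>

lemma clamped_decay:
  assumes y: "ray_sol s y" and s: "s \<ge> 1" and cl: "y 0 1 = 0" "y 1 1 = 0"
    and e: "0 < e" "e \<le> 1" and K: "K = exp (2 * IA)" and e2: "2 * K\<^sup>2 * (4 + 2 * IA) * e \<le> 1/2"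
    and conc: "\<And>x. x \<in> {0..1} \<Longrightarrow> integral {0..1} (\<lambda>t. al t * exp (- (2 * s * \<bar>t - x\<bar>))) \<le> e"
    and s2: "4 * exp (- (2 * s)) \<le> e"
  shows "grow s y 0 \<le> 6 * K\<^sup>2 * e * decay s y 0"
    "x \<in> {0..1} \<Longrightarrow> grow s y x + decay s y x \<le> 2 * K * (6 * K + 1) * decay s y 0 * exp (- (s * x))"
proof -
  note c = grow_decay_continuous[OF y s]
  note nn = grow_decay_nonneg[of s y]
  have K1: "K \<ge> 1" using IA_nonneg by (simp add: K)
  define V where "V t = exp (s * t) * decay s y t" for t
  define X where "X t = exp (- (s * t)) * grow s y t" for t
  define U where "U t = exp (s * t) * grow s y t" for t
  have cV: "continuous_on {0..1} V" and cX: "continuous_on {0..1} X" and cU: "continuous_on {0..1} U"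
    unfolding V_def X_def U_def by (intro continuous_intros c)+
  have nnV: "0 \<le> V t" "0 \<le> X t" "0 \<le> U t" for t using nn by (auto simp: V_def X_def U_def)
  have UX: "U t = exp (2 * s * t) * X t" for t by (simp add: U_def X_def mult.assoc[symmetric] exp_add[symmetric])
  \<comment> \<open>The maximum B of the weighted decaying part is first treated as an unknown. The
    growing part is bounded by a multiple of B, and B by its initial data plus half of
    itself.\<close>
  obtain xm where xm: "xm \<in> {0..1}" "\<And>t. t \<in> {0..1} \<Longrightarrow> V t \<le> V xm"
    using continuous_attains_sup[OF compact_Icc _ cV] by auto
  define B where "B = V xm"
  have B: "V t \<le> B" if "t \<in> {0..1}" for t using xm(2)[OF that] by (simp add: B_def)
  have B0: "B \<ge> 0" using nnV by (simp add: B_def)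
  \<comment> \<open>Integrating backwards from 1, the clamping conditions give the first
    exponential, and the coupling to the decaying modes, bounded by B, gives the kernel of
    \<open>concentration\<close> at x.\<close>
  have Ux: "U x \<le> K * B * (4 * exp (- (2 * s * \<bar>1 - x\<bar>)) + 2 * e)" if x: "x \<in> {0..1}" for x
  proof -
    define k where "k t = exp (- (2 * s * t)) * B" for t
    have ck: "continuous_on {0..1} k" unfolding k_def by (intro continuous_intros)
    define G where "G = 2 * integral {x..1} (\<lambda>t. al t * k t)"
    have "X x \<le> (X 1 + G) * exp (integral {x..1} (\<lambda>t. 2 * al t))"
    proof (rule gronwall_backward)
      show "continuous_on {x..1} X" using x by (intro continuous_on_subset[OF cX]) auto
      show "(\<lambda>t. 2 * al t) absolutely_integrable_on {x..1}"
        using x by (intro absolutely_integrable_subinterval[OF two_al(1)]) auto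
      fix u assume u: "u \<in> {x..1}"
      then have u1: "0 \<le> u" "u \<le> 1" "(1::real) \<le> 1" using x by auto
      have "X u \<le> X 1 + 2 * integral {u..1} (\<lambda>t. al t * (exp (- (s * t)) * (grow s y t + decay s y t)))"
        using grow_variation[OF y s u1] by (simp add: X_def)
      also have "integral {u..1} (\<lambda>t. al t * (exp (- (s * t)) * (grow s y t + decay s y t)))
         \<le> integral {u..1} (\<lambda>t. al t * (X t + k t))"
      proof (rule integral_al_mult_mono)
        fix t assume t: "t \<in> {u..1}"
        have "exp (- (s * t)) * decay s y t = exp (- (2 * s * t)) * V t"
          by (simp add: V_def mult.assoc[symmetric] exp_add[symmetric])
        also have "\<dots> \<le> k t" unfolding k_def using B[of t] t u1 by (intro mult_left_mono) auto
        finally show "exp (- (s * t)) * (grow s y t + decay s y t) \<le> X t + k t" by (simp add: X_def distrib_left)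
      qed (use u1 in \<open>auto intro!: continuous_intros c cX ck\<close>)
      also have "\<dots> = integral {u..1} (\<lambda>t. al t * X t) + integral {u..1} (\<lambda>t. al t * k t)"
        unfolding distrib_left using u1 by (intro integral_add al_mult_integrable cX ck) auto
      also have "integral {u..1} (\<lambda>t. al t * k t) \<le> integral {x..1} (\<lambda>t. al t * k t)"
        using u x B0 by (intro integral_al_mult_subset ck) (auto simp: k_def)
      finally have "X u \<le> X 1 + 2 * (integral {u..1} (\<lambda>t. al t * X t) + integral {x..1} (\<lambda>t. al t * k t))" by simp
      moreover have "integral {u..1} (\<lambda>t. 2 * al t * X t) = 2 * integral {u..1} (\<lambda>t. al t * X t)" by (simp add: mult.assoc)
      ultimately show "X u \<le> X 1 + G + integral {u..1} (\<lambda>t. 2 * al t * X t)" by (simp add: G_def)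
    qed (use x al_nonneg in auto)
    also have "\<dots> \<le> (X 1 + G) * K"
    proof (rule mult_left_mono)
      show "exp (integral {x..1} (\<lambda>t. 2 * al t)) \<le> K" unfolding K using integral_al_le[of x 1] x by simp
      have "0 \<le> integral {x..1} (\<lambda>t. al t * k t)"
        using x B0 al_nonneg by (intro Henstock_Kurzweil_Integration.integral_nonneg al_mult_integrable ck) (auto simp: k_def)
      then show "0 \<le> X 1 + G" using nnV by (simp add: G_def)
    qed
    finally have "U x \<le> exp (2 * s * x) * ((X 1 + G) * K)" unfolding UX by (intro mult_left_mono) auto
    also have "\<dots> = K * (exp (2 * s * x) * X 1 + exp (2 * s * x) * G)" by (simp add: algebra_simps)
    also have "\<dots> \<le> K * (4 * exp (- (2 * s * \<bar>1 - x\<bar>)) * B + 2 * e * B)"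
    proof (intro mult_left_mono add_mono)
      have "exp (2 * s * x) = exp (- (2 * s * \<bar>1 - x\<bar>)) * exp (2 * s * 1)"
        using x by (simp add: exp_add[symmetric] algebra_simps)
      then have "exp (2 * s * x) * X 1 = exp (- (2 * s * \<bar>1 - x\<bar>)) * U 1"
        unfolding UX by simp
      also have "\<dots> \<le> exp (- (2 * s * \<bar>1 - x\<bar>)) * (4 * B)"
      proof (rule mult_left_mono)
        have "U 1 \<le> 4 * V 1" unfolding U_def V_def using clamped_grow_le_decay[of y s, OF cl s] by simp
        then show "U 1 \<le> 4 * B" using B[of 1] by simp
      qed simp
      finally show "exp (2 * s * x) * X 1 \<le> 4 * exp (- (2 * s * \<bar>1 - x\<bar>)) * B" by simp
      have "exp (2 * s * x) * G = 2 * integral {x..1} (\<lambda>t. al t * (exp (- (2 * s * \<bar>t - x\<bar>)) * B))"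
      proof -
        have "exp (2 * s * x) * integral {x..1} (\<lambda>t. al t * k t) = integral {x..1} (\<lambda>t. exp (2 * s * x) * (al t * k t))" by simp
        also have "\<dots> = integral {x..1} (\<lambda>t. al t * (exp (- (2 * s * \<bar>t - x\<bar>)) * B))"
        proof (rule integral_cong)
          fix t assume "t \<in> {x..1}"
          then have "exp (2 * s * x) * exp (- (2 * s * t)) = exp (- (2 * s * \<bar>t - x\<bar>))"
            by (simp add: exp_add[symmetric] algebra_simps)
          then show "exp (2 * s * x) * (al t * k t) = al t * (exp (- (2 * s * \<bar>t - x\<bar>)) * B)"
            by (simp add: k_def mult.left_commute flip: mult.assoc)
        qed
        finally show ?thesis by (simp add: G_def)
      qed
      also have "\<dots> \<le> 2 * integral {0..1} (\<lambda>t. al t * (exp (- (2 * s * \<bar>t - x\<bar>)) * B))"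
        using x B0 by (intro mult_left_mono integral_al_mult_subset continuous_intros) auto
      also have "\<dots> = 2 * (integral {0..1} (\<lambda>t. al t * exp (- (2 * s * \<bar>t - x\<bar>))) * B)"
        unfolding integral_mult_left[symmetric] by (simp add: mult.assoc)
      also have "\<dots> \<le> 2 * (e * B)" using conc[OF x] B0 by (intro mult_left_mono mult_right_mono) auto
      finally show "exp (2 * s * x) * G \<le> 2 * e * B" by simp
    qed (use K1 in auto)
    finally show ?thesis by (simp add: algebra_simps)
  qed
  \<comment> \<open>Although U is not small near 1, its integral against \<open>al\<close> is: the
    boundary term is again a concentrated kernel, now at the point 1.\<close>
  have iU: "integral {0..1} (\<lambda>t. al t * U t) \<le> K * B * ((4 + 2 * IA) * e)"
  proof -
    have "integral {0..1} (\<lambda>t. al t * U t) \<le> integral {0..1} (\<lambda>t. al t * (K * B * (4 * exp (- (2 * s * \<bar>t - 1\<bar>)) + 2 * e)))"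
      using Ux by (intro integral_al_mult_mono cU continuous_intros) (auto simp: abs_minus_commute)
    also have "\<dots> = integral {0..1} (\<lambda>t. K * B * (4 * (al t * exp (- (2 * s * \<bar>t - 1\<bar>))) + 2 * e * (al t * 1)))"
      by (simp add: algebra_simps)
    also have "\<dots> = K * B * (4 * integral {0..1} (\<lambda>t. al t * exp (- (2 * s * \<bar>t - 1\<bar>))) + 2 * e * integral {0..1} (\<lambda>t. al t * 1))"
    proof -
      have "integral {0..1} (\<lambda>t. 4 * (al t * exp (- (2 * s * \<bar>t - 1\<bar>))) + 2 * e * (al t * 1))
        = integral {0..1} (\<lambda>t. 4 * (al t * exp (- (2 * s * \<bar>t - 1\<bar>)))) + integral {0..1} (\<lambda>t. 2 * e * (al t * 1))"
        by (intro integral_add integrable_on_mult_right al_mult_integrable continuous_intros) auto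
      then show ?thesis unfolding integral_mult_right by simp
    qed
    also have "\<dots> \<le> K * B * (4 * e + 2 * e * IA)"
      using conc[of 1] K1 B0 e by (intro mult_left_mono add_mono) (auto simp: IA_def)
    finally show ?thesis by (simp add: algebra_simps)
  qed
  \<comment> \<open>Forwards from 0, the decaying modes are driven by their own initial value and by
    the integral \<open>iU\<close>. By \<open>e2\<close> the resulting multiple of B is at most B /
    2 and can be absorbed.\<close>
  have "V xm \<le> (decay s y 0 + 2 * (K * B * ((4 + 2 * IA) * e))) * exp (integral {0..xm} (\<lambda>t. 2 * al t))"
  proof (rule gronwall)
    show "continuous_on {0..xm} V" using xm by (intro continuous_on_subset[OF cV]) auto
    show "(\<lambda>t. 2 * al t) absolutely_integrable_on {0..xm}"
      using xm by (intro absolutely_integrable_subinterval[OF two_al(1)]) auto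
    fix u assume u: "u \<in> {0..xm}"
    then have u1: "0 \<le> (0::real)" "0 \<le> u" "u \<le> 1" using xm by auto
    have "V u \<le> decay s y 0 + 2 * integral {0..u} (\<lambda>t. al t * (exp (s * t) * (grow s y t + decay s y t)))"
      using decay_variation[OF y s u1] by (simp add: V_def)
    also have "integral {0..u} (\<lambda>t. al t * (exp (s * t) * (grow s y t + decay s y t))) = integral {0..u} (\<lambda>t. al t * U t + al t * V t)"
      by (simp add: U_def V_def algebra_simps)
    also have "\<dots> = integral {0..u} (\<lambda>t. al t * U t) + integral {0..u} (\<lambda>t. al t * V t)"
      using u1 by (intro integral_add al_mult_integrable cU cV) auto
    also have "integral {0..u} (\<lambda>t. al t * U t) \<le> integral {0..1} (\<lambda>t. al t * U t)"
      using u1 nnV by (intro integral_al_mult_subset cU) auto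
    also note iU
    finally have "V u \<le> decay s y 0 + 2 * (K * B * ((4 + 2 * IA) * e) + integral {0..u} (\<lambda>t. al t * V t))" by simp
    moreover have "integral {0..u} (\<lambda>t. 2 * al t * V t) = 2 * integral {0..u} (\<lambda>t. al t * V t)" by (simp add: mult.assoc)
    ultimately show "V u \<le> decay s y 0 + 2 * (K * B * ((4 + 2 * IA) * e)) + integral {0..u} (\<lambda>t. 2 * al t * V t)" by simp
  qed (use xm al_nonneg in auto)
  also have "\<dots> \<le> (decay s y 0 + 2 * (K * B * ((4 + 2 * IA) * e))) * K"
  proof (rule mult_left_mono)
    show "exp (integral {0..xm} (\<lambda>t. 2 * al t)) \<le> K" unfolding K using integral_al_le[of 0 xm] xm by simp
    show "0 \<le> decay s y 0 + 2 * (K * B * ((4 + 2 * IA) * e))" using nn K1 B0 IA_nonneg e by simp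
  qed
  also have "\<dots> = K * decay s y 0 + (2 * K\<^sup>2 * (4 + 2 * IA) * e) * B" by (simp add: algebra_simps power2_eq_square)
  also have "\<dots> \<le> K * decay s y 0 + 1/2 * B" using e2 B0 by (intro add_left_mono mult_right_mono)
  finally have BB: "B \<le> 2 * K * decay s y 0" unfolding B_def[symmetric] by simp
  have "grow s y 0 = U 0" by (simp add: U_def)
  also have "\<dots> \<le> K * B * (4 * exp (- (2 * s)) + 2 * e)" using Ux[of 0] by simp
  also have "\<dots> \<le> K * B * (3 * e)" using s2 K1 B0 by (intro mult_left_mono) auto
  also have "\<dots> \<le> K * (2 * K * decay s y 0) * (3 * e)" using BB K1 e by (intro mult_right_mono mult_left_mono) auto
  finally show "grow s y 0 \<le> 6 * K\<^sup>2 * e * decay s y 0" by (simp add: power2_eq_square algebra_simps)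
  show "grow s y x + decay s y x \<le> 2 * K * (6 * K + 1) * decay s y 0 * exp (- (s * x))" if x: "x \<in> {0..1}"
  proof -
    have "4 * exp (- (2 * s * \<bar>1 - x\<bar>)) + 2 * e \<le> 6" using e s by (simp add: add_mono[of _ 4 _ 2, simplified])
    then have "U x \<le> K * B * 6" using Ux[OF x] K1 B0 mult_left_mono[of _ 6 "K * B"] by (smt (verit) mult_nonneg_nonneg)
    then have "U x + V x \<le> (6 * K + 1) * B" using B[OF x] by (simp add: algebra_simps)
    also have "\<dots> \<le> (6 * K + 1) * (2 * K * decay s y 0)" using BB K1 by (intro mult_left_mono) auto
    finally have "exp (- (s * x)) * (U x + V x) \<le> exp (- (s * x)) * ((6 * K + 1) * (2 * K * decay s y 0))" by (intro mult_left_mono) auto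
    moreover have "exp (- (s * x)) * (U x + V x) = grow s y x + decay s y x"
      by (simp add: U_def V_def distrib_left mult.assoc[symmetric] exp_add[symmetric])
    moreover have "exp (- (s * x)) * ((6 * K + 1) * (2 * K * decay s y 0)) = 2 * K * (6 * K + 1) * decay s y 0 * exp (- (s * x))"
      by (simp only: ac_simps)
    ultimately show ?thesis by simp
  qed
qed

end

section \<open>Clamped solutions and the Weyl matrix\<close>

text \<open>If both growing modes vanished at 0, then w 0 = (w 2 + w 3) / 2 and w 1 = - w 2 - w 3 /
  2. The lemma is the perturbed form of this elimination, and these two equations are the origin of
  the limits in \<open>weyl_asymptotic\<close>.\<close>

lemma initial_mode_bounds:
  assumes le: "grow s y 0 \<le> \<eta> * decay s y 0" and \<eta>: "0 < \<eta>" "\<eta> \<le> 1/12"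
  defines "w \<equiv> \<lambda>i. y i 0 / of_real s ^ i"
  defines "R \<equiv> cmod (w 2) + cmod (w 3)"
  shows "grow s y 0 \<le> 48 * \<eta> * R" "decay s y 0 \<le> 48 * R"
    "cmod (w 0 - (w 2 + w 3) / 2) \<le> 12 * \<eta> * R" "cmod (w 1 + w 2 + w 3 / 2) \<le> 24 * \<eta> * R"
proof -
  have mode: "mode s \<mu> y 0 = \<mu>^3 * w 0 + \<mu>\<^sup>2 * w 1 + \<mu> * w 2 + w 3" for \<mu>
    by (simp add: mode_def w_def)
  define G where "G = grow s y 0"
  have G0: "0 \<le> G" "0 \<le> R" by (auto simp: G_def grow_def R_def)
  have i2: "\<i> * \<i> = - 1" by simp
  let ?p = "mode s (1 + \<i>) y 0" and ?q = "mode s (1 - \<i>) y 0"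
  have "- 4 * w 0 + 2 * w 2 + 2 * w 3 = ?p + ?q" unfolding mode using i2 by algebra
  moreover have "- 4 * (w 0 - (w 2 + w 3) / 2) = - 4 * w 0 + 2 * w 2 + 2 * w 3" by (simp add: algebra_simps add_divide_distrib)
  ultimately have "- 4 * (w 0 - (w 2 + w 3) / 2) = ?p + ?q" by simp
  then have "cmod (- 4 * (w 0 - (w 2 + w 3) / 2)) \<le> G" using norm_triangle_ineq[of ?p ?q] by (simp add: G_def grow_def)
  then have a: "cmod (w 0 - (w 2 + w 3) / 2) \<le> G / 4" unfolding norm_mult by simp
  have "4 * \<i> * (w 1 + w 2) + 2 * \<i> * w 3 = (?p - ?q) + \<i> * (?p + ?q)" unfolding mode using i2 by algebra
  moreover have "4 * \<i> * (w 1 + w 2 + w 3 / 2) = 4 * \<i> * (w 1 + w 2) + 2 * \<i> * w 3" by (simp add: algebra_simps)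
  ultimately have "4 * \<i> * (w 1 + w 2 + w 3 / 2) = (?p - ?q) + \<i> * (?p + ?q)" by simp
  then have "cmod (4 * \<i> * (w 1 + w 2 + w 3 / 2)) \<le> cmod (?p - ?q) + cmod (\<i> * (?p + ?q))" using norm_triangle_ineq by metis
  also have "\<dots> \<le> G + G" using norm_triangle_ineq[of ?p ?q] norm_triangle_ineq4[of ?p ?q] by (simp add: G_def grow_def norm_mult)
  finally have b: "cmod (w 1 + w 2 + w 3 / 2) \<le> G / 2" unfolding norm_mult by simp
  have w0: "cmod (w 0) \<le> G / 4 + R"
  proof -
    have "cmod (w 0) \<le> cmod (w 0 - (w 2 + w 3) / 2) + cmod ((w 2 + w 3) / 2)" using norm_triangle_ineq[of "w 0 - (w 2 + w 3) / 2" "(w 2 + w 3) / 2"] by simp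
    also have "cmod ((w 2 + w 3) / 2) \<le> R"
    proof -
      have "cmod ((w 2 + w 3) / 2) = cmod (w 2 + w 3) / 2" by (simp add: norm_divide)
      also have "\<dots> \<le> R" using norm_triangle_ineq[of "w 2" "w 3"] norm_ge_zero[of "w 2"] norm_ge_zero[of "w 3"] unfolding R_def by linarith
      finally show ?thesis .
    qed
    finally show ?thesis using a by simp
  qed
  have w1: "cmod (w 1) \<le> G / 2 + R"
  proof -
    have "cmod (w 1) \<le> cmod (w 1 + w 2 + w 3 / 2) + cmod (w 2 + w 3 / 2)" using norm_triangle_ineq4[of "w 1 + w 2 + w 3 / 2" "w 2 + w 3 / 2"] by simp
    also have "cmod (w 2 + w 3 / 2) \<le> R"
    proof -
      have "cmod (w 3 / 2) = cmod (w 3) / 2" by (simp add: norm_divide)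
      then show ?thesis using norm_triangle_ineq[of "w 2" "w 3 / 2"] norm_ge_zero[of "w 3"] unfolding R_def by linarith
    qed
    finally show ?thesis using b by simp
  qed
  have md: "cmod (mode s \<mu> y 0) \<le> 4 * cmod (w 0) + 2 * cmod (w 1) + 2 * R" if "cmod \<mu> \<le> 2" "cmod (\<mu>\<^sup>2) \<le> 2" for \<mu>
  proof -
    have "cmod (\<mu>^3) = cmod \<mu> * cmod (\<mu>\<^sup>2)" by (simp add: norm_mult[symmetric] power3_eq_cube power2_eq_square mult.assoc)
    also have "\<dots> \<le> 2 * 2" using that by (intro mult_mono) auto
    finally have m3: "cmod (\<mu>^3) \<le> 4" by simp
    have "cmod (mode s \<mu> y 0) \<le> cmod (\<mu>^3 * w 0) + cmod (\<mu>\<^sup>2 * w 1) + cmod (\<mu> * w 2) + cmod (w 3)"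
      unfolding mode using norm_triangle_ineq[of "\<mu>^3 * w 0 + \<mu>\<^sup>2 * w 1 + \<mu> * w 2" "w 3"]
        norm_triangle_ineq[of "\<mu>^3 * w 0 + \<mu>\<^sup>2 * w 1" "\<mu> * w 2"] norm_triangle_ineq[of "\<mu>^3 * w 0" "\<mu>\<^sup>2 * w 1"] by linarith
    also have "\<dots> \<le> 4 * cmod (w 0) + 2 * cmod (w 1) + 2 * cmod (w 2) + 2 * cmod (w 3)"
      unfolding norm_mult using m3 that by (intro add_mono mult_right_mono) auto
    finally show ?thesis by (simp add: R_def)
  qed
  have "decay s y 0 \<le> 8 * cmod (w 0) + 4 * cmod (w 1) + 4 * R"
    unfolding decay_def using md[of "- 1 + \<i>"] md[of "- 1 - \<i>"] mode_numbers by simp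
  then have D: "decay s y 0 \<le> 4 * G + 16 * R" using w0 w1 by linarith
  \<comment> \<open>The bound for the decaying modes contains G again; \<open>\<eta>\<close> \<le>
    1/12 allows it to be absorbed on the left.\<close>
  have "G \<le> \<eta> * (4 * G + 16 * R)" using le D \<eta> unfolding G_def[symmetric] by (meson mult_left_mono less_imp_le order_trans)
  also have "\<dots> = 4 * (\<eta> * G) + 16 * (\<eta> * R)" by (simp add: algebra_simps)
  also have "\<eta> * G \<le> 1/12 * G" using \<eta> G0 by (intro mult_right_mono) auto
  finally have GR: "G \<le> 48 * \<eta> * R"
    using mult_nonneg_nonneg[of \<eta> R] \<eta> G0 by simp
  then show "grow s y 0 \<le> 48 * \<eta> * R" by (simp add: G_def)
  show "cmod (w 0 - (w 2 + w 3) / 2) \<le> 12 * \<eta> * R" "cmod (w 1 + w 2 + w 3 / 2) \<le> 24 * \<eta> * R" using a b GR by linarith+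
  have "\<eta> * R \<le> 1/12 * R" using \<eta> G0 by (intro mult_right_mono) auto
  then show "decay s y 0 \<le> 48 * R" using D GR G0 by simp
qed

lemma initial_modes_le:
  "grow s y 0 + decay s y 0 \<le> 16 * (\<Sum>i<4. cmod (y i 0 / of_real s ^ i))"
proof -
  define w where "w i = y i 0 / complex_of_real s ^ i" for i
  have "cmod (mode s \<mu> y 0) \<le> 4 * (\<Sum>i<4. cmod (w i))" if "cmod \<mu> \<le> 2" "cmod (\<mu>\<^sup>2) \<le> 2" for \<mu>
  proof -
    have "cmod (\<mu>^3) = cmod \<mu> * cmod (\<mu>\<^sup>2)" by (simp add: norm_mult[symmetric] power3_eq_cube power2_eq_square mult.assoc)
    also have "\<dots> \<le> 2 * 2" using that by (intro mult_mono) auto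
    finally have m3: "cmod (\<mu>^3) \<le> 4" by simp
    have mode: "mode s \<mu> y 0 = \<mu>^3 * w 0 + \<mu>\<^sup>2 * w 1 + \<mu> * w 2 + w 3" by (simp add: mode_def w_def)
    have "cmod (mode s \<mu> y 0) \<le> cmod (\<mu>^3 * w 0) + cmod (\<mu>\<^sup>2 * w 1) + cmod (\<mu> * w 2) + cmod (w 3)"
      unfolding mode using norm_triangle_ineq[of "\<mu>^3 * w 0 + \<mu>\<^sup>2 * w 1 + \<mu> * w 2" "w 3"]
        norm_triangle_ineq[of "\<mu>^3 * w 0 + \<mu>\<^sup>2 * w 1" "\<mu> * w 2"] norm_triangle_ineq[of "\<mu>^3 * w 0" "\<mu>\<^sup>2 * w 1"] by linarith
    also have "\<dots> \<le> 4 * cmod (w 0) + 4 * cmod (w 1) + 4 * cmod (w 2) + 4 * cmod (w 3)"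
      unfolding norm_mult using m3 that by (intro add_mono mult_right_mono) auto
    finally show ?thesis by (simp add: sum_lessThan_4)
  qed
  note md = this
  note nb = mode_numbers
  show ?thesis unfolding grow_def decay_def w_def[symmetric]
    using md[OF nb(1,5)] md[OF nb(2,6)] md[OF nb(3,7)] md[OF nb(4,8)] by linarith
qed


text \<open>The bilinear form of Lagrange's identity, y^T J z with the antidiagonal J of entries 1,
  -1, 1, -1. It is constant on pairs of solutions because the coefficient matrix A satisfies A^T J +
  J A = 0, for every value of the spectral parameter.\<close>

definition bracket :: "(nat \<Rightarrow> real \<Rightarrow> complex) \<Rightarrow> (nat \<Rightarrow> real \<Rightarrow> complex) \<Rightarrow> real \<Rightarrow> complex" where
  "bracket y z x = y 0 x * z 3 x - y 1 x * z 2 x + y 2 x * z 1 x - y 3 x * z 0 x"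

text \<open>The rows are \<open>V_4, V_3\<close> and the columns \<open>C_k\<close> with \<open>k = 4 - i, 4 - j\<close> in the notation of the paper.\<close>
definition minor :: "(real \<Rightarrow> complex) \<Rightarrow> (real \<Rightarrow> complex) \<Rightarrow> nat \<Rightarrow> nat \<Rightarrow> complex \<Rightarrow> complex" where
  "minor t1 t2 i j l = esol t1 t2 l i 0 1 * esol t1 t2 l j 1 1 - esol t1 t2 l i 1 1 * esol t1 t2 l j 0 1"

text \<open>The solutions clamped at the right end, normalised by their quasi-derivatives of order 2 and 3
  at the left end (k = 2, 3); the coefficients are the entries of a 2 x 2 Weyl matrix.\<close>
definition weyl :: "(real \<Rightarrow> complex) \<Rightarrow> (real \<Rightarrow> complex) \<Rightarrow> complex \<Rightarrow> nat \<Rightarrow> nat \<Rightarrow> real \<Rightarrow> complex" where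
  "weyl t1 t2 l k i x = esol t1 t2 l k i x + minor t1 t2 1 k l / minor t1 t2 0 1 l * esol t1 t2 l 0 i x
     - minor t1 t2 0 k l / minor t1 t2 0 1 l * esol t1 t2 l 1 i x"

text \<open>The limits 1, 1/2 and 1/2 are the values for vanishing growing modes at 0, with the
  quasi-derivative of order 2 or 3 normalised to 1. In the last line s^i / s^k is the natural scale
  of component i of a solution normalised at component k; the constant C there is separate from
  \<open>\<eta>\<close>, which has to become arbitrarily small.\<close>

definition weyl_asymptotic :: "(real \<Rightarrow> complex) \<Rightarrow> (real \<Rightarrow> complex) \<Rightarrow> real \<Rightarrow> real \<Rightarrow> real \<Rightarrow> bool" where
  "weyl_asymptotic t1 t2 C \<eta> s \<longleftrightarrow> (let l = - 4 * of_real (s ^ 4) in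
     minor t1 t2 0 1 l \<noteq> 0 \<and>
     cmod (of_real s * (minor t1 t2 0 2 l / minor t1 t2 0 1 l) - 1) \<le> \<eta> \<and>
     cmod (of_real s ^ 2 * (minor t1 t2 0 3 l / minor t1 t2 0 1 l) - 1/2) \<le> \<eta> \<and>
     cmod (of_real s ^ 3 * (minor t1 t2 1 3 l / minor t1 t2 0 1 l) - 1/2) \<le> \<eta> \<and>
     (\<forall>k\<in>{2,3}. \<forall>i<4. \<forall>x\<in>{0..1}. cmod (weyl t1 t2 l k i x) \<le> C * (s ^ i / s ^ k) * exp (- (s * x))))"

context fourth_order
begin

lemma bracket_constant:
  assumes y: "lin_sol 4 (coef t1 t2 l) y" and z: "lin_sol 4 (coef t1 t2 l) z" and x: "x \<in> {0..1}"
  shows "bracket y z x = bracket y z 0"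
proof -
  have yi: "acon 0 x (y i)" "acon 0 x (z i)" if "i < 4" for i
    using y z that x by (auto simp: lin_sol_def intro: acon_subset)
  have ac: "acon 0 x (bracket y z)" unfolding bracket_def[abs_def]
    by (intro acon_add acon_diff acon_mult yi) auto
  have "AE t in lborel. t \<in> {0<..<x} \<longrightarrow> (bracket y z has_vector_derivative 0) (at t)"
    using conjunct2[OF y[unfolded lin_sol_coef_iff]] conjunct2[OF z[unfolded lin_sol_coef_iff]]
  proof eventually_elim
    case (elim t)
    show ?case
    proof
      assume "t \<in> {0<..<x}"
      then have t: "t \<in> {0<..<1}" using x by auto
      note dy = elim(1)[rule_format, OF t] and dz = elim(2)[rule_format, OF t]
      note D = dy[THEN conjunct1] dy[THEN conjunct2, THEN conjunct1] dy[THEN conjunct2, THEN conjunct2, THEN conjunct1]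
        dy[THEN conjunct2, THEN conjunct2, THEN conjunct2] dz[THEN conjunct1] dz[THEN conjunct2, THEN conjunct1]
        dz[THEN conjunct2, THEN conjunct2, THEN conjunct1] dz[THEN conjunct2, THEN conjunct2, THEN conjunct2]
      define y0' y1' y2' y3' where "y0' = y 1 t" and "y1' = - t2 t * y 0 t + t1 t * y 1 t + y 2 t"
        and "y2' = t1 t * t2 t * y 0 t + (2 * t2 t - (t1 t)\<^sup>2) * y 1 t - t1 t * y 2 t + y 3 t"
        and "y3' = ((t2 t)\<^sup>2 + l) * y 0 t - t1 t * t2 t * y 1 t - t2 t * y 2 t"
      define z0' z1' z2' z3' where "z0' = z 1 t" and "z1' = - t2 t * z 0 t + t1 t * z 1 t + z 2 t"
        and "z2' = t1 t * t2 t * z 0 t + (2 * t2 t - (t1 t)\<^sup>2) * z 1 t - t1 t * z 2 t + z 3 t"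
        and "z3' = ((t2 t)\<^sup>2 + l) * z 0 t - t1 t * t2 t * z 1 t - t2 t * z 2 t"
      note D' = D[folded y0'_def y1'_def y2'_def y3'_def z0'_def z1'_def z2'_def z3'_def]
      have "(bracket y z has_vector_derivative (y 0 t * z3' + y0' * z 3 t) - (y 1 t * z2' + y1' * z 2 t)
          + (y 2 t * z1' + y2' * z 1 t) - (y 3 t * z0' + y3' * z 0 t)) (at t)"
        unfolding bracket_def[abs_def]
        by (intro has_vector_derivative_add has_vector_derivative_diff has_vector_derivative_mult D')
      also have "(y 0 t * z3' + y0' * z 3 t) - (y 1 t * z2' + y1' * z 2 t)
          + (y 2 t * z1' + y2' * z 1 t) - (y 3 t * z0' + y3' * z 0 t) = 0"
        unfolding y0'_def y1'_def y2'_def y3'_def z0'_def z1'_def z2'_def z3'_def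
        by (simp add: algebra_simps power2_eq_square)
      finally show "(bracket y z has_vector_derivative 0) (at t)" .
    qed
  qed
  then have "((\<lambda>t. 0) has_integral bracket y z x - bracket y z 0) {0..x}"
    using x by (intro fundamental_theorem_acon[OF ac]) auto
  then show ?thesis using has_integral_unique has_integral_0 by fastforce
qed

lemma clamped_bracket_zero:
  assumes "lin_sol 4 (coef t1 t2 l) y" "lin_sol 4 (coef t1 t2 l) z"
    and "y 0 1 = 0" "y 1 1 = 0" "z 0 1 = 0" "z 1 1 = 0"
  shows "bracket y z 0 = 0"
  using bracket_constant[OF assms(1,2), of 1] assms(3-) by (simp add: bracket_def)

text \<open>If both minors vanish, solutions 1 and 2 can be corrected by multiples of solution 0,
  after scaling, to two clamped solutions. Their bracket at 0 is minus the square of the end point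
  value of solution 0, yet it must vanish, against separation.\<close>

lemma minor_no_common_zero:
  assumes sep: "minor t1 t2 0 1 l = 0 \<Longrightarrow> esol t1 t2 l 0 0 1 \<noteq> 0" and 0: "minor t1 t2 0 1 l = 0"
  shows "minor t1 t2 0 2 l \<noteq> 0"
proof
  assume 2: "minor t1 t2 0 2 l = 0"
  define y where "y k i x = esol t1 t2 l 0 0 1 * esol t1 t2 l k i x + (- esol t1 t2 l k 0 1) * esol t1 t2 l 0 i x" for k i x
  have "bracket (y 1) (y 2) 0 = 0"
  proof (rule clamped_bracket_zero)
    show "lin_sol 4 (coef t1 t2 l) (y 1)" "lin_sol 4 (coef t1 t2 l) (y 2)"
      unfolding y_def[abs_def] by (intro lin_sol_lincomb esol_props(1))+
    show "y 1 0 1 = 0" "y 1 1 1 = 0" "y 2 0 1 = 0" "y 2 1 1 = 0"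
      using 0 2 by (simp_all add: y_def minor_def mult.commute)
  qed
  then have "(esol t1 t2 l 0 0 1)\<^sup>2 = 0"
    by (simp add: bracket_def y_def esol_props(2) power2_eq_square)
  then show False using sep[OF 0] by simp
qed

lemma minor_holomorphic: "i < 4 \<Longrightarrow> j < 4 \<Longrightarrow> minor t1 t2 i j holomorphic_on UNIV"
  unfolding minor_def[abs_def] by (intro holomorphic_intros esol_props(3)) auto

lemma minor_ord14: "i < 4 \<Longrightarrow> j < 4 \<Longrightarrow> ord14 (minor t1 t2 i j)"
  unfolding minor_def[abs_def] by (intro ord14_diff ord14_mult esol_growth) auto

lemma weyl_lin_sol: "lin_sol 4 (coef t1 t2 l) (weyl t1 t2 l k)"
proof -
  have "lin_sol 4 (coef t1 t2 l) (\<lambda>i x. 1 * (1 * esol t1 t2 l k i x + minor t1 t2 1 k l / minor t1 t2 0 1 l * esol t1 t2 l 0 i x)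
     + (- (minor t1 t2 0 k l / minor t1 t2 0 1 l)) * esol t1 t2 l 1 i x)"
    by (intro lin_sol_lincomb esol_props(1))
  then show ?thesis by (simp add: weyl_def[abs_def])
qed

lemma weyl_clamped:
  assumes "minor t1 t2 0 1 l \<noteq> 0" shows "weyl t1 t2 l k 0 1 = 0" "weyl t1 t2 l k 1 1 = 0"
proof -
  define D where "D = minor t1 t2 0 1 l"
  have D: "D \<noteq> 0" using assms by (simp add: D_def)
  have "D * weyl t1 t2 l k i 1 = D * esol t1 t2 l k i 1 + minor t1 t2 1 k l * esol t1 t2 l 0 i 1 - minor t1 t2 0 k l * esol t1 t2 l 1 i 1" for i
    using D unfolding weyl_def D_def[symmetric] by (simp add: field_simps del: One_nat_def)
  note eq = this
  have "D * weyl t1 t2 l k 0 1 = 0" "D * weyl t1 t2 l k 1 1 = 0"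
    unfolding eq by (simp_all add: D_def minor_def algebra_simps)
  then show "weyl t1 t2 l k 0 1 = 0" "weyl t1 t2 l k 1 1 = 0" using D by auto
qed

lemma weyl_initial:
  assumes "k = 2 \<or> k = 3"
  shows "weyl t1 t2 l k 0 0 = minor t1 t2 1 k l / minor t1 t2 0 1 l" "weyl t1 t2 l k 1 0 = - (minor t1 t2 0 k l / minor t1 t2 0 1 l)"
    "weyl t1 t2 l k 2 0 = (if k = 2 then 1 else 0)" "weyl t1 t2 l k 3 0 = (if k = 3 then 1 else 0)"
  using assms by (auto simp: weyl_def esol_props(2))

text \<open>The two Weyl solutions are clamped, and their bracket at 0 is the difference of these
  two minors divided by the first one.\<close>

lemma minor_symmetry_regular:
  assumes nz: "minor t1 t2 0 1 l \<noteq> 0" shows "minor t1 t2 1 2 l = minor t1 t2 0 3 l"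
proof -
  have "bracket (weyl t1 t2 l 2) (weyl t1 t2 l 3) 0 = 0"
    by (rule clamped_bracket_zero) (use weyl_lin_sol weyl_clamped[OF nz] in auto)
  then show ?thesis using nz unfolding bracket_def
    by (simp add: weyl_initial[of 2] weyl_initial[of 3] field_simps del: One_nat_def)
qed

lemma esol_ray_bound:
  assumes s: "s \<ge> 1" and k: "k < 4" and i: "i < 4" and x: "x \<in> {0..1}"
  shows "cmod (esol t1 t2 (- 4 * of_real (s ^ 4)) k i x) \<le> 4 * exp (4 * IA) * (s ^ i / s ^ k) * exp (s * x)"
proof -
  define y where "y = esol t1 t2 (- 4 * of_real (s ^ 4)) k"
  have "ray_sol s y" unfolding ray_sol_def y_def by (rule esol_props(1))
  note g = ray_growth[OF this s x]
  have "(\<Sum>i<4. cmod (y i 0 / of_real s ^ i)) = 1 / s ^ k"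
    using less_4_cases[OF k] s by (auto simp: sum_lessThan_4 y_def esol_props(2) norm_divide norm_power)
  then have "grow s y 0 + decay s y 0 \<le> 16 * (1 / s ^ k)" using initial_modes_le[of s y] by simp
  then have "exp (4 * IA) * (grow s y 0 + decay s y 0) * exp (s * x) \<le> exp (4 * IA) * (16 * (1 / s ^ k)) * exp (s * x)"
    by (intro mult_right_mono mult_left_mono) auto
  then have "4 * cmod (y i x / of_real s ^ i) \<le> exp (4 * IA) * (16 * (1 / s ^ k)) * exp (s * x)"
    using component_bound[OF i, of y x s] g by linarith
  then have "4 * (cmod (y i x) / s ^ i) \<le> exp (4 * IA) * (16 * (1 / s ^ k)) * exp (s * x)"
    using s by (simp add: norm_divide norm_power)
  also have "\<dots> = 4 * (4 * exp (4 * IA) * (1 / s ^ k) * exp (s * x))" by simp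
  finally have "cmod (y i x) / s ^ i \<le> 4 * exp (4 * IA) * (1 / s ^ k) * exp (s * x)"
    by (rule mult_left_le_imp_le) simp
  then show ?thesis using s unfolding y_def[symmetric] by (simp add: pos_divide_le_eq mult.commute mult.left_commute)
qed

text \<open>For large s \<open>clamped_decay\<close> makes the growing modes at 0 a small multiple
  of the decaying ones, and \<open>initial_mode_bounds\<close> translates this into initial values,
  that is, into ratios of minors. \<open>C\<close> precedes \<open>\<eta>\<close> because it depends
  on \<open>IA\<close> alone.\<close>

lemma weyl_ray_asymptotics:
  obtains C where "\<And>\<eta>. 0 < \<eta> \<Longrightarrow> \<exists>s1\<ge>1. \<forall>s\<ge>s1. weyl_asymptotic t1 t2 C \<eta> s"
proof -
  define K where "K = exp (2 * IA)"
  have K1: "K \<ge> 1" using IA_nonneg by (simp add: K_def)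
  define C where "C = 24 * K * (6 * K + 1)"
  show thesis
  proof (rule that[of C])
    fix \<eta> :: real assume \<eta>: "\<eta> > 0"
    \<comment> \<open>The first minimum supplies the bound \<open>e2\<close> that
      \<open>clamped_decay\<close> absorbs with. The second gives \<open>\<theta>\<close> = 6 K^2 e
      the bounds 24 \<open>\<theta>\<close> \<le> \<open>\<eta>\<close> and \<open>\<theta>\<close>
      \<le> 1/12.\<close>
    define e where "e = min (min 1 (1 / (4 * K\<^sup>2 * (4 + 2 * IA)))) (min \<eta> 1 / (144 * K\<^sup>2))"
    have IK: "4 * K\<^sup>2 * (4 + 2 * IA) > 0" using K1 IA_nonneg by (intro mult_pos_pos) auto
    have e: "0 < e" "e \<le> 1" using IK K1 \<eta> by (auto simp: e_def)
    have e2: "2 * K\<^sup>2 * (4 + 2 * IA) * e \<le> 1/2"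
    proof -
      have "e \<le> 1 / (4 * K\<^sup>2 * (4 + 2 * IA))" by (simp add: e_def)
      then have "e * (4 * K\<^sup>2 * (4 + 2 * IA)) \<le> 1" using IK by (simp add: pos_le_divide_eq)
      then show ?thesis by (simp add: algebra_simps)
    qed
    define \<theta> where "\<theta> = 6 * K\<^sup>2 * e"
    have \<theta>: "0 < \<theta>" "\<theta> \<le> 1/12" "24 * \<theta> \<le> \<eta>"
    proof -
      show "0 < \<theta>" using e K1 by (simp add: \<theta>_def)
      have "e \<le> min \<eta> 1 / (144 * K\<^sup>2)" by (simp add: e_def)
      then have "e * (144 * K\<^sup>2) \<le> min \<eta> 1" using K1 by (simp add: pos_le_divide_eq)
      then show "\<theta> \<le> 1/12" "24 * \<theta> \<le> \<eta>" by (auto simp: \<theta>_def algebra_simps)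
    qed
    obtain s0 where s0: "s0 \<ge> 1" "\<And>s x. s \<ge> s0 \<Longrightarrow> x \<in> {0..1} \<Longrightarrow> integral {0..1} (\<lambda>t. al t * exp (- (2 * s * \<bar>t - x\<bar>))) \<le> e"
      using concentration[OF e(1)] by blast
    define s1 where "s1 = max s0 (2 / e)"
    show "\<exists>s1\<ge>1. \<forall>s\<ge>s1. weyl_asymptotic t1 t2 C \<eta> s"
    proof (intro exI[of _ s1] conjI allI impI)
      show "s1 \<ge> 1" using s0 by (simp add: s1_def)
      fix s assume "s \<ge> s1"
      then have s: "s \<ge> 1" "s \<ge> s0" "s \<ge> 2 / e" using s0 by (auto simp: s1_def)
      have s2: "4 * exp (- (2 * s)) \<le> e"
      proof -
        have "2 * s \<le> exp (2 * s)" using exp_ge_add_one_self[of "2 * s"] by linarith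
        then have "exp (- (2 * s)) \<le> 1 / (2 * s)" unfolding exp_minus inverse_eq_divide using s by (intro divide_left_mono) auto
        moreover have "2 / s \<le> e" using s e by (simp add: field_simps)
        ultimately show ?thesis by simp
      qed
      define l where "l = - 4 * complex_of_real (s ^ 4)"
      define c where "c = complex_of_real s"
      have c0: "c \<noteq> 0" "cmod c = s" using s by (auto simp: c_def)
      have clamped: "grow s y 0 \<le> \<theta> * decay s y 0"
        "\<And>x. x \<in> {0..1} \<Longrightarrow> grow s y x + decay s y x \<le> 2 * K * (6 * K + 1) * decay s y 0 * exp (- (s * x))"
        if "lin_sol 4 (coef t1 t2 l) y" "y 0 1 = 0" "y 1 1 = 0" for y
      proof -
        have r: "ray_sol s y" using that(1) by (simp add: ray_sol_def l_def)
        note cd = clamped_decay[OF r s(1) that(2,3) e K_def e2 s0(2)[OF s(2)] s2]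
        show "grow s y 0 \<le> \<theta> * decay s y 0" using cd(1) by (simp add: \<theta>_def)
        show "\<And>x. x \<in> {0..1} \<Longrightarrow> grow s y x + decay s y x \<le> 2 * K * (6 * K + 1) * decay s y 0 * exp (- (s * x))" by (rule cd(2))
      qed
      have nz: "minor t1 t2 0 1 l \<noteq> 0"
      proof
        assume 0: "minor t1 t2 0 1 l = 0"
        \<comment> \<open>Such a combination is clamped, and its quasi-derivatives of orders 2 and 3
          vanish at 0; \<open>initial_mode_bounds\<close> then forces those of orders 0 and 1 to
          vanish as well.\<close>
        have z: "a = 0 \<and> b = 0" if ab: "a * esol t1 t2 l 0 0 1 + b * esol t1 t2 l 1 0 1 = 0"
           "a * esol t1 t2 l 0 1 1 + b * esol t1 t2 l 1 1 1 = 0" for a b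
        proof -
          define y where "y i x = a * esol t1 t2 l 0 i x + b * esol t1 t2 l 1 i x" for i x
          have "lin_sol 4 (coef t1 t2 l) y" unfolding y_def[abs_def] by (intro lin_sol_lincomb esol_props(1))
          then have g: "grow s y 0 \<le> \<theta> * decay s y 0" using clamped(1)[of y] ab by (simp add: y_def)
          note ib = initial_mode_bounds[OF g \<theta>(1,2)]
          have yi: "y 0 0 = a" "y 1 0 = b" "y 2 0 = 0" "y 3 0 = 0" by (auto simp: y_def esol_props(2))
          show ?thesis using ib(3,4) s unfolding yi by simp
        qed
        define a0 a1 b0 b1 where "a0 = esol t1 t2 l 0 0 1" and "a1 = esol t1 t2 l 1 0 1"
          and "b0 = esol t1 t2 l 0 1 1" and "b1 = esol t1 t2 l 1 1 1"
        have det: "a0 * b1 = b0 * a1" using 0 by (simp add: minor_def a0_def a1_def b0_def b1_def)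
        \<comment> \<open>As the determinant vanishes, the vectors (a1, -a0) and (b1, -b0) lie in
          the kernel and are zero by \<open>z\<close>. Then the whole matrix is zero, and even (1,
          0) would lie in its kernel.\<close>
        have "a1 = 0 \<and> - a0 = 0" by (rule z) (use det in \<open>auto simp: a0_def a1_def b0_def b1_def mult.commute\<close>)
        moreover have "b1 = 0 \<and> - b0 = 0" by (rule z) (use det in \<open>auto simp: a0_def a1_def b0_def b1_def mult.commute\<close>)
        ultimately have "1 = (0::complex) \<and> 0 = (0::complex)"
          by (intro z) (auto simp: a0_def a1_def b0_def b1_def)
        then show False by simp
      qed
      have W: "cmod (minor t1 t2 1 k l / minor t1 t2 0 1 l - 1 / (2 * c ^ k)) \<le> 12 * \<theta> * (1 / s ^ k)"
        "cmod (- (minor t1 t2 0 k l / minor t1 t2 0 1 l) / c + (if k = 2 then 1 else 1/2) / c ^ k) \<le> 24 * \<theta> * (1 / s ^ k)"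
        "\<And>i x. i < 4 \<Longrightarrow> x \<in> {0..1} \<Longrightarrow> cmod (weyl t1 t2 l k i x) \<le> C * (s ^ i / s ^ k) * exp (- (s * x))"
        if k: "k = 2 \<or> k = 3" for k
      proof -
        define y where "y = weyl t1 t2 l k"
        note cl = clamped[of y, unfolded y_def, OF weyl_lin_sol weyl_clamped[OF nz], folded y_def]
        note ib = initial_mode_bounds[OF cl(1) \<theta>(1,2)]
        note yi = weyl_initial[OF k, of l, folded y_def]
        have R: "cmod (y 2 0 / of_real s ^ 2) + cmod (y 3 0 / of_real s ^ 3) = 1 / s ^ k"
          using k s by (auto simp: yi norm_divide norm_power)
        note ib' = ib[unfolded R, folded c_def]
        show "cmod (minor t1 t2 1 k l / minor t1 t2 0 1 l - 1 / (2 * c ^ k)) \<le> 12 * \<theta> * (1 / s ^ k)"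
          using ib'(3) k unfolding yi by (auto simp: mult.commute)
        show "cmod (- (minor t1 t2 0 k l / minor t1 t2 0 1 l) / c + (if k = 2 then 1 else 1/2) / c ^ k) \<le> 24 * \<theta> * (1 / s ^ k)"
          using ib'(4) k unfolding yi by (auto simp: mult.commute)
        fix i :: nat and x :: real assume i: "i < 4" and x: "x \<in> {0..1}"
        have "4 * cmod (y i x / of_real s ^ i) \<le> 2 * K * (6 * K + 1) * decay s y 0 * exp (- (s * x))"
          using component_bound[OF i, of y x s] cl(2)[OF x] by linarith
        also have "\<dots> \<le> 2 * K * (6 * K + 1) * (48 * (1 / s ^ k)) * exp (- (s * x))"
          using ib'(2) K1 by (intro mult_right_mono mult_left_mono) auto
        finally have "4 * (cmod (y i x) / s ^ i) \<le> 4 * (C * (1 / s ^ k) * exp (- (s * x)))"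
          using s by (simp add: norm_divide norm_power C_def)
        then have "cmod (y i x) / s ^ i \<le> C * (1 / s ^ k) * exp (- (s * x))"
          by (rule mult_left_le_imp_le) simp
        then show "cmod (weyl t1 t2 l k i x) \<le> C * (s ^ i / s ^ k) * exp (- (s * x))"
          using s unfolding y_def[symmetric] by (simp add: pos_divide_le_eq mult.commute mult.left_commute)
      qed
      have scale: "cmod (c ^ k * z - d) \<le> \<eta>" if "cmod (z - d / c ^ k) \<le> B * (1 / s ^ k)" "B \<le> \<eta>" for z d B and k :: nat
      proof -
        have "cmod (c ^ k * z - d) = cmod (c ^ k * (z - d / c ^ k))" using c0 by (simp add: algebra_simps)
        also have "\<dots> = s ^ k * cmod (z - d / c ^ k)" using c0 by (simp add: norm_mult norm_power)
        also have "\<dots> \<le> s ^ k * (B * (1 / s ^ k))" using that s by (intro mult_left_mono) auto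
        also have "\<dots> = B" using s by simp
        finally show ?thesis using that by linarith
      qed
      have "cmod (c ^ 2 * (minor t1 t2 0 3 l / minor t1 t2 0 1 l) - 1/2) \<le> \<eta>"
        using scale[of "minor t1 t2 1 2 l / minor t1 t2 0 1 l" "1/2" 2 "12 * \<theta>"] W(1)[of 2] \<theta> unfolding minor_symmetry_regular[OF nz] by simp
      moreover have "cmod (c ^ 3 * (minor t1 t2 1 3 l / minor t1 t2 0 1 l) - 1/2) \<le> \<eta>"
        using scale[of "minor t1 t2 1 3 l / minor t1 t2 0 1 l" "1/2" 3 "12 * \<theta>"] W(1)[of 3] \<theta> by simp
      moreover have "cmod (c * (minor t1 t2 0 2 l / minor t1 t2 0 1 l) - 1) \<le> \<eta>"
      proof -
        define a where "a = minor t1 t2 0 2 l / minor t1 t2 0 1 l"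
        have "a / c - 1 / c ^ 2 = - (- a / c + (if 2 = (2::nat) then 1 else 1/2) / c ^ 2)" by simp
        then have "cmod (a / c - 1 / c ^ 2) \<le> 24 * \<theta> * (1 / s ^ 2)"
          using W(2)[of 2, OF disjI1[OF refl], folded a_def] by (simp only: norm_minus_cancel)
        then have "cmod (c ^ 2 * (a / c) - 1) \<le> \<eta>"
          by (rule scale) (use \<theta> in simp)
        then show ?thesis using c0 unfolding a_def[symmetric] by (simp add: power2_eq_square)
      qed
      ultimately show "weyl_asymptotic t1 t2 C \<eta> s"
        using nz W(3) unfolding weyl_asymptotic_def Let_def l_def[symmetric] c_def[symmetric] by blast
    qed
  qed
qed

text \<open>Far out on the ray the normalised ratios lie within 1/4 of their limits 1 and 1/2. This
  excludes the zero function when zeros are counted.\<close>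

lemma minor_nonzero: "\<exists>l. minor t1 t2 0 1 l \<noteq> 0 \<and> minor t1 t2 0 2 l \<noteq> 0 \<and> minor t1 t2 0 3 l \<noteq> 0"
proof -
  obtain C where "\<And>\<eta>. 0 < \<eta> \<Longrightarrow> \<exists>s1\<ge>1. \<forall>s\<ge>s1. weyl_asymptotic t1 t2 C \<eta> s"
    using weyl_ray_asymptotics by blast
  from this[of "1/4"] obtain s1 where s1: "\<forall>s\<ge>s1. weyl_asymptotic t1 t2 C (1/4) s"
    by auto
  define l where "l = - 4 * complex_of_real (s1 ^ 4)"
  have "minor t1 t2 0 1 l \<noteq> 0" "cmod (of_real s1 * (minor t1 t2 0 2 l / minor t1 t2 0 1 l) - 1) \<le> 1/4"
     "cmod (of_real s1 ^ 2 * (minor t1 t2 0 3 l / minor t1 t2 0 1 l) - 1/2) \<le> 1/4"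
    using s1[rule_format, OF order_refl] unfolding weyl_asymptotic_def Let_def l_def by blast+
  then have "minor t1 t2 0 1 l \<noteq> 0 \<and> minor t1 t2 0 2 l \<noteq> 0 \<and> minor t1 t2 0 3 l \<noteq> 0"
    by (auto simp: norm_divide)
  then show ?thesis by blast
qed

text \<open>The identity theorem removes the restriction to points where the first minor is
  nonzero.\<close>

lemma minor_symmetry: "minor t1 t2 1 2 l = minor t1 t2 0 3 l"
proof (rule analytic_continuation_open[of "{l. minor t1 t2 0 1 l \<noteq> 0}" UNIV "minor t1 t2 1 2" "minor t1 t2 0 3"])
  have "continuous_on UNIV (minor t1 t2 0 1)" by (intro holomorphic_on_imp_continuous_on minor_holomorphic) auto
  then have "open (minor t1 t2 0 1 -` (- {0}))"
    by (intro open_vimage) auto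
  then show "open {l. minor t1 t2 0 1 l \<noteq> 0}" by (simp add: vimage_def)
  show "{l. minor t1 t2 0 1 l \<noteq> 0} \<noteq> {}" using minor_nonzero by blast
  show "minor t1 t2 1 2 z = minor t1 t2 0 3 z" if "z \<in> {l. minor t1 t2 0 1 l \<noteq> 0}" for z
    using minor_symmetry_regular that by blast
qed (auto intro: minor_holomorphic)

lemma minor_pluecker:
  "minor t1 t2 0 2 l * minor t1 t2 1 3 l = (minor t1 t2 0 3 l)\<^sup>2 + minor t1 t2 0 1 l * minor t1 t2 2 3 l"
proof -
  have "minor t1 t2 0 2 l * minor t1 t2 1 3 l = minor t1 t2 0 3 l * minor t1 t2 1 2 l + minor t1 t2 0 1 l * minor t1 t2 2 3 l"
    unfolding minor_def by (simp add: algebra_simps)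
  then show ?thesis unfolding minor_symmetry by (simp add: power2_eq_square)
qed

end

section \<open>Characteristic functions\<close>

lemma detI_singleton: "detI {a} M = M a a"
  by (simp add: detI_def permutes_sing sign_id)

lemma detI_pair:
  assumes "a \<noteq> b" shows "detI {a, b} M = M a a * M b b - M a b * M b a"
  using assms unfolding detI_def
  by (subst sum_over_permutations_insert)
     (auto simp: permutes_sing sign_swap_id permutation_swap_id sign_compose sign_id swap_id_eq)

text \<open>The first two rows are unit vectors, so only permutations with values i at 1 and j at 2
  survive, leaving a signed 2 x 2 minor of the last two rows.\<close>

lemma detI_1_4:
  fixes M :: "nat \<Rightarrow> nat \<Rightarrow> complex"
  assumes r1: "\<And>r. r \<in> {1..4} \<Longrightarrow> M 1 r = (if r = i then 1 else 0)"
    and r2: "\<And>r. r \<in> {1..4} \<Longrightarrow> M 2 r = (if r = j then 1 else 0)"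
  shows "i = 1 \<Longrightarrow> j = 2 \<Longrightarrow> detI {1..4} M = M 3 3 * M 4 4 - M 3 4 * M 4 3"
    "i = 1 \<Longrightarrow> j = 3 \<Longrightarrow> detI {1..4} M = - (M 3 2 * M 4 4 - M 3 4 * M 4 2)"
    "i = 2 \<Longrightarrow> j = 3 \<Longrightarrow> detI {1..4} M = M 3 1 * M 4 4 - M 3 4 * M 4 1"
proof -
  have set4: "{1..4::nat} = {1, 2, 3, 4}" by auto
  have f: "finite {2,3,4::nat}" "1 \<notin> {2,3,4::nat}" "finite {3,4::nat}" "2 \<notin> {3,4::nat}" "finite {4::nat}" "3 \<notin> {4::nat}" by auto
  have D: "detI {1..4} M = (\<Sum>p | p permutes {1,2,3,4}. of_int (sign p) * (M 1 (p 1) * (M 2 (p 2) * (M 3 (p 3) * M 4 (p 4)))))"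
    unfolding detI_def set4 by (intro sum.cong) auto
  have r: "M 1 1 = (if 1 = i then 1 else 0)" "M 1 2 = (if 2 = i then 1 else 0)" "M 1 3 = (if 3 = i then 1 else 0)" "M 1 4 = (if 4 = i then 1 else 0)"
    "M 2 1 = (if 1 = j then 1 else 0)" "M 2 2 = (if 2 = j then 1 else 0)" "M 2 3 = (if 3 = j then 1 else 0)" "M 2 4 = (if 4 = j then 1 else 0)"
    using r1[of 1] r1[of 2] r1[of 3] r1[of 4] r2[of 1] r2[of 2] r2[of 3] r2[of 4] by simp_all
  note expand = sum_over_permutations_insert[OF f(1,2)] sum_over_permutations_insert[OF f(3,4)] sum_over_permutations_insert[OF f(5,6)] permutes_sing
  show "i = 1 \<Longrightarrow> j = 2 \<Longrightarrow> detI {1..4} M = M 3 3 * M 4 4 - M 3 4 * M 4 3"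
    "i = 1 \<Longrightarrow> j = 3 \<Longrightarrow> detI {1..4} M = - (M 3 2 * M 4 4 - M 3 4 * M 4 2)"
    "i = 2 \<Longrightarrow> j = 3 \<Longrightarrow> detI {1..4} M = M 3 1 * M 4 4 - M 3 4 * M 4 1"
    unfolding D expand using r
    by (simp_all add: sign_swap_id permutation_swap_id sign_compose sign_id swap_id_eq permutation_compose)
qed

text \<open>Used with a quantity Y for which Y and r Y approach the same nonzero limit d along the
  ray; the witness may depend on the accuracy.\<close>

lemma ratio_eq_1:
  fixes r d :: complex
  assumes d: "d \<noteq> 0" and a: "\<And>\<eta>. \<eta> > 0 \<Longrightarrow> \<exists>Y. cmod (r * Y - d) \<le> \<eta> \<and> cmod (Y - d) \<le> \<eta>"
  shows "r = 1"
proof (rule ccontr)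
  assume "r \<noteq> 1"
  define q where "q = cmod (r - 1) * cmod d"
  have q: "q > 0" using d \<open>r \<noteq> 1\<close> by (simp add: q_def)
  define \<eta> where "\<eta> = q / (2 * (cmod r + 1))"
  have r1: "cmod r + 1 > 0" by (simp add: add_nonneg_pos)
  have \<eta>: "\<eta> > 0" using q r1 by (simp add: \<eta>_def)
  obtain Y where Y: "cmod (r * Y - d) \<le> \<eta>" "cmod (Y - d) \<le> \<eta>" using a[OF \<eta>] by blast
  have "q = cmod ((r * Y - d) - r * (Y - d))" by (simp add: q_def norm_mult[symmetric] algebra_simps)
  also have "\<dots> \<le> cmod (r * Y - d) + cmod (r * (Y - d))" by (rule norm_triangle_ineq4)
  also have "\<dots> \<le> \<eta> + cmod r * \<eta>" using Y by (intro add_mono) (auto simp: norm_mult intro: mult_left_mono)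
  also have "\<dots> = q / 2"
  proof -
    have "\<eta> + cmod r * \<eta> = (cmod r + 1) * \<eta>" by (simp add: algebra_simps)
    also have "\<dots> = q / 2" using r1 unfolding \<eta>_def by (simp add: divide_simps)
    finally show ?thesis .
  qed
  finally show False using q by simp
qed

text \<open>Relations read off from the differential equations hold almost everywhere; this extends
  them to the whole interval, so that they can be differentiated again.\<close>

lemma AE_zero_continuous:
  fixes f :: "real \<Rightarrow> complex"
  assumes c: "continuous_on {0..1} f" and ae: "AE x in lborel. x \<in> {0<..<1} \<longrightarrow> f x = 0" and x: "x \<in> {0..1}"
  shows "f x = 0"
proof (rule ccontr)
  assume nz: "f x \<noteq> 0"
  obtain N where N: "negligible N" "\<And>x. x \<notin> N \<Longrightarrow> x \<in> {0<..<1} \<Longrightarrow> f x = 0"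
    using ae unfolding AE_lborel_iff_negligible by blast
  obtain d where d: "d > 0" "\<And>y. y \<in> {0..1} \<Longrightarrow> dist y x < d \<Longrightarrow> dist (f y) (f x) < cmod (f x)"
    using c x nz unfolding continuous_on_iff by (metis zero_less_norm_iff)
  define a b where "a = max 0 (x - d)" and "b = min 1 (x + d)"
  have ab: "a < b" using x d(1) by (auto simp: a_def b_def)
  have "{a<..<b} \<subseteq> N"
  proof
    fix y assume y: "y \<in> {a<..<b}"
    have "dist (f y) (f x) < cmod (f x)" by (rule d(2)) (use y in \<open>auto simp: a_def b_def dist_real_def\<close>)
    then have "f y \<noteq> 0" by (auto simp: dist_norm)
    then show "y \<in> N" using N(2)[of y] y by (auto simp: a_def b_def)
  qed
  then have "negligible {a<..<b}" using N(1) negligible_subset by blast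
  then show False using open_not_negligible[of "{a<..<b}"] ab by auto
qed

lemma acon_AE_derivative_zero:
  fixes f :: "real \<Rightarrow> complex"
  assumes ac: "acon 0 1 f" and ae: "AE x in lborel. x \<in> {0<..<1} \<longrightarrow> (f has_vector_derivative 0) (at x)" and x: "x \<in> {0..1}"
  shows "f x = f 0"
proof -
  have "((\<lambda>t. 0) has_integral f x - f 0) {0..x}"
  proof (rule fundamental_theorem_acon)
    show "acon 0 x f" using acon_subset[OF ac] x by auto
    show "AE t in lborel. t \<in> {0<..<x} \<longrightarrow> (f has_vector_derivative 0) (at t)"
      using ae by eventually_elim (use x in auto)
  qed (use x in auto)
  then show ?thesis using has_integral_unique[OF _ has_integral_0] by fastforce
qed

lemma derivative_of_constant:
  fixes f :: "real \<Rightarrow> complex"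
  assumes "\<And>x. x \<in> {0..1} \<Longrightarrow> f x = c" "x \<in> {0<..<1}" "(f has_vector_derivative D) (at x)"
  shows "D = 0"
proof -
  have "(f has_vector_derivative 0) (at x)"
    by (rule has_vector_derivative_transform_within_open[OF has_vector_derivative_const[of c], of "{0<..<1}"])
       (use assms in auto)
  then show ?thesis using assms(3) vector_derivative_unique_at by blast
qed

context fourth_order
begin

lemma bform_True: "s \<in> {1..4} \<Longrightarrow> r \<in> {1..4} \<Longrightarrow> bform 4 (Fmat t1 t2) l (True, s) r = esol t1 t2 l (4 - r) (4 - s) 1"
  unfolding bform_def by (auto intro: fund_sol_eq)

lemma bform_False: "s \<in> {1..4} \<Longrightarrow> r \<in> {1..4} \<Longrightarrow> bform 4 (Fmat t1 t2) l (False, s) r = (if r = s then 1 else 0)"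
  unfolding bform_def using fund_sol_eq[of r "4 - s" 0 l] by (auto simp: esol_props(2))

lemma Delta_2: "Delta 4 (Fmat t1 t2) 2 l = minor t1 t2 0 1 l"
proof -
  have "{2 + 1..4::nat} = {3, 4}" by auto
  then show ?thesis unfolding Delta_def by (simp add: detI_pair bform_True minor_def algebra_simps)
qed

lemma Delta_3: "Delta 4 (Fmat t1 t2) 3 l = esol t1 t2 l 0 0 1"
proof -
  have "{3 + 1..4::nat} = {4}" by auto
  then show ?thesis unfolding Delta_def by (simp add: detI_singleton bform_True)
qed

text \<open>The conditions at 0 leave the columns C_k with k outside {i, j}. In the numbering of
  \<open>esol\<close> the index is 4 - k, which yields the pairs 0 1, 0 2 and 0 3; the sign in the
  second case is that of the expansion.\<close>

lemma char_fun_eq: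
  "char_fun 4 (Fmat t1 t2) (W_ij 1 2) = minor t1 t2 0 1"
  "char_fun 4 (Fmat t1 t2) (W_ij 1 3) = (\<lambda>l. - minor t1 t2 0 2 l)"
  "char_fun 4 (Fmat t1 t2) (W_ij 2 3) = minor t1 t2 0 3"
proof -
  have W: "W_ij i j 1 = (False, i)" "W_ij i j 2 = (False, j)" "W_ij i j 3 = (True, 3)" "W_ij i j 4 = (True, 4)" for i j
    by (auto simp: W_ij_def)
  have row: "bform 4 (Fmat t1 t2) l (W_ij i j 1) r = (if r = i then 1 else 0)"
    "bform 4 (Fmat t1 t2) l (W_ij i j 2) r = (if r = j then 1 else 0)" if "i \<in> {1..4}" "j \<in> {1..4}" "r \<in> {1..4}" for i j r l
    unfolding W using that by (auto simp: bform_False)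
  have V: "bform 4 (Fmat t1 t2) l (True, 3) 1 = esol t1 t2 l 3 1 1" "bform 4 (Fmat t1 t2) l (True, 3) 2 = esol t1 t2 l 2 1 1"
    "bform 4 (Fmat t1 t2) l (True, 3) 3 = esol t1 t2 l 1 1 1" "bform 4 (Fmat t1 t2) l (True, 3) 4 = esol t1 t2 l 0 1 1"
    "bform 4 (Fmat t1 t2) l (True, 4) 1 = esol t1 t2 l 3 0 1" "bform 4 (Fmat t1 t2) l (True, 4) 2 = esol t1 t2 l 2 0 1"
    "bform 4 (Fmat t1 t2) l (True, 4) 3 = esol t1 t2 l 1 0 1" "bform 4 (Fmat t1 t2) l (True, 4) 4 = esol t1 t2 l 0 0 1" for l
    using bform_True[of 3 1 l] bform_True[of 3 2 l] bform_True[of 3 3 l] bform_True[of 3 4 l]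
      bform_True[of 4 1 l] bform_True[of 4 2 l] bform_True[of 4 3 l] bform_True[of 4 4 l] by simp_all
  show "char_fun 4 (Fmat t1 t2) (W_ij 1 2) = minor t1 t2 0 1"
  proof
    fix l
    have "char_fun 4 (Fmat t1 t2) (W_ij 1 2) l = esol t1 t2 l 1 1 1 * esol t1 t2 l 0 0 1 - esol t1 t2 l 0 1 1 * esol t1 t2 l 1 0 1"
      unfolding char_fun_def by (rule detI_1_4(1)[where i = 1 and j = 2, THEN trans])
        ((rule row; auto), (rule row; auto), rule refl, rule refl, simp only: W V)
    then show "char_fun 4 (Fmat t1 t2) (W_ij 1 2) l = minor t1 t2 0 1 l" by (simp only: minor_def mult.commute)
  qed
  show "char_fun 4 (Fmat t1 t2) (W_ij 1 3) = (\<lambda>l. - minor t1 t2 0 2 l)"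
  proof
    fix l
    have "char_fun 4 (Fmat t1 t2) (W_ij 1 3) l = - (esol t1 t2 l 2 1 1 * esol t1 t2 l 0 0 1 - esol t1 t2 l 0 1 1 * esol t1 t2 l 2 0 1)"
      unfolding char_fun_def by (rule detI_1_4(2)[where i = 1 and j = 3, THEN trans])
        ((rule row; auto), (rule row; auto), rule refl, rule refl, simp only: W V)
    then show "char_fun 4 (Fmat t1 t2) (W_ij 1 3) l = - minor t1 t2 0 2 l" by (simp only: minor_def mult.commute)
  qed
  show "char_fun 4 (Fmat t1 t2) (W_ij 2 3) = minor t1 t2 0 3"
  proof
    fix l
    have "char_fun 4 (Fmat t1 t2) (W_ij 2 3) l = esol t1 t2 l 3 1 1 * esol t1 t2 l 0 0 1 - esol t1 t2 l 0 1 1 * esol t1 t2 l 3 0 1"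
      unfolding char_fun_def by (rule detI_1_4(3)[where i = 2 and j = 3, THEN trans])
        ((rule row; auto), (rule row; auto), rule refl, rule refl, simp only: W V)
    then show "char_fun 4 (Fmat t1 t2) (W_ij 2 3) l = minor t1 t2 0 3 l" by (simp only: minor_def mult.commute)
  qed
qed

text \<open>Separation at m = 2, where the two functions are the first minor and the end point value
  of solution 0.\<close>

lemma separation_minor:
  assumes "separation 4 (Fmat t1 t2)" "minor t1 t2 0 1 l = 0" shows "esol t1 t2 l 0 0 1 \<noteq> 0"
proof -
  have "(2::nat) \<in> {1..4 - 1}" by auto
  then have "\<not> (\<exists>lam. Delta 4 (Fmat t1 t2) 2 lam = 0 \<and> Delta 4 (Fmat t1 t2) (2 + 1) lam = 0)"
    using assms(1) unfolding separation_def by blast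
  then show ?thesis using assms(2) Delta_2[of l] Delta_3[of l] by auto
qed

end


section \<open>Comparison of two problems\<close>

locale fourth_order_pair = fourth_order t1 t2 + tilde: fourth_order u1 u2
  for t1 t2 u1 u2 :: "real \<Rightarrow> complex"
begin

text \<open>\<open>Q x l = C(x) J C~(x)^T\<close> with the fundamental matrices of the two problems. As the transposed
  fundamental matrix is inverted by J up to sign, Q is, up to the constant factor J, the matrix
  that maps solutions of the second problem to solutions of the first one with the same initial values.\<close>
definition Q :: "nat \<Rightarrow> nat \<Rightarrow> complex \<Rightarrow> real \<Rightarrow> complex" where
  "Q i j l x = esol t1 t2 l 0 i x * esol u1 u2 l 3 j x - esol t1 t2 l 1 i x * esol u1 u2 l 2 j x
    + esol t1 t2 l 2 i x * esol u1 u2 l 1 j x - esol t1 t2 l 3 i x * esol u1 u2 l 0 j x"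

text \<open>Equal zeros give each pair of minors a constant of its own. The constants agree, because
  after multiplication by the same power of s the ratios to the first minor have the same nonzero
  limit for both problems.\<close>

lemma minors_proportional:
  assumes sp: "spectrum 4 (Fmat t1 t2) (W_ij 1 2) = spectrum 4 (Fmat u1 u2) (W_ij 1 2)"
    "spectrum 4 (Fmat t1 t2) (W_ij 1 3) = spectrum 4 (Fmat u1 u2) (W_ij 1 3)"
    "spectrum 4 (Fmat t1 t2) (W_ij 2 3) = spectrum 4 (Fmat u1 u2) (W_ij 2 3)"
  obtains c where "c \<noteq> 0" "\<And>l. minor t1 t2 0 1 l = c * minor u1 u2 0 1 l"
    "\<And>l. minor t1 t2 0 2 l = c * minor u1 u2 0 2 l" "\<And>l. minor t1 t2 0 3 l = c * minor u1 u2 0 3 l"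
proof -
  obtain w where w: "minor t1 t2 0 1 w \<noteq> 0" "minor t1 t2 0 2 w \<noteq> 0" "minor t1 t2 0 3 w \<noteq> 0"
    using minor_nonzero by blast
  obtain v where v: "minor u1 u2 0 1 v \<noteq> 0" "minor u1 u2 0 2 v \<noteq> 0" "minor u1 u2 0 3 v \<noteq> 0"
    using tilde.minor_nonzero by blast
  note hol = minor_holomorphic tilde.minor_holomorphic and ord = minor_ord14 tilde.minor_ord14
  note zm = sp[unfolded spectrum_def char_fun_eq tilde.char_fun_eq]
  obtain c1 where c1: "c1 \<noteq> 0" "\<And>l. minor t1 t2 0 1 l = c1 * minor u1 u2 0 1 l"
    by (rule ord14_same_zeros_proportional[OF _ _ w(1) _ _ v(1) zm(1)]) (auto intro: hol ord)
  obtain c2 where c2: "c2 \<noteq> 0" "\<And>l. - minor t1 t2 0 2 l = c2 * - minor u1 u2 0 2 l"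
  proof (rule ord14_same_zeros_proportional[OF _ _ _ _ _ _ zm(2)])
    show "- minor t1 t2 0 2 w \<noteq> 0" "- minor u1 u2 0 2 v \<noteq> 0" using w v by auto
  qed (auto intro!: hol ord holomorphic_intros ord14_minus)
  obtain c3 where c3: "c3 \<noteq> 0" "\<And>l. minor t1 t2 0 3 l = c3 * minor u1 u2 0 3 l"
    by (rule ord14_same_zeros_proportional[OF _ _ w(3) _ _ v(3) zm(3)]) (auto intro: hol ord)
  obtain C where A: "\<And>\<eta>. 0 < \<eta> \<Longrightarrow> \<exists>s1\<ge>1. \<forall>s\<ge>s1. weyl_asymptotic t1 t2 C \<eta> s"
    using weyl_ray_asymptotics by blast
  obtain D where B: "\<And>\<eta>. 0 < \<eta> \<Longrightarrow> \<exists>s1\<ge>1. \<forall>s\<ge>s1. weyl_asymptotic u1 u2 D \<eta> s"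
    using tilde.weyl_ray_asymptotics by blast
  have ray: "\<exists>s l. minor u1 u2 0 1 l \<noteq> 0 \<and>
     cmod (of_real s * (minor t1 t2 0 2 l / minor t1 t2 0 1 l) - 1) \<le> \<eta> \<and>
     cmod (of_real s ^ 2 * (minor t1 t2 0 3 l / minor t1 t2 0 1 l) - 1/2) \<le> \<eta> \<and>
     cmod (of_real s * (minor u1 u2 0 2 l / minor u1 u2 0 1 l) - 1) \<le> \<eta> \<and>
     cmod (of_real s ^ 2 * (minor u1 u2 0 3 l / minor u1 u2 0 1 l) - 1/2) \<le> \<eta>" if "\<eta> > 0" for \<eta>
  proof -
    from A[OF that] obtain sa where sa: "\<forall>s\<ge>sa. weyl_asymptotic t1 t2 C \<eta> s" by blast
    from B[OF that] obtain sb where sb: "\<forall>s\<ge>sb. weyl_asymptotic u1 u2 D \<eta> s" by blast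
    show ?thesis
      using sa[rule_format, OF max.cobounded1[of sa sb]] sb[rule_format, OF max.cobounded2[of sb sa]]
      unfolding weyl_asymptotic_def Let_def by blast
  qed
  have "c2 / c1 = 1"
  proof (rule ratio_eq_1[of 1])
    fix \<eta> :: real assume "\<eta> > 0"
    from ray[OF this] obtain s l where sl: "cmod (of_real s * (minor t1 t2 0 2 l / minor t1 t2 0 1 l) - 1) \<le> \<eta>"
     "cmod (of_real s * (minor u1 u2 0 2 l / minor u1 u2 0 1 l) - 1) \<le> \<eta>" by blast
    have m: "minor t1 t2 0 2 l = c2 * minor u1 u2 0 2 l" using c2(2)[of l] by simp
    have "of_real s * (minor t1 t2 0 2 l / minor t1 t2 0 1 l) = c2 / c1 * (of_real s * (minor u1 u2 0 2 l / minor u1 u2 0 1 l))"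
      unfolding m c1(2) by simp
    then show "\<exists>Y. cmod (c2 / c1 * Y - 1) \<le> \<eta> \<and> cmod (Y - 1) \<le> \<eta>" using sl by metis
  qed simp
  moreover have "c3 / c1 = 1"
  proof (rule ratio_eq_1[of "1/2"])
    fix \<eta> :: real assume "\<eta> > 0"
    from ray[OF this] obtain s l where sl: "cmod (of_real s ^ 2 * (minor t1 t2 0 3 l / minor t1 t2 0 1 l) - 1/2) \<le> \<eta>"
     "cmod (of_real s ^ 2 * (minor u1 u2 0 3 l / minor u1 u2 0 1 l) - 1/2) \<le> \<eta>" by blast
    have "of_real s ^ 2 * (minor t1 t2 0 3 l / minor t1 t2 0 1 l) = c3 / c1 * (of_real s ^ 2 * (minor u1 u2 0 3 l / minor u1 u2 0 1 l))"
      unfolding c3(2) c1(2) by simp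
    then show "\<exists>Y. cmod (c3 / c1 * Y - 1/2) \<le> \<eta> \<and> cmod (Y - 1/2) \<le> \<eta>" using sl by metis
  qed simp
  ultimately have "c2 = c1" "c3 = c1" using c1(1) by auto
  then show thesis using that[of c1] c1 c2(2) c3(2) by simp
qed

text \<open>The two Pluecker relations, the second scaled by c^2, differ by a relation in which the
  second minor times X equals the first minor times Z. Hence X divided by the first minor extends
  across its zeros as Z divided by the second minor. The extension \<open>h\<close> has order at
  most 1/4 and on the ray is a difference of two decaying ratios, so it vanishes.\<close>

lemma minor_13_proportional:
  assumes sep: "separation 4 (Fmat t1 t2)" and c0: "c \<noteq> 0"
    and c: "\<And>l. minor t1 t2 0 1 l = c * minor u1 u2 0 1 l"
    "\<And>l. minor t1 t2 0 2 l = c * minor u1 u2 0 2 l" "\<And>l. minor t1 t2 0 3 l = c * minor u1 u2 0 3 l"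
  shows "minor t1 t2 1 3 l = c * minor u1 u2 1 3 l"
proof -
  define X where "X l = minor t1 t2 1 3 l - c * minor u1 u2 1 3 l" for l
  define Z where "Z l = minor t1 t2 2 3 l - c * minor u1 u2 2 3 l" for l
  note hol = minor_holomorphic tilde.minor_holomorphic and ord = minor_ord14 tilde.minor_ord14
  have XZ: "minor t1 t2 0 2 l * X l = minor t1 t2 0 1 l * Z l" for l
  proof -
    have "c * minor u1 u2 0 2 l * (c * minor u1 u2 1 3 l) = (c * minor u1 u2 0 3 l)\<^sup>2 + c * minor u1 u2 0 1 l * (c * minor u1 u2 2 3 l)"
      using arg_cong[OF tilde.minor_pluecker[of l], of "\<lambda>z. c * c * z"] by (simp add: algebra_simps power2_eq_square)
    then have "minor t1 t2 0 2 l * (c * minor u1 u2 1 3 l) = (minor t1 t2 0 3 l)\<^sup>2 + minor t1 t2 0 1 l * (c * minor u1 u2 2 3 l)"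
      by (simp only: c)
    then show ?thesis using minor_pluecker[of l] unfolding X_def Z_def right_diff_distrib by simp
  qed
  define h where "h l = (if minor t1 t2 0 1 l \<noteq> 0 then X l / minor t1 t2 0 1 l else Z l / minor t1 t2 0 2 l)" for l
  have nc: "minor t1 t2 0 1 l \<noteq> 0 \<or> minor t1 t2 0 2 l \<noteq> 0" for l
    using minor_no_common_zero[OF separation_minor[OF sep]] by blast
  have hX: "X l = h l * minor t1 t2 0 1 l" for l
  proof (cases "minor t1 t2 0 1 l = 0")
    case True
    then have "X l = 0" using XZ[of l] nc[of l] by auto
    then show ?thesis using True by simp
  qed (simp add: h_def)
  have opn: "open {l. minor t1 t2 0 j l \<noteq> 0}" if "j < 4" for j
  proof -
    have "continuous_on UNIV (minor t1 t2 0 j)" using that by (intro holomorphic_on_imp_continuous_on hol) auto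
    then have "open (minor t1 t2 0 j -` (- {0}))" by (intro open_vimage) auto
    then show ?thesis by (simp add: vimage_def)
  qed
  have XZhol: "X holomorphic_on S" "Z holomorphic_on S" for S
    unfolding X_def[abs_def] Z_def[abs_def] by (auto intro!: holomorphic_intros holomorphic_on_subset[OF hol(1)] holomorphic_on_subset[OF hol(2)])
  have "h holomorphic_on {l. minor t1 t2 0 1 l \<noteq> 0} \<union> {l. minor t1 t2 0 2 l \<noteq> 0}"
  proof (rule holomorphic_on_Un[OF _ _ opn opn])
    show "h holomorphic_on {l. minor t1 t2 0 1 l \<noteq> 0}"
      by (rule holomorphic_transform[of "\<lambda>l. X l / minor t1 t2 0 1 l"])
         (auto simp: h_def intro!: holomorphic_on_divide XZhol holomorphic_on_subset[OF hol(1)])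
    show "h holomorphic_on {l. minor t1 t2 0 2 l \<noteq> 0}"
    proof (rule holomorphic_transform[of "\<lambda>l. Z l / minor t1 t2 0 2 l"])
      show "(\<lambda>l. Z l / minor t1 t2 0 2 l) holomorphic_on {l. minor t1 t2 0 2 l \<noteq> 0}"
        by (auto intro!: holomorphic_on_divide XZhol holomorphic_on_subset[OF hol(1)])
      show "Z l / minor t1 t2 0 2 l = h l" if "l \<in> {l. minor t1 t2 0 2 l \<noteq> 0}" for l
        using that XZ[of l] by (auto simp: h_def divide_simps mult.commute)
    qed
  qed auto
  moreover have "{l. minor t1 t2 0 1 l \<noteq> 0} \<union> {l. minor t1 t2 0 2 l \<noteq> 0} = UNIV" using nc by auto
  ultimately have hh: "h holomorphic_on UNIV" by simp
  have "ord14 X" unfolding X_def[abs_def] by (intro ord14_diff ord14_mult ord14_const ord) auto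
  moreover obtain w where "minor t1 t2 0 1 w \<noteq> 0" using minor_nonzero by blast
  ultimately have oh: "ord14 h"
    by (intro ord14_quotient[OF XZhol(1) _ hh hX]) (auto intro: hol ord)
  obtain C where A: "\<And>\<eta>. 0 < \<eta> \<Longrightarrow> \<exists>s1\<ge>1. \<forall>s\<ge>s1. weyl_asymptotic t1 t2 C \<eta> s"
    using weyl_ray_asymptotics by blast
  obtain D where B: "\<And>\<eta>. 0 < \<eta> \<Longrightarrow> \<exists>s1\<ge>1. \<forall>s\<ge>s1. weyl_asymptotic u1 u2 D \<eta> s"
    using tilde.weyl_ray_asymptotics by blast
  from A[of "1/2"] obtain sa where sa: "sa \<ge> 1" "\<forall>s\<ge>sa. weyl_asymptotic t1 t2 C (1/2) s" by auto
  from B[of "1/2"] obtain sb where sb: "sb \<ge> 1" "\<forall>s\<ge>sb. weyl_asymptotic u1 u2 D (1/2) s" by auto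
  have "h l = 0"
  proof (rule ord14_decaying_on_ray_zero[OF hh oh, of "max sa sb" 2])
    show "max sa sb \<ge> 1" using sa by auto
    fix s assume "s \<ge> max sa sb"
    then have s: "s \<ge> sa" "s \<ge> sb" "s \<ge> 1" using sa(1) by auto
    define l where "l = - 4 * complex_of_real (s ^ 4)"
    define p q where "p = minor t1 t2 1 3 l / minor t1 t2 0 1 l" and "q = minor u1 u2 1 3 l / minor u1 u2 0 1 l"
    have m: "minor t1 t2 0 1 l \<noteq> 0" "cmod (of_real s ^ 3 * p - 1/2) \<le> 1/2"
      using sa(2)[rule_format, OF s(1)] unfolding weyl_asymptotic_def Let_def l_def p_def by blast+
    have n: "minor u1 u2 0 1 l \<noteq> 0" "cmod (of_real s ^ 3 * q - 1/2) \<le> 1/2"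
      using sb(2)[rule_format, OF s(2)] unfolding weyl_asymptotic_def Let_def l_def q_def by blast+
    have small: "cmod r \<le> 1 / s" if "cmod (of_real s ^ 3 * r - 1/2) \<le> 1/2" for r :: complex
    proof -
      have "cmod (of_real s ^ 3 * r) \<le> cmod (of_real s ^ 3 * r - 1/2) + cmod (1/2)"
        using norm_triangle_ineq[of "of_real s ^ 3 * r - 1/2" "1/2"] by simp
      also have "\<dots> \<le> 1" using that by simp
      finally have "s ^ 3 * cmod r \<le> 1" using s by (simp add: norm_mult norm_power)
      moreover have "s * cmod r \<le> s ^ 3 * cmod r" using s self_le_power[of s 3] by (intro mult_right_mono) auto
      ultimately have "s * cmod r \<le> 1" by linarith
      then show ?thesis using s by (simp add: pos_le_divide_eq mult.commute)
    qed
    have "h l = p - q"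
      using m(1) n(1) c0 c(1)[of l] by (simp add: h_def X_def p_def q_def diff_divide_distrib)
    then have "cmod (h l) \<le> cmod p + cmod q" by (simp add: norm_triangle_ineq4)
    also have "\<dots> \<le> 1 / s + 1 / s" by (intro add_mono small m n)
    finally show "cmod (h (- 4 * of_real (s ^ 4))) \<le> 2 / s" by (simp add: l_def)
  qed
  then show ?thesis using hX[of l] by (simp add: X_def)
qed

lemma Q_holomorphic: "i < 4 \<Longrightarrow> j < 4 \<Longrightarrow> x \<in> {0..1} \<Longrightarrow> (\<lambda>l. Q i j l x) holomorphic_on UNIV"
  unfolding Q_def by (intro holomorphic_intros esol_props(3) tilde.esol_props(3)) auto

lemma Q_ord14: "i < 4 \<Longrightarrow> j < 4 \<Longrightarrow> x \<in> {0..1} \<Longrightarrow> ord14 (\<lambda>l. Q i j l x)"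
  unfolding Q_def by (intro ord14_add ord14_diff ord14_mult esol_growth tilde.esol_growth) auto

text \<open>The two problems have the same Weyl matrix, so in Q the growing solutions can be paired with
  clamped, hence decaying, ones.\<close>
lemma Q_weyl:
  assumes c0: "c \<noteq> 0" and nz: "minor t1 t2 0 1 l \<noteq> 0"
    and c: "\<And>l. minor t1 t2 0 1 l = c * minor u1 u2 0 1 l"
    "\<And>l. minor t1 t2 0 2 l = c * minor u1 u2 0 2 l" "\<And>l. minor t1 t2 0 3 l = c * minor u1 u2 0 3 l"
    "\<And>l. minor t1 t2 1 3 l = c * minor u1 u2 1 3 l"
  shows "Q i j l x = esol t1 t2 l 0 i x * weyl u1 u2 l 3 j x - esol t1 t2 l 1 i x * weyl u1 u2 l 2 j x
    + weyl t1 t2 l 2 i x * esol u1 u2 l 1 j x - weyl t1 t2 l 3 i x * esol u1 u2 l 0 j x"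
proof -
  define a b g where "a = minor t1 t2 0 3 l / minor t1 t2 0 1 l" and "b = minor t1 t2 0 2 l / minor t1 t2 0 1 l"
    and "g = minor t1 t2 1 3 l / minor t1 t2 0 1 l"
  have e: "minor u1 u2 0 3 l / minor u1 u2 0 1 l = a" "minor u1 u2 0 2 l / minor u1 u2 0 1 l = b" "minor u1 u2 1 3 l / minor u1 u2 0 1 l = g"
    unfolding a_def b_def g_def c using c0 by simp_all
  have w: "weyl t1 t2 l 2 i x = esol t1 t2 l 2 i x + a * esol t1 t2 l 0 i x - b * esol t1 t2 l 1 i x"
    "weyl t1 t2 l 3 i x = esol t1 t2 l 3 i x + g * esol t1 t2 l 0 i x - a * esol t1 t2 l 1 i x" for i
    unfolding weyl_def minor_symmetry a_def b_def g_def by simp_all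
  have w': "weyl u1 u2 l 2 j x = esol u1 u2 l 2 j x + a * esol u1 u2 l 0 j x - b * esol u1 u2 l 1 j x"
    "weyl u1 u2 l 3 j x = esol u1 u2 l 3 j x + g * esol u1 u2 l 0 j x - a * esol u1 u2 l 1 j x" for j
    unfolding weyl_def tilde.minor_symmetry e by simp_all
  show ?thesis unfolding Q_def w w' by (simp add: algebra_simps)
qed

text \<open>In each of the four products of \<open>Q_weyl\<close> one factor is bounded by a
  multiple of exp(s x) and the other by one of exp(-s x), so the exponentials cancel for every x.
  The normalising indices add up to 3, which leaves the power s^(i+j-3).\<close>

lemma Q_ray_bound:
  assumes c0: "c \<noteq> 0"
    and c: "\<And>l. minor t1 t2 0 1 l = c * minor u1 u2 0 1 l"
    "\<And>l. minor t1 t2 0 2 l = c * minor u1 u2 0 2 l" "\<And>l. minor t1 t2 0 3 l = c * minor u1 u2 0 3 l"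
    "\<And>l. minor t1 t2 1 3 l = c * minor u1 u2 1 3 l"
  shows "\<exists>K s0. s0 \<ge> 1 \<and> (\<forall>s\<ge>s0. \<forall>i<4. \<forall>j<4. \<forall>x\<in>{0..1}.
    cmod (Q i j (- 4 * of_real (s ^ 4)) x) \<le> K * (s ^ (i + j) / s ^ 3))"
proof -
  obtain C where A: "\<And>\<eta>. 0 < \<eta> \<Longrightarrow> \<exists>s1\<ge>1. \<forall>s\<ge>s1. weyl_asymptotic t1 t2 C \<eta> s"
    using weyl_ray_asymptotics by blast
  obtain D where B: "\<And>\<eta>. 0 < \<eta> \<Longrightarrow> \<exists>s1\<ge>1. \<forall>s\<ge>s1. weyl_asymptotic u1 u2 D \<eta> s"
    using tilde.weyl_ray_asymptotics by blast
  from A[of 1] obtain sa where sa: "sa \<ge> 1" "\<forall>s\<ge>sa. weyl_asymptotic t1 t2 C 1 s" by auto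
  from B[of 1] obtain sb where sb: "sb \<ge> 1" "\<forall>s\<ge>sb. weyl_asymptotic u1 u2 D 1 s" by auto
  define E where "E = 4 * exp (4 * IA) + 4 * exp (4 * tilde.IA)"
  have E: "4 * exp (4 * IA) \<le> E" "4 * exp (4 * tilde.IA) \<le> E" "E \<ge> 0" by (auto simp: E_def)
  define W where "W = max 0 (max C D)"
  have W: "C \<le> W" "D \<le> W" "W \<ge> 0" by (auto simp: W_def)
  show ?thesis
  proof (rule exI[of _ "4 * (E * W)"], rule exI[of _ "max sa sb"], intro conjI allI impI ballI)
    show "max sa sb \<ge> 1" using sa by auto
    fix s x :: real and i j :: nat assume "s \<ge> max sa sb" and i: "i < 4" and j: "j < 4" and x: "x \<in> {0..1}"
    then have s: "s \<ge> sa" "s \<ge> sb" "s \<ge> 1" using sa(1) by auto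
    define l where "l = - 4 * complex_of_real (s ^ 4)"
    have nz: "minor t1 t2 0 1 l \<noteq> 0"
      and wt: "\<And>k i. k \<in> {2,3} \<Longrightarrow> i < 4 \<Longrightarrow> cmod (weyl t1 t2 l k i x) \<le> C * (s ^ i / s ^ k) * exp (- (s * x))"
      using sa(2)[rule_format, OF s(1)] x unfolding weyl_asymptotic_def Let_def l_def by blast+
    have wu: "\<And>k i. k \<in> {2,3} \<Longrightarrow> i < 4 \<Longrightarrow> cmod (weyl u1 u2 l k i x) \<le> D * (s ^ i / s ^ k) * exp (- (s * x))"
      using sb(2)[rule_format, OF s(2)] x unfolding weyl_asymptotic_def Let_def l_def by blast
    have up: "B * (s ^ i / s ^ k) * e \<le> B' * (s ^ i / s ^ k) * e" if "B \<le> B'" "e \<ge> 0" for B B' e :: real and i k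
      using that s by (intro mult_right_mono) auto
    have et: "cmod (esol t1 t2 l k i x) \<le> E * (s ^ i / s ^ k) * exp (s * x)" if "k < 4" "i < 4" for k i
      unfolding l_def by (rule order_trans[OF esol_ray_bound[OF s(3) that x] up[OF E(1)]]) simp
    have eu: "cmod (esol u1 u2 l k i x) \<le> E * (s ^ i / s ^ k) * exp (s * x)" if "k < 4" "i < 4" for k i
      unfolding l_def by (rule order_trans[OF tilde.esol_ray_bound[OF s(3) that x] up[OF E(2)]]) simp
    have wt': "cmod (weyl t1 t2 l k i x) \<le> W * (s ^ i / s ^ k) * exp (- (s * x))" if "k \<in> {2,3}" "i < 4" for k i
      by (rule order_trans[OF wt[OF that] up[OF W(1)]]) simp
    have wu': "cmod (weyl u1 u2 l k i x) \<le> W * (s ^ i / s ^ k) * exp (- (s * x))" if "k \<in> {2,3}" "i < 4" for k i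
      by (rule order_trans[OF wu[OF that] up[OF W(2)]]) simp
    have pr: "cmod (e * w) \<le> E * W * (s ^ (i + j) / s ^ 3)"
      if "cmod e \<le> E * (s ^ i / s ^ k) * exp (s * x)" "cmod w \<le> W * (s ^ j / s ^ k') * exp (- (s * x))" "k + k' = 3" for e w i j k k'
    proof -
      have "cmod (e * w) \<le> (E * (s ^ i / s ^ k) * exp (s * x)) * (W * (s ^ j / s ^ k') * exp (- (s * x)))"
        unfolding norm_mult using that E W s by (intro mult_mono) auto
      also have "\<dots> = E * W * ((s ^ i * s ^ j) / (s ^ k * s ^ k')) * (exp (s * x) * exp (- (s * x)))" by simp
      also have "\<dots> = E * W * (s ^ (i + j) / s ^ 3)" using that(3) by (simp add: power_add[symmetric] exp_minus)
      finally show ?thesis .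
    qed
    have pr': "cmod (w * e) \<le> E * W * (s ^ (i + j) / s ^ 3)"
      if "cmod w \<le> W * (s ^ i / s ^ k') * exp (- (s * x))" "cmod e \<le> E * (s ^ j / s ^ k) * exp (s * x)" "k + k' = 3" for e w i j k k'
      using pr[OF that(2,1,3)] by (simp add: mult.commute add.commute)
    let ?P = "E * W * (s ^ (i + j) / s ^ 3)"
    have "cmod (a - b + c - d) \<le> cmod a + cmod b + cmod c + cmod d" for a b c d :: complex
      using norm_triangle_ineq4[of "a - b + c" d] norm_triangle_ineq[of "a - b" c] norm_triangle_ineq4[of a b] by linarith
    then have "cmod (Q i j l x) \<le> cmod (esol t1 t2 l 0 i x * weyl u1 u2 l 3 j x) + cmod (esol t1 t2 l 1 i x * weyl u1 u2 l 2 j x)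
      + cmod (weyl t1 t2 l 2 i x * esol u1 u2 l 1 j x) + cmod (weyl t1 t2 l 3 i x * esol u1 u2 l 0 j x)"
      unfolding Q_weyl[OF c0 nz c] .
    also have "\<dots> \<le> ?P + ?P + ?P + ?P"
      using i j by (intro add_mono pr[OF et wu'] pr'[OF wt' eu]) auto
    finally show "cmod (Q i j (- 4 * of_real (s ^ 4)) x) \<le> 4 * (E * W) * (s ^ (i + j) / s ^ 3)" by (simp add: l_def)
  qed
qed

text \<open>For i + j < 3 the power in \<open>Q_ray_bound\<close> is at most 1 / s.\<close>

lemma Q_upper_zero:
  assumes c0: "c \<noteq> 0"
    and c: "\<And>l. minor t1 t2 0 1 l = c * minor u1 u2 0 1 l"
    "\<And>l. minor t1 t2 0 2 l = c * minor u1 u2 0 2 l" "\<And>l. minor t1 t2 0 3 l = c * minor u1 u2 0 3 l"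
    "\<And>l. minor t1 t2 1 3 l = c * minor u1 u2 1 3 l"
    and ij: "i < 4" "j < 4" "i + j < 3" and x: "x \<in> {0..1}"
  shows "Q i j l x = 0"
proof -
  obtain K s0 where s0: "s0 \<ge> 1"
    and K: "\<forall>s\<ge>s0. \<forall>i<4. \<forall>j<4. \<forall>x\<in>{0..1}. cmod (Q i j (- 4 * of_real (s ^ 4)) x) \<le> K * (s ^ (i + j) / s ^ 3)"
    using Q_ray_bound[OF c0 c] by blast
  show ?thesis
  proof (rule ord14_decaying_on_ray_zero[OF Q_holomorphic[OF ij(1,2) x] Q_ord14[OF ij(1,2) x] s0, of "\<bar>K\<bar>"])
    fix s assume s: "s \<ge> s0"
    have s1: "s \<ge> 1" using s s0 by simp
    have "s ^ (i + j) / s ^ 3 \<le> s ^ 2 / s ^ 3" using s1 ij by (intro divide_right_mono power_increasing) auto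
    also have "\<dots> = 1 / s" using s1 by (simp add: power2_eq_square power3_eq_cube)
    finally have "\<bar>K\<bar> * (s ^ (i + j) / s ^ 3) \<le> \<bar>K\<bar> * (1 / s)" by (intro mult_left_mono) auto
    moreover have "K * (s ^ (i + j) / s ^ 3) \<le> \<bar>K\<bar> * (s ^ (i + j) / s ^ 3)" using s1 by (intro mult_right_mono) auto
    ultimately show "cmod (Q i j (- 4 * of_real (s ^ 4)) x) \<le> \<bar>K\<bar> / s" using K[rule_format, OF s ij(1,2) x] by simp
  qed
qed

text \<open>The product rule for Q = C J C~^T gives Q' = A Q + Q A~^T, written out in
  entries.\<close>

lemma Q_derivative:
  "AE x in lborel. x \<in> {0<..<1} \<longrightarrow> (\<forall>i<4. \<forall>j<4. (Q i j l has_vector_derivative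
     (\<Sum>k<4. coef t1 t2 l i k x * Q k j l x) + (\<Sum>k<4. coef u1 u2 l j k x * Q i k l x)) (at x))"
proof -
  have "AE x in lborel. \<forall>k<4. x \<in> {0<..<1} \<longrightarrow> (\<forall>i<4. (esol t1 t2 l k i has_vector_derivative (\<Sum>j<4. coef t1 t2 l i j x * esol t1 t2 l k j x)) (at x))"
    using esol_props(1)[of l] by (intro AE_all_countable[THEN iffD2] allI AE_impI) (auto simp: lin_sol_def)
  moreover have "AE x in lborel. \<forall>k<4. x \<in> {0<..<1} \<longrightarrow> (\<forall>i<4. (esol u1 u2 l k i has_vector_derivative (\<Sum>j<4. coef u1 u2 l i j x * esol u1 u2 l k j x)) (at x))"
    using tilde.esol_props(1)[of l] by (intro AE_all_countable[THEN iffD2] allI AE_impI) (auto simp: lin_sol_def)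
  ultimately show ?thesis
  proof eventually_elim
    case (elim x)
    show ?case
    proof (intro impI allI)
      fix i j :: nat assume x: "x \<in> {0<..<1}" and i: "i < 4" and j: "j < 4"
      define a where "a k = (\<Sum>m<4. coef t1 t2 l i m x * esol t1 t2 l k m x)" for k
      define b where "b k = (\<Sum>m<4. coef u1 u2 l j m x * esol u1 u2 l k m x)" for k
      have d: "(esol t1 t2 l k i has_vector_derivative a k) (at x)" "(esol u1 u2 l k j has_vector_derivative b k) (at x)" if "k < 4" for k
        using elim x i j that by (auto simp: a_def b_def)
      have "(Q i j l has_vector_derivative (esol t1 t2 l 0 i x * b 3 + a 0 * esol u1 u2 l 3 j x) - (esol t1 t2 l 1 i x * b 2 + a 1 * esol u1 u2 l 2 j x)
         + (esol t1 t2 l 2 i x * b 1 + a 2 * esol u1 u2 l 1 j x) - (esol t1 t2 l 3 i x * b 0 + a 3 * esol u1 u2 l 0 j x)) (at x)"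
        unfolding Q_def[abs_def] by (intro has_vector_derivative_add has_vector_derivative_diff has_vector_derivative_mult d) auto
      also have "(esol t1 t2 l 0 i x * b 3 + a 0 * esol u1 u2 l 3 j x) - (esol t1 t2 l 1 i x * b 2 + a 1 * esol u1 u2 l 2 j x)
         + (esol t1 t2 l 2 i x * b 1 + a 2 * esol u1 u2 l 1 j x) - (esol t1 t2 l 3 i x * b 0 + a 3 * esol u1 u2 l 0 j x)
         = (\<Sum>k<4. coef t1 t2 l i k x * Q k j l x) + (\<Sum>k<4. coef u1 u2 l j k x * Q i k l x)"
      proof -
        have "(\<Sum>k<4. coef t1 t2 l i k x * Q k j l x) = a 0 * esol u1 u2 l 3 j x - a 1 * esol u1 u2 l 2 j x + a 2 * esol u1 u2 l 1 j x - a 3 * esol u1 u2 l 0 j x"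
          unfolding a_def Q_def sum_distrib_right sum.distrib[symmetric] sum_subtractf[symmetric] by (intro sum.cong) (auto simp: algebra_simps)
        moreover have "(\<Sum>k<4. coef u1 u2 l j k x * Q i k l x) = esol t1 t2 l 0 i x * b 3 - esol t1 t2 l 1 i x * b 2 + esol t1 t2 l 2 i x * b 1 - esol t1 t2 l 3 i x * b 0"
          unfolding b_def Q_def sum_distrib_left sum.distrib[symmetric] sum_subtractf[symmetric] by (intro sum.cong) (auto simp: algebra_simps)
        ultimately show ?thesis by simp
      qed
      finally show "(Q i j l has_vector_derivative (\<Sum>k<4. coef t1 t2 l i k x * Q k j l x) + (\<Sum>k<4. coef u1 u2 l j k x * Q i k l x)) (at x)" .
    qed
  qed
qed

lemma Q_acon: "i < 4 \<Longrightarrow> j < 4 \<Longrightarrow> acon 0 1 (Q i j l)"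
  using esol_props(1)[of l] tilde.esol_props(1)[of l] unfolding Q_def[abs_def] lin_sol_def
  by (intro acon_add acon_diff acon_mult) auto

text \<open>At x = 0 both fundamental matrices are the identity, so Q is J there.\<close>

lemma Q_initial: "Q 0 3 l 0 = 1" "Q 2 2 l 0 = 0" "Q 2 3 l 0 = 0" "Q 3 3 l 0 = 0"
  by (simp_all add: Q_def esol_props(2) tilde.esol_props(2))

text \<open>The equation Q' = A Q + Q A~^T is read along the antidiagonals i + j = 2, 3, 4, 5, 6.
  When the entries of one antidiagonal are known, their derivatives express the next one, because
  the ones above the diagonal of A and A~ raise an index by 1. The choice l = 0 removes the
  parameter from the coefficients.\<close>

theorem coefficients_AE_eq:
  assumes zero: "\<And>i j x. i < 4 \<Longrightarrow> j < 4 \<Longrightarrow> i + j < 3 \<Longrightarrow> x \<in> {0..1} \<Longrightarrow> Q i j 0 x = 0"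
  shows "AE x in lborel. x \<in> {0<..<1} \<longrightarrow> t1 x = u1 x \<and> t2 x = u2 x"
proof -
  define q where "q i j = Q i j 0" for i j
  define D where "D i j x = (\<Sum>k<4. coef t1 t2 0 i k x * q k j x) + (\<Sum>k<4. coef u1 u2 0 j k x * q i k x)" for i j x
  have ac: "acon 0 1 (q i j)" if "i < 4" "j < 4" for i j using Q_acon[OF that] by (simp add: q_def)
  have cont: "continuous_on {0..1} (q i j)" if "i < 4" "j < 4" for i j by (rule acon_continuous_on[OF ac[OF that]])
  have dq: "AE x in lborel. x \<in> {0<..<1} \<longrightarrow> (\<forall>i<4. \<forall>j<4. (q i j has_vector_derivative D i j x) (at x))"
    using Q_derivative[of 0] by (simp add: q_def D_def)
  have z: "q 0 0 x = 0" "q 0 1 x = 0" "q 0 2 x = 0" "q 1 0 x = 0" "q 1 1 x = 0" "q 2 0 x = 0" if "x \<in> {0..1}" for x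
    using zero that by (auto simp: q_def)
  have Dz: "D i j x = 0" if "\<And>x. x \<in> {0..1} \<Longrightarrow> q i j x = c" "(q i j has_vector_derivative D i j x) (at x)" "x \<in> {0<..<1}" for i j c x
    by (rule derivative_of_constant[OF that(1) that(3) that(2)])
  note Dx = D_def coef_sum[where y = "\<lambda>k. q k _ _"] coef_sum[where y = "\<lambda>k. q _ k _"]
  have l4: "(0::nat) < 4" "(1::nat) < 4" "(2::nat) < 4" "(3::nat) < 4" by auto
  \<comment> \<open>The entries with i + j = 2 vanish identically, and their derivatives say that
    neighbouring entries with i + j = 3 add up to zero.\<close>
  have anti: "q 1 2 x = - q 0 3 x" "q 2 1 x = q 0 3 x" "q 3 0 x = - q 0 3 x" if "x \<in> {0..1}" for x
  proof -
    have ae: "AE x in lborel. x \<in> {0<..<1} \<longrightarrow> q 1 2 x + q 0 3 x = 0 \<and> q 2 1 x + q 1 2 x = 0 \<and> q 3 0 x + q 2 1 x = 0"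
      using dq
    proof eventually_elim
      case (elim x)
      show ?case
      proof
        assume x: "x \<in> {0<..<1}"
        then have x1: "x \<in> {0..1}" by auto
        have d: "(q i j has_vector_derivative D i j x) (at x)" if "i < 4" "j < 4" for i j using elim x that by blast
        have "D 0 2 x = 0" "D 1 1 x = 0" "D 2 0 x = 0"
          by (rule Dz[OF z(3) d[OF l4(1,3)] x] Dz[OF z(5) d[OF l4(2,2)] x] Dz[OF z(6) d[OF l4(3,1)] x]; assumption)+
        then show "q 1 2 x + q 0 3 x = 0 \<and> q 2 1 x + q 1 2 x = 0 \<and> q 3 0 x + q 2 1 x = 0"
          unfolding Dx using z[OF x1] by simp
      qed
    qed
    have "q 1 2 x + q 0 3 x = 0" by (rule AE_zero_continuous[OF _ _ that]) (use ae in \<open>auto intro!: continuous_intros cont elim: eventually_mono\<close>)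
    moreover have "q 2 1 x + q 1 2 x = 0" by (rule AE_zero_continuous[OF _ _ that]) (use ae in \<open>auto intro!: continuous_intros cont elim: eventually_mono\<close>)
    moreover have "q 3 0 x + q 2 1 x = 0" by (rule AE_zero_continuous[OF _ _ that]) (use ae in \<open>auto intro!: continuous_intros cont elim: eventually_mono\<close>)
    ultimately show "q 1 2 x = - q 0 3 x" "q 2 1 x = q 0 3 x" "q 3 0 x = - q 0 3 x" by algebra+
  qed
  \<comment> \<open>Differentiating the alternation gives three linear equations for q 1 3, q 3 1
    and q 2 2. As q 1 3 is also the derivative of q 0 3, the latter is constant.\<close>
  have ae1: "AE x in lborel. x \<in> {0<..<1} \<longrightarrow> (q 0 3 has_vector_derivative 0) (at x) \<and> q 1 3 x = 0 \<and> q 3 1 x = 0 \<and> q 2 2 x = (t1 x - u1 x) * q 0 3 x"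
    using dq
  proof eventually_elim
    case (elim x)
    show ?case
    proof
      assume x: "x \<in> {0<..<1}"
      then have x1: "x \<in> {0..1}" by auto
      have d: "(q i j has_vector_derivative D i j x) (at x)" if "i < 4" "j < 4" for i j using elim x that by blast
      have sum0: "A + B = 0" if "\<And>x. x \<in> {0..1} \<Longrightarrow> f x + g x = 0" "(f has_vector_derivative A) (at x)" "(g has_vector_derivative B) (at x)"
        for f g :: "real \<Rightarrow> complex" and A B
        by (rule derivative_of_constant[of "\<lambda>x. f x + g x" 0, OF that(1) x]) (use that in \<open>auto intro: has_vector_derivative_add\<close>)
      have diff0: "A - B = 0" if "\<And>x. x \<in> {0..1} \<Longrightarrow> f x - g x = 0" "(f has_vector_derivative A) (at x)" "(g has_vector_derivative B) (at x)"
        for f g :: "real \<Rightarrow> complex" and A B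
        by (rule derivative_of_constant[of "\<lambda>x. f x - g x" 0, OF that(1) x]) (use that in \<open>auto intro: has_vector_derivative_diff\<close>)
      have 1: "D 1 2 x + D 0 3 x = 0" by (rule sum0[of "q 1 2" "q 0 3", OF _ d d]) (use anti in auto)
      have 2: "D 2 1 x - D 0 3 x = 0" by (rule diff0[of "q 2 1" "q 0 3", OF _ d d]) (use anti in auto)
      have 3: "D 3 0 x + D 0 3 x = 0" by (rule sum0[of "q 3 0" "q 0 3", OF _ d d]) (use anti in auto)
      have e0: "D 0 3 x = q 1 3 x" unfolding Dx using z[OF x1] by simp
      have e1: "D 1 2 x = t1 x * q 1 2 x + q 2 2 x - u1 x * q 1 2 x + q 1 3 x" unfolding Dx using z[OF x1] by simp
      have e2: "D 2 1 x = - t1 x * q 2 1 x + q 3 1 x + u1 x * q 2 1 x + q 2 2 x" unfolding Dx using z[OF x1] by simp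
      have e3: "D 3 0 x = q 3 1 x" unfolding Dx using z[OF x1] by simp
      have E: "- (t1 x * q 0 3 x) + q 2 2 x + u1 x * q 0 3 x + q 1 3 x + q 1 3 x = 0"
        "- (t1 x * q 0 3 x) + q 3 1 x + u1 x * q 0 3 x + q 2 2 x - q 1 3 x = 0" "q 3 1 x + q 1 3 x = 0"
        using 1 2 3 unfolding e0 e1 e2 e3 anti[OF x1] by simp_all
      then have q13: "q 1 3 x = 0" by algebra
      with E have "q 3 1 x = 0" "q 2 2 x = (t1 x - u1 x) * q 0 3 x" by algebra+
      then show "(q 0 3 has_vector_derivative 0) (at x) \<and> q 1 3 x = 0 \<and> q 3 1 x = 0 \<and> q 2 2 x = (t1 x - u1 x) * q 0 3 x"
        using d[of 0 3] q13 unfolding e0 by simp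
    qed
  qed
  have q03: "q 0 3 x = 1" if "x \<in> {0..1}" for x
  proof -
    have "q 0 3 x = q 0 3 0" by (rule acon_AE_derivative_zero[OF ac _ that]) (use ae1 in \<open>auto elim: eventually_mono\<close>)
    then show ?thesis by (simp add: q_def Q_initial)
  qed
  have q13: "q 1 3 x = 0" if "x \<in> {0..1}" for x
    by (rule AE_zero_continuous[OF cont _ that]) (use ae1 in \<open>auto elim: eventually_mono\<close>)
  have q31: "q 3 1 x = 0" if "x \<in> {0..1}" for x
    by (rule AE_zero_continuous[OF cont _ that]) (use ae1 in \<open>auto elim: eventually_mono\<close>)
  \<comment> \<open>The derivatives of the vanishing entries q 1 3 and q 3 1 identify q 2 3 and q 3
    2 with t2 - u2. After these substitutions the derivatives of q 2 2 and q 3 3 cancel completely,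
    so both are constant with initial value 0.\<close>
  have ae2: "AE x in lborel. x \<in> {0<..<1} \<longrightarrow> (q 2 2 has_vector_derivative 0) (at x) \<and> (q 3 3 has_vector_derivative 0) (at x) \<and>
      q 2 2 x = t1 x - u1 x \<and> q 2 3 x = t2 x - u2 x \<and> (q 2 3 has_vector_derivative q 3 3 x + (t1 x - u1 x) * u2 x - u2 x * q 2 2 x) (at x)"
    using dq ae1
  proof eventually_elim
    case (elim x)
    show ?case
    proof
      assume x: "x \<in> {0<..<1}"
      then have x1: "x \<in> {0..1}" by auto
      have d: "(q i j has_vector_derivative D i j x) (at x)" if "i < 4" "j < 4" for i j using elim(1) x that by blast
      note zz = z[OF x1] anti[OF x1] q03[OF x1] q13[OF x1] q31[OF x1]
      have q22: "q 2 2 x = t1 x - u1 x" using elim(2) x q03[OF x1] by simp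
      have "D 1 3 x = 0" "D 3 1 x = 0" by (rule Dz[OF q13 d[OF l4(2,4)] x] Dz[OF q31 d[OF l4(4,2)] x]; assumption)+
      then have "- t2 x + q 2 3 x + u2 x = 0" "u2 x + q 3 2 x = t2 x" unfolding Dx zz by simp_all
      then have q23: "q 2 3 x = t2 x - u2 x" "q 3 2 x = t2 x - u2 x" by algebra+
      have "D 2 2 x = 0" unfolding Dx zz q22 q23 by (simp add: algebra_simps power2_eq_square)
      moreover have "D 3 3 x = 0" unfolding Dx zz q22 q23 by (simp add: algebra_simps power2_eq_square)
      moreover have "D 2 3 x = q 3 3 x + (t1 x - u1 x) * u2 x - u2 x * q 2 2 x" unfolding Dx zz q23 by (simp add: algebra_simps)
      ultimately show "(q 2 2 has_vector_derivative 0) (at x) \<and> (q 3 3 has_vector_derivative 0) (at x) \<and>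
        q 2 2 x = t1 x - u1 x \<and> q 2 3 x = t2 x - u2 x \<and> (q 2 3 has_vector_derivative q 3 3 x + (t1 x - u1 x) * u2 x - u2 x * q 2 2 x) (at x)"
        using d[of 2 2] d[of 3 3] d[of 2 3] q22 q23 by simp
    qed
  qed
  have q22: "q 2 2 x = 0" if "x \<in> {0..1}" for x
  proof -
    have "q 2 2 x = q 2 2 0" by (rule acon_AE_derivative_zero[OF ac _ that]) (use ae2 in \<open>auto elim: eventually_mono\<close>)
    then show ?thesis by (simp add: q_def Q_initial)
  qed
  have q33: "q 3 3 x = 0" if "x \<in> {0..1}" for x
  proof -
    have "q 3 3 x = q 3 3 0" by (rule acon_AE_derivative_zero[OF ac _ that]) (use ae2 in \<open>auto elim: eventually_mono\<close>)
    then show ?thesis by (simp add: q_def Q_initial)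
  qed
  \<comment> \<open>Since t1 - u1 = q 2 2 and q 3 3 are zero by now, nothing is left of the
    derivative of q 2 3, the continuous representative of t2 - u2.\<close>
  have "AE x in lborel. x \<in> {0<..<1} \<longrightarrow> (q 2 3 has_vector_derivative 0) (at x)"
    using ae2
  proof eventually_elim
    case (elim x)
    show ?case
    proof
      assume x: "x \<in> {0<..<1}"
      then have x1: "x \<in> {0..1}" by auto
      then have "t1 x - u1 x = 0" "q 3 3 x = 0" "q 2 2 x = 0" using elim x q22[OF x1] q33[OF x1] by auto
      then show "(q 2 3 has_vector_derivative 0) (at x)" using elim x by simp
    qed
  qed
  then have q23: "q 2 3 x = 0" if "x \<in> {0..1}" for x
    using acon_AE_derivative_zero[OF ac[of 2 3] _ that] by (simp add: q_def Q_initial)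
  show ?thesis
    using ae2
  proof eventually_elim
    case (elim x)
    then show ?case using q22[of x] q23[of x] by auto
  qed
qed

end

section \<open>From equality almost everywhere to equality of distributions\<close>

lemma distr_deriv_cong_AE:
  assumes "L2_01 f" "L2_01 g" and ae: "AE x in lborel. x \<in> {0<..<1} \<longrightarrow> f x = g x" and "test_fun \<phi>"
  shows "distr_deriv k f \<phi> = distr_deriv k g \<phi>"
proof -
  let ?\<psi> = "vderiv_iter k \<phi>"
  have "continuous_on UNIV ?\<psi>"
    using assms(4) unfolding test_fun_def
    by (auto simp: continuous_on_eq_continuous_at intro: differentiable_imp_continuous_within)
  then have \<psi>: "?\<psi> \<in> borel_measurable lborel" by (simp add: borel_measurable_continuous_onI)
  have meas: "(\<lambda>x. indicat_real {0..1} x *\<^sub>R (h x * ?\<psi> x)) \<in> borel_measurable lborel" if "L2_01 h" for h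
  proof -
    have "(\<lambda>x. (indicat_real {0..1} x *\<^sub>R h x) * ?\<psi> x) \<in> borel_measurable lborel"
      using that \<psi> by (intro borel_measurable_times) (auto simp: L2_01_def set_borel_measurable_def)
    then show ?thesis by simp
  qed
  have "AE x in lborel. x \<noteq> 0 \<and> x \<noteq> (1::real)"
    using AE_lborel_singleton[of 0] AE_lborel_singleton[of 1] by eventually_elim simp
  with ae have "AE x in lborel. indicat_real {0..1} x *\<^sub>R (f x * ?\<psi> x) = indicat_real {0..1} x *\<^sub>R (g x * ?\<psi> x)"
    by eventually_elim (auto simp: indicator_def)
  then have "(LINT x:{0..1}|lborel. f x * ?\<psi> x) = (LINT x:{0..1}|lborel. g x * ?\<psi> x)"
    unfolding set_lebesgue_integral_def by (intro integral_cong_AE meas assms)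
  then show ?thesis by (simp add: distr_deriv_def)
qed

theorem theorem2p2:
  fixes \<tau>1 \<tau>2 \<tau>1' \<tau>2' :: "real \<Rightarrow> complex"
  assumes "L2_01 \<tau>1" and "L2_01 \<tau>2" and "L2_01 \<tau>1'" and "L2_01 \<tau>2'"
    and "separation 4 (Fmat \<tau>1 \<tau>2)" and "separation 4 (Fmat \<tau>1' \<tau>2')"
    and "spectrum 4 (Fmat \<tau>1 \<tau>2) (W_ij 1 2) = spectrum 4 (Fmat \<tau>1' \<tau>2') (W_ij 1 2)"
    and "spectrum 4 (Fmat \<tau>1 \<tau>2) (W_ij 1 3) = spectrum 4 (Fmat \<tau>1' \<tau>2') (W_ij 1 3)"
    and "spectrum 4 (Fmat \<tau>1 \<tau>2) (W_ij 2 3) = spectrum 4 (Fmat \<tau>1' \<tau>2') (W_ij 2 3)"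
  shows "(\<forall>\<phi>. test_fun \<phi> \<longrightarrow> distr_deriv 1 \<tau>1 \<phi> = distr_deriv 1 \<tau>1' \<phi>)
       \<and> (\<forall>\<phi>. test_fun \<phi> \<longrightarrow> distr_deriv 2 \<tau>2 \<phi> = distr_deriv 2 \<tau>2' \<phi>)"
proof -
  interpret fourth_order_pair \<tau>1 \<tau>2 \<tau>1' \<tau>2'
    by unfold_locales (rule assms)+
  obtain c where c: "c \<noteq> 0" "\<And>l. minor \<tau>1 \<tau>2 0 1 l = c * minor \<tau>1' \<tau>2' 0 1 l"
    "\<And>l. minor \<tau>1 \<tau>2 0 2 l = c * minor \<tau>1' \<tau>2' 0 2 l" "\<And>l. minor \<tau>1 \<tau>2 0 3 l = c * minor \<tau>1' \<tau>2' 0 3 l"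
    using minors_proportional[OF assms(7-9)] by blast
  have "AE x in lborel. x \<in> {0<..<1} \<longrightarrow> \<tau>1 x = \<tau>1' x \<and> \<tau>2 x = \<tau>2' x"
    by (intro coefficients_AE_eq Q_upper_zero[OF c minor_13_proportional[OF assms(5) c]])
  then have "AE x in lborel. x \<in> {0<..<1} \<longrightarrow> \<tau>1 x = \<tau>1' x" "AE x in lborel. x \<in> {0<..<1} \<longrightarrow> \<tau>2 x = \<tau>2' x"
    by (auto elim: eventually_mono)
  then show ?thesis using distr_deriv_cong_AE assms(1-4) by blast
qed

end
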